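(* Let $n>2$, let $\lambda$ be a nondegenerate character of the associative algebra $\mathfrak{g}_+$, let $S\subset\Pi$ and $a\in\Lambda_S$. Then the defining ideal $\mathcal{I}_{S,a}$ of the coadjoint orbit $\overline{\Omega}_{S,a}(\lambda)\subset\overline{\mathfrak g}^*$ of $\lambda_{S,a}$ under $\mathrm{UT}(n,\overline{\mathbb{F}}_q)$ is generated by the algebraically independent system of polynomials $$\{\mathcal{F}_\gamma-\mathcal{F}_\gamma^0:\ \gamma\in S\sqcup L_S\}.$$
   Context: Let $\mathbb{F}_q$ be a finite field with $q$ elements (arbitrary characteristic), $n>2$. $\mathfrak{g}$ is the associative algebra (and Lie algebra with $[x,y]=xy-yx$) of strictly upper triangular $n\times n$ matrices over $\mathbb{F}_q$, $E$ is the identity matrix. A root is a pair $(i,j)$ with $1\le i<j\le n$; $R$ is the set of roots and $E_{(i,j)}=E_{ij}$ is the matrix unit. Put $R_+=\{(i,j)\in R: i+j<n+1\}$ and $\mathfrak{g}_+=\mathrm{span}\{E_\alpha:\alpha\in R_+\}$, a subalgebra of $\mathfrak g$. Let $k=[\frac{n-1}{2}]$, $\Pi_0=\{(i,i+1):1\le i\le k\}$, $\Pi=\{(i,n-i):1\le i\le k\}$. A character of an associative algebra $\mathfrak{a}$ is a linear form on $\mathfrak{a}$ vanishing on $\mathfrak{a}^2$. A character $\lambda:\mathfrak{g}_+\to\mathbb{F}_q$ is nondegenerate if $\lambda(E_\gamma)\neq0$ for all $\gamma\in\Pi\setminus\Pi_0$. A root $(i,j)$ is viewed as a box in row $i$ and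 column $j$ of an $n\times n$ matrix. For $S\subset\Pi$ define: - $L_S^0$: all roots $\gamma=(i,j)$ with $1\le i\le k$, $i+j\ge n+1$, such that (ii) there is no root of $S$ in the $i$th row and none in the $j$th column, and (iii) all roots of $\Pi$ lying strictly above and strictly to the left of $\gamma$ belong to $S$. - $L_S^{00}$: empty if $n$ is odd; if $n=2(k+1)$, it consists of the single root $(k+1,j)$ satisfying (ii) and (iii). - $L_S^+$: all roots $\gamma=(i,j)$ with $1\le i\le k$, $i+j\ge n+1$, $(i,n-i)\in S$, no root of $S$ in the $j$th column, and all roots of $\Pi$ lying strictly above and strictly to the left of $\gamma$ belonging to $S$. - $L_S^-=\{(n-i,j):(i,j)\in L_S^+\}$. - $L_S=L_S^+\sqcup L_S^0\sqcup L_S^{00}\sqcup L_S^-$. $\Lambda_S$ is the set of all functions $a:L_S^0\sqcup L_S^{00}\sqcup L_S^-\to\mathbb{F}_q$ with $a(\gamma)\ne0$ for all $\gamma\in L_S^0$. For $a\in\Lambda_S$ the linear form $\lambda_{S,a}$ on $\mathfrak{g}$ is defined by: $\lambda_{S,a}(E_\gamma)=\lambda(E_\gamma)$ for $\gamma\in(\Pi_0\setminus\Pi)\cup S$; $\lambda_{S,a}(E_\gamma)=a(\gamma)$ for $\gamma\in L_S^0\sqcup L_S^{00}\sqcup L_S^-$; $\lambda_{S,a}(E_\gamma)=0$ for all other roots $\gamma$. $\overline{\mathbb{F}}_q$ is an algebraic closure of $\mathbb{F}_q$, $\overline{\mathfrak g}=\mathfrak g\otimes\overline{\mathbb{F}}_q$,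 and $\overline{\Omega}_{S,a}(\lambda)$ is the orbit of $\lambda_{S,a}$ (extended linearly to $\overline{\mathfrak g}$) under the coadjoint action of $\overline G=\mathrm{UT}(n,\overline{\mathbb{F}}_q)$ on $\overline{\mathfrak g}^*$; it is Zariski closed. $\mathcal{I}_{S,a}$ is the ideal of all polynomials in the symmetric algebra $\mathcal{S}(\overline{\mathfrak g})=\overline{\mathbb{F}}_q[\overline{\mathfrak g}^*]$ (a polynomial ring in the $E_{ij}$, $i<j$, with $E_{ij}(\mu)=\mu(E_{ij})$) vanishing on this orbit. $\mathbb{X}$ is the upper triangular $n\times n$ matrix with entries in $\mathcal{S}(\overline{\mathfrak g})$, zero on and below the diagonal, whose $(i,j)$ entry for $i<j$ is the variable $E_{ij}$. For a root $\gamma$, let $\mathbb{S}_\gamma$ be the set consisting of $\gamma$ and all roots of $S\sqcup L_S^0$ lying strictly above and strictly to the right of $\gamma$; $\mathcal{M}_\gamma$ is the minor of $\mathbb{X}$ whose set of rows (resp. columns) is the set of rows (resp. columns) of the roots in $\mathbb{S}_\gamma$. For $\gamma=(n-i,j)\in L_S^-$, let $|\mathbb{X}-\tau E|_i$ be the determinant of the matrix obtained from the characteristic matrix $\mathbb{X}-\tau E$ by deleting the first $i$ columns and the last $i$ rows, and write $$|\mathbb{X}-\tau E|_i=\mathcal{P}_{\gamma,0}\tau^{n-2i}+\mathcal{P}_{\gamma,1}\tau^{n-2i-1}+\dots+\mathcal{P}_{\gamma,n-2i}.$$ Set $\mathcal{F}_\gamma=\mathcal{M}_\gamma$ if $\gamma\in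 S\sqcup L_S^+\sqcup L_S^0\sqcup L_S^{00}$, and $\mathcal{F}_\gamma=\mathcal{P}_{\gamma,1}$ if $\gamma\in L_S^-$. $\mathcal{F}_\gamma^0$ denotes the value of $\mathcal{F}_\gamma$ at the point $\lambda_{S,a}$.
   Formalization: The ideal equality additionally assumes λ(E_γ) ≠ 0 for all γ ∈ S∩Π_0 (relevant only for n = 2k+1 with (k,k+1) ∈ S); without it the claim fails, e.g. n = 3, λ = 0, S = {(1,2)}; algebraic independence is proved unconditionally. *)

theory Defs
  imports
    "Jordan_Normal_Form.VS_Connect"
    "Jordan_Normal_Form.Determinant"
    "Jordan_Normal_Form.DL_Submatrix"
    "HOL-Algebra.Algebraic_Closure_Type"
    "HOL-Library.Poly_Mapping"
    "HOL-Library.FuncSet"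
begin

section \<open>Roots\<close>

text \<open>Roots carry 1-based indices, while entries of the type 'a mat are 0-based: the root
  \<open>(i, j)\<close> is the matrix position \<open>(i - 1, j - 1)\<close>.\<close>

type_synonym root = "nat \<times> nat"

definition roots :: "nat \<Rightarrow> root set" where
  "roots n = {(i, j). 1 \<le> i \<and> i < j \<and> j \<le> n}"

definition roots_plus :: "nat \<Rightarrow> root set" where
  "roots_plus n = {(i, j) \<in> roots n. i + j < n + 1}"

definition kk :: "nat \<Rightarrow> nat" where
  "kk n = (n - 1) div 2"

definition Pi0_roots :: "nat \<Rightarrow> root set" where
  "Pi0_roots n = {(i, i + 1) | i. 1 \<le> i \<and> i \<le> kk n}"

definition Pi_roots :: "nat \<Rightarrow> root set" where
  "Pi_roots n = {(i, n - i) | i. 1 \<le> i \<and> i \<le> kk n}"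

definition no_root_in_row :: "root set \<Rightarrow> nat \<Rightarrow> bool" where
  "no_root_in_row S i \<longleftrightarrow> (\<forall>\<beta>\<in>S. fst \<beta> \<noteq> i)"

definition no_root_in_column :: "root set \<Rightarrow> nat \<Rightarrow> bool" where
  "no_root_in_column S j \<longleftrightarrow> (\<forall>\<beta>\<in>S. snd \<beta> \<noteq> j)"

definition above_left_in :: "nat \<Rightarrow> root set \<Rightarrow> root \<Rightarrow> bool" where
  "above_left_in n S \<gamma> \<longleftrightarrow>
     (\<forall>\<beta>\<in>Pi_roots n. fst \<beta> < fst \<gamma> \<and> snd \<beta> < snd \<gamma> \<longrightarrow> \<beta> \<in> S)"

definition L_zero :: "nat \<Rightarrow> root set \<Rightarrow> root set" where
  "L_zero n S = {(i, j) \<in> roots n. 1 \<le> i \<and> i \<le> kk n \<and> i + j \<ge> n + 1 \<and>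
     no_root_in_row S i \<and> no_root_in_column S j \<and> above_left_in n S (i, j)}"

definition L_zerozero :: "nat \<Rightarrow> root set \<Rightarrow> root set" where
  "L_zerozero n S = (if odd n then {} else {(i, j) \<in> roots n. i = kk n + 1 \<and>
     no_root_in_row S i \<and> no_root_in_column S j \<and> above_left_in n S (i, j)})"

definition L_plus :: "nat \<Rightarrow> root set \<Rightarrow> root set" where
  "L_plus n S = {(i, j) \<in> roots n. 1 \<le> i \<and> i \<le> kk n \<and> i + j \<ge> n + 1 \<and>
     (i, n - i) \<in> S \<and> no_root_in_column S j \<and> above_left_in n S (i, j)}"

definition L_minus :: "nat \<Rightarrow> root set \<Rightarrow> root set" where
  "L_minus n S = {(n - i, j) | i j. (i, j) \<in> L_plus n S}"

definition L_roots :: "nat \<Rightarrow> root set \<Rightarrow> root set" where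
  "L_roots n S = L_plus n S \<union> L_zero n S \<union> L_zerozero n S \<union> L_minus n S"


section \<open>Matrix algebras, characters, coadjoint orbits\<close>

definition mat_unit :: "nat \<Rightarrow> root \<Rightarrow> 'a :: field mat" where
  "mat_unit n \<gamma> = mat n n (\<lambda>(r, c). if (r + 1, c + 1) = \<gamma> then 1 else 0)"

definition strict_upper :: "nat \<Rightarrow> 'a :: field mat set" where
  "strict_upper n = {x \<in> carrier_mat n n. \<forall>r<n. \<forall>c<n. c \<le> r \<longrightarrow> x $$ (r, c) = 0}"

definition span_of_mats :: "nat \<Rightarrow> 'a :: field mat set \<Rightarrow> 'a mat set" where
  "span_of_mats n B = LinearCombinations.module.span class_ring (module_mat TYPE('a) n n) B"

definition g_plus :: "nat \<Rightarrow> 'a :: field mat set" where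
  "g_plus n = span_of_mats n (mat_unit n ` roots_plus n)"

definition linear_form_on :: "'a :: field mat set \<Rightarrow> ('a mat \<Rightarrow> 'a) \<Rightarrow> bool" where
  "linear_form_on A f \<longleftrightarrow>
     (\<forall>x\<in>A. \<forall>y\<in>A. f (x + y) = f x + f y) \<and> (\<forall>c. \<forall>x\<in>A. f (c \<cdot>\<^sub>m x) = c * f x)"

definition alg_square :: "nat \<Rightarrow> 'a :: field mat set \<Rightarrow> 'a mat set" where
  "alg_square n A = span_of_mats n {x * y | x y. x \<in> A \<and> y \<in> A}"

definition is_character :: "nat \<Rightarrow> 'a :: field mat set \<Rightarrow> ('a mat \<Rightarrow> 'a) \<Rightarrow> bool" where
  "is_character n A f \<longleftrightarrow> linear_form_on A f \<and> (\<forall>x\<in>alg_square n A. f x = 0)"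

text \<open>For \<open>n = 2k + 1\<close> the root \<open>(k, k + 1)\<close> belongs to both \<open>Pi_roots n\<close> and
  \<open>Pi0_roots n\<close>, so nondegeneracy does not constrain the character there. If this root is in
  \<open>S\<close> and the character vanishes on it, the polynomials below need not generate the ideal of
  the orbit: for \<open>n = 3\<close>, \<open>S = {(1, 2)}\<close>, \<open>lam = 0\<close> the orbit is a point with ideal
  \<open>(E12, E13, E23 - a(2,3))\<close>, while the polynomials are \<open>E12\<close>, \<open>E13\<close>, \<open>E12 * E23\<close>.\<close>

definition nondegenerate :: "nat \<Rightarrow> ('a :: field mat \<Rightarrow> 'a) \<Rightarrow> bool" where
  "nondegenerate n lam \<longleftrightarrow> (\<forall>\<gamma>\<in>Pi_roots n - Pi0_roots n. lam (mat_unit n \<gamma>) \<noteq> 0)"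

text \<open>Linear forms on the strictly upper triangular matrices are represented by functions that
  are restricted to that set; \<open>form_with n f\<close> is the linear form with value
  \<open>f \<gamma>\<close> on the matrix unit of each root \<open>\<gamma>\<close>.\<close>

definition form_with :: "nat \<Rightarrow> (root \<Rightarrow> 'a :: field) \<Rightarrow> 'a mat \<Rightarrow> 'a" where
  "form_with n f =
     (\<lambda>x\<in>strict_upper n. \<Sum>\<gamma>\<in>roots n. f \<gamma> * x $$ (fst \<gamma> - 1, snd \<gamma> - 1))"

definition Lambda_set :: "nat \<Rightarrow> root set \<Rightarrow> (root \<Rightarrow> 'a :: field) set" where
  "Lambda_set n S = {a \<in> (L_zero n S \<union> L_zerozero n S \<union> L_minus n S) \<rightarrow>\<^sub>E UNIV.
     \<forall>\<gamma>\<in>L_zero n S. a \<gamma> \<noteq> 0}"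

definition lambda_Sa ::
    "nat \<Rightarrow> ('a :: field mat \<Rightarrow> 'a) \<Rightarrow> root set \<Rightarrow> (root \<Rightarrow> 'a) \<Rightarrow> 'a mat \<Rightarrow> 'a" where
  "lambda_Sa n lam S a = form_with n (\<lambda>\<gamma>.
     if \<gamma> \<in> (Pi0_roots n - Pi_roots n) \<union> S then lam (mat_unit n \<gamma>)
     else if \<gamma> \<in> L_zero n S \<union> L_zerozero n S \<union> L_minus n S then a \<gamma>
     else 0)"

definition extend_form ::
    "nat \<Rightarrow> ('a :: field mat \<Rightarrow> 'a) \<Rightarrow> 'a alg_closure mat \<Rightarrow> 'a alg_closure" where
  "extend_form n \<mu> = form_with n (\<lambda>\<gamma>. to_ac (\<mu> (mat_unit n \<gamma>)))"

definition unitriangular :: "nat \<Rightarrow> 'a :: field mat set" where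
  "unitriangular n = {g \<in> carrier_mat n n. upper_triangular g \<and> (\<forall>r<n. g $$ (r, r) = 1)}"

definition coadjoint :: "nat \<Rightarrow> 'a :: field mat \<Rightarrow> ('a mat \<Rightarrow> 'a) \<Rightarrow> 'a mat \<Rightarrow> 'a" where
  "coadjoint n g \<mu> =
     (\<lambda>x\<in>strict_upper n. \<mu> (inv\<^bsub>ring_mat TYPE('a) n ()\<^esub> g * x * g))"

definition orbit_Sa ::
    "nat \<Rightarrow> ('a :: field mat \<Rightarrow> 'a) \<Rightarrow> root set \<Rightarrow> (root \<Rightarrow> 'a)
      \<Rightarrow> ('a alg_closure mat \<Rightarrow> 'a alg_closure) set" where
  "orbit_Sa n lam S a =
     (\<lambda>g. coadjoint n g (extend_form n (lambda_Sa n lam S a))) ` unitriangular n"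


section \<open>Multivariate polynomials\<close>

type_synonym ('v, 'c) mpolynomial = "('v \<Rightarrow>\<^sub>0 nat) \<Rightarrow>\<^sub>0 'c"

definition mvar :: "'v \<Rightarrow> ('v, 'c :: comm_ring_1) mpolynomial" where
  "mvar v = Poly_Mapping.single (Poly_Mapping.single v 1) 1"

definition mconst :: "'c \<Rightarrow> ('v, 'c :: comm_ring_1) mpolynomial" where
  "mconst c = Poly_Mapping.single 0 c"

text \<open>Substitution of \<open>f v\<close> for each variable \<open>v\<close>, the coefficients
  being mapped to the target ring by the structure map \<open>h\<close>.\<close>

definition msubst ::
    "('c :: comm_ring_1 \<Rightarrow> 'r :: comm_ring_1) \<Rightarrow> ('v \<Rightarrow> 'r) \<Rightarrow> ('v, 'c) mpolynomial \<Rightarrow> 'r" where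
  "msubst h f p = (\<Sum>m\<in>Poly_Mapping.keys p. h (Poly_Mapping.lookup p m) *
     (\<Prod>v\<in>Poly_Mapping.keys m. f v ^ Poly_Mapping.lookup m v))"

definition mpolys_in :: "'v set \<Rightarrow> ('v, 'c :: comm_ring_1) mpolynomial set" where
  "mpolys_in V = {p. \<forall>m\<in>Poly_Mapping.keys p. Poly_Mapping.keys m \<subseteq> V}"

definition alg_independent ::
    "('c :: comm_ring_1 \<Rightarrow> 'r :: comm_ring_1) \<Rightarrow> 'v set \<Rightarrow> ('v \<Rightarrow> 'r) \<Rightarrow> bool" where
  "alg_independent h V f \<longleftrightarrow>
     (\<forall>p \<in> mpolys_in V :: ('v, 'c) mpolynomial set. msubst h f p = 0 \<longrightarrow> p = 0)"

text \<open>The symmetric algebra of the strictly upper triangular matrices, as the polynomial ring in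
  the variables \<open>mvar \<gamma>\<close>, \<open>\<gamma> \<in> roots n\<close>.\<close>

definition sym_alg :: "nat \<Rightarrow> (root, 'c :: comm_ring_1) mpolynomial ring" where
  "sym_alg n = \<lparr>carrier = mpolys_in (roots n), monoid.mult = (*), one = 1, zero = 0, add = (+)\<rparr>"

definition value_at ::
    "nat \<Rightarrow> ('c :: field mat \<Rightarrow> 'c) \<Rightarrow> (root, 'c) mpolynomial \<Rightarrow> 'c" where
  "value_at n \<mu> p = msubst (\<lambda>c. c) (\<lambda>\<gamma>. \<mu> (mat_unit n \<gamma>)) p"

definition ideal_Sa ::
    "nat \<Rightarrow> ('a :: field mat \<Rightarrow> 'a) \<Rightarrow> root set \<Rightarrow> (root \<Rightarrow> 'a)
      \<Rightarrow> (root, 'a alg_closure) mpolynomial set" where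
  "ideal_Sa n lam S a =
     {p \<in> carrier (sym_alg n). \<forall>\<mu>\<in>orbit_Sa n lam S a. value_at n \<mu> p = 0}"


section \<open>The polynomials attached to roots\<close>

definition generic_mat :: "nat \<Rightarrow> (root, 'c :: comm_ring_1) mpolynomial mat" where
  "generic_mat n = mat n n (\<lambda>(r, c). if r < c then mvar (r + 1, c + 1) else 0)"

definition S_gamma :: "nat \<Rightarrow> root set \<Rightarrow> root \<Rightarrow> root set" where
  "S_gamma n S \<gamma> =
     insert \<gamma> {\<beta> \<in> S \<union> L_zero n S. fst \<beta> < fst \<gamma> \<and> snd \<beta> > snd \<gamma>}"

definition M_poly :: "nat \<Rightarrow> root set \<Rightarrow> root \<Rightarrow> (root, 'c :: comm_ring_1) mpolynomial" where
  "M_poly n S \<gamma> = det (submatrix (generic_mat n)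
     ((\<lambda>\<beta>. fst \<beta> - 1) ` S_gamma n S \<gamma>) ((\<lambda>\<beta>. snd \<beta> - 1) ` S_gamma n S \<gamma>))"

text \<open>The characteristic matrix is taken over the univariate polynomials (in \<open>\<tau>\<close>)
  with coefficients in the symmetric algebra.\<close>

definition tau_char_mat :: "nat \<Rightarrow> (root, 'c :: comm_ring_1) mpolynomial poly mat" where
  "tau_char_mat n = map_mat (\<lambda>p. [:p:]) (generic_mat n) - [:0, 1:] \<cdot>\<^sub>m 1\<^sub>m n"

definition tau_minor :: "nat \<Rightarrow> nat \<Rightarrow> (root, 'c :: comm_ring_1) mpolynomial poly" where
  "tau_minor n i = det (submatrix (tau_char_mat n) {..<n - i} {i..<n})"

definition P_poly :: "nat \<Rightarrow> root \<Rightarrow> nat \<Rightarrow> (root, 'c :: comm_ring_1) mpolynomial" where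
  "P_poly n \<gamma> m = (let i = n - fst \<gamma> in Polynomial.coeff (tau_minor n i) (n - 2 * i - m))"

definition F_poly :: "nat \<Rightarrow> root set \<Rightarrow> root \<Rightarrow> (root, 'c :: comm_ring_1) mpolynomial" where
  "F_poly n S \<gamma> = (if \<gamma> \<in> L_minus n S then P_poly n \<gamma> 1 else M_poly n S \<gamma>)"

definition F_gen ::
    "nat \<Rightarrow> ('a :: field mat \<Rightarrow> 'a) \<Rightarrow> root set \<Rightarrow> (root \<Rightarrow> 'a) \<Rightarrow> root
      \<Rightarrow> (root, 'a alg_closure) mpolynomial" where
  "F_gen n lam S a \<gamma> =
     F_poly n S \<gamma> - mconst (value_at n (extend_form n (lambda_Sa n lam S a)) (F_poly n S \<gamma>))"

end

theory Submission
  imports Defs "Jordan_Normal_Form.Char_Poly"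
begin

text \<open>Order the roots of \<open>S \<squnion> L\<^sub>S\<close> by rows. Each \<open>\<F>\<^sub>\<gamma>\<close> is linear in the variable
  \<open>E\<^sub>\<gamma>\<close> and otherwise involves only variables of earlier rows and variables not in
  \<open>S \<squnion> L\<^sub>S\<close>; the coefficient of \<open>E\<^sub>\<gamma>\<close> is, up to sign, a minor which does not vanish
  where the entries in \<open>S \<squnion> L\<^sub>S\<^sup>0\<close> are nonzero and all others are zero. A Jacobian argument at
  such a point gives algebraic independence.

  On the orbit of \<open>\<lambda>\<^sub>S\<^sub>,\<^sub>a\<close> the \<open>\<F>\<^sub>\<gamma>\<close> and these coefficients are constant: the minors
  because the matrix of \<open>\<lambda>\<^sub>S\<^sub>,\<^sub>a\<close> is supported, weakly to the upper right of \<open>\<gamma>\<close>, on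
  \<open>\<S>\<^sub>\<gamma>\<close>, and \<open>P\<^sub>\<gamma>\<^sub>,\<^sub>1\<close> because it equals \<open>tr (adj A U V)\<close> up to sign for
  blocks \<open>A\<close>, \<open>U\<close>, \<open>V\<close> of \<open>\<X>\<close>, with \<open>det A = 0\<close> on the orbit.

  The projection of the orbit to the coordinates outside \<open>S \<squnion> L\<^sub>S\<close> is dense, because the
  differential of the orbit map at the identity, given by \<open>y \<mapsto> \<lambda>([E\<^sub>\<delta>, y])\<close>, is onto
  these coordinates: pairing each such root with a suitable partner makes the matrix of the commutator
  form triangular. Hence a polynomial in the remaining variables that is constant on the orbit is
  constant, so modulo the ideal generated by the \<open>\<F>\<^sub>\<gamma> - \<F>\<^sub>\<gamma>\<^sup>0\<close> the coefficients above are
  units, every \<open>E\<^sub>\<gamma>\<close> can be eliminated, and what remains of a polynomial vanishing on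
  the orbit is zero.\<close>

text \<open>Writing columns as n - m turns all the combinatorics into statements about the set
  \<open>rows\<close> of rows met by S. The pivots, i.e. the roots of S and \<open>L_zero\<close>,
  are one per row i \<le> k, at column n - \<open>pcol i\<close>, and at most one per column. This
  makes the matrix of the form monomial on the index sets of the minors. The difficulty lies in
  \<open>L_minus\<close>, whose polynomials are not minors. Conjugation changes U V by terms A E and
  E A, and \<open>det_deriv A\<close> kills these because A times its adjugate is det A = 0. Here
  det A vanishes because the pivot of row i is in column n - i, immediately left of A. The
  coefficient of the leading variable is, up to sign, the minor attached to the pivot (i, n - i)
  itself. That value must be nonzero, which is where the premise on
  \<open>S \<inter> Pi0_roots n\<close> enters, through \<open>admissible\<close>. Both differential
  arguments use polynomial curves and the form of lowest degree at the starting point; this needs an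
  infinite field and is insensitive to the characteristic.\<close>

abbreviation (input) mkeys :: "('k \<Rightarrow>\<^sub>0 'b :: zero) \<Rightarrow> 'k set" where "mkeys \<equiv> Poly_Mapping.keys"
abbreviation (input) mlookup :: "('k \<Rightarrow>\<^sub>0 'b :: zero) \<Rightarrow> 'k \<Rightarrow> 'b" where "mlookup \<equiv> Poly_Mapping.lookup"
abbreviation (input) pcoeff :: "'b :: zero poly \<Rightarrow> nat \<Rightarrow> 'b" where "pcoeff \<equiv> Polynomial.coeff"

section \<open>Polynomial substitution\<close>

definition meval :: "('v \<Rightarrow> 'r :: comm_ring_1) \<Rightarrow> ('v \<Rightarrow>\<^sub>0 nat) \<Rightarrow> 'r" where
  "meval f m = (\<Prod>v\<in>mkeys m. f v ^ mlookup m v)"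

lemma meval_superset:
  assumes "finite A" "mkeys m \<subseteq> A"
  shows "meval f m = (\<Prod>v\<in>A. f v ^ mlookup m v)"
  unfolding meval_def using assms
  by (intro prod.mono_neutral_left) (auto simp: in_keys_iff)

lemma meval_add: "meval f (m + m') = meval f m * meval f m'"
proof -
  let ?A = "mkeys m \<union> mkeys m'"
  have "meval f (m + m') = (\<Prod>v\<in>?A. f v ^ mlookup (m + m') v)"
    by (rule meval_superset) (auto simp: Poly_Mapping.keys_add)
  also have "\<dots> = (\<Prod>v\<in>?A. f v ^ mlookup m v) * (\<Prod>v\<in>?A. f v ^ mlookup m' v)"
    by (simp add: lookup_add power_add prod.distrib)
  also have "\<dots> = meval f m * meval f m'"
    by (simp add: meval_superset[of ?A])
  finally show ?thesis .
qed

lemma meval_0 [simp]: "meval f 0 = 1"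
  by (simp add: meval_def)

lemma meval_single: "meval f (Poly_Mapping.single v e) = f v ^ e"
  by (simp add: meval_def)

lemma poly_mapping_sum_single:
  "p = (\<Sum>m\<in>mkeys p. Poly_Mapping.single m (mlookup p m))"
  by (rule poly_mapping_eqI) (auto simp: lookup_sum lookup_single when_def in_keys_iff)

context
  fixes h :: "'c :: comm_ring_1 \<Rightarrow> 'r :: comm_ring_1"
  assumes h: "comm_ring_hom h"
begin

interpretation h: comm_ring_hom h by (rule h)

lemma msubst_superset:
  assumes "finite A" "mkeys p \<subseteq> A"
  shows "msubst h f p = (\<Sum>m\<in>A. h (mlookup p m) * meval f m)"
  unfolding msubst_def meval_def using assms
  by (intro sum.mono_neutral_left) (auto simp: in_keys_iff)

lemma msubst_add: "msubst h f (p + q) = msubst h f p + msubst h f q"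
proof -
  let ?A = "mkeys p \<union> mkeys q"
  have "msubst h f (p + q) = (\<Sum>m\<in>?A. h (mlookup (p + q) m) * meval f m)"
    by (rule msubst_superset) (auto simp: Poly_Mapping.keys_add)
  also have "\<dots> = (\<Sum>m\<in>?A. h (mlookup p m) * meval f m)
     + (\<Sum>m\<in>?A. h (mlookup q m) * meval f m)"
    by (simp add: lookup_add h.hom_add algebra_simps sum.distrib)
  also have "\<dots> = msubst h f p + msubst h f q"
    by (simp add: msubst_superset[of ?A])
  finally show ?thesis .
qed

lemma msubst_0: "msubst h f 0 = 0"
  by (simp add: msubst_def)

lemma msubst_single: "msubst h f (Poly_Mapping.single m c) = h c * meval f m"
  by (cases "c = 0") (simp_all add: msubst_def meval_def)

lemma msubst_sum: "msubst h f (sum p A) = (\<Sum>x\<in>A. msubst h f (p x))"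
  by (induction A rule: infinite_finite_induct) (simp_all add: msubst_0 msubst_add)

lemma msubst_mult: "msubst h f (p * q) = msubst h f p * msubst h f q"
proof -
  have "p * q = (\<Sum>m\<in>mkeys p. \<Sum>m'\<in>mkeys q.
      Poly_Mapping.single (m + m') (mlookup p m * mlookup q m'))"
    by (subst poly_mapping_sum_single[of p], subst poly_mapping_sum_single[of q])
      (simp add: sum_product mult_single)
  then have "msubst h f (p * q) = (\<Sum>m\<in>mkeys p. \<Sum>m'\<in>mkeys q.
      (h (mlookup p m) * meval f m) * (h (mlookup q m') * meval f m'))"
    by (simp add: msubst_sum msubst_single h.hom_mult meval_add algebra_simps)
  then show ?thesis
    by (simp add: msubst_superset[of "mkeys p" p] msubst_superset[of "mkeys q" q]
        sum_product)
qed

lemma msubst_mconst: "msubst h f (mconst c) = h c"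
  by (simp add: mconst_def msubst_single)

lemma msubst_1: "msubst h f 1 = 1"
  using msubst_mconst[of f 1] by (simp add: mconst_def)

lemma msubst_diff: "msubst h f (p - q) = msubst h f p - msubst h f q"
  using msubst_add[of f "p - q" q] by (simp add: algebra_simps)

lemma hom_msubst: "comm_ring_hom (msubst h f)"
  by unfold_locales (simp_all add: msubst_add msubst_mult msubst_0 msubst_1)

lemma msubst_mvar: "msubst h f (mvar v) = f v"
  by (simp add: mvar_def msubst_single meval_single)

text \<open>Together with \<open>msubst_mvar_id\<close> this replaces induction on polynomials. It
  is applied to \<open>mpolys_in W\<close>, to univariate polynomials with restricted coefficients,
  and to the subring of elements reducible modulo an ideal.\<close>

lemma msubst_closed:
  assumes p: "p \<in> mpolys_in V"
    and "0 \<in> A" "1 \<in> A" and add: "\<And>x y. x \<in> A \<Longrightarrow> y \<in> A \<Longrightarrow> x + y \<in> A"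
    and mult: "\<And>x y. x \<in> A \<Longrightarrow> y \<in> A \<Longrightarrow> x * y \<in> A"
    and hc: "\<And>c. h c \<in> A" and fv: "\<And>v. v \<in> V \<Longrightarrow> f v \<in> A"
  shows "msubst h f p \<in> A"
proof -
  have pw: "x ^ e \<in> A" if "x \<in> A" for x e
    using that by (induction e) (auto intro: mult \<open>1 \<in> A\<close>)
  have pr: "(\<Prod>x\<in>B. g x) \<in> A" if "\<And>x. x \<in> B \<Longrightarrow> g x \<in> A" for B :: "'v set" and g
    using that by (induction B rule: infinite_finite_induct) (auto intro: mult \<open>1 \<in> A\<close>)
  have sm: "(\<Sum>x\<in>B. g x) \<in> A" if "\<And>x. x \<in> B \<Longrightarrow> g x \<in> A" for B :: "('v \<Rightarrow>\<^sub>0 nat) set" and g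
    using that by (induction B rule: infinite_finite_induct) (auto intro: add \<open>0 \<in> A\<close>)
  show ?thesis
    unfolding msubst_def using p
    by (intro sm mult hc pr pw fv) (auto simp: mpolys_in_def)
qed

lemma msubst_cong:
  assumes "p \<in> mpolys_in V" "\<And>v. v \<in> V \<Longrightarrow> f v = g v"
  shows "msubst h f p = msubst h g p"
  unfolding msubst_def using assms
  by (intro sum.cong refl arg_cong2[of _ _ _ _ times] prod.cong) (auto simp: mpolys_in_def subset_iff)

end

lemma hom_mconst: "comm_ring_hom (mconst :: 'c :: comm_ring_1 \<Rightarrow> ('v, 'c) mpolynomial)"
  by unfold_locales (simp_all add: mconst_def single_add mult_single)

lemma hom_id: "comm_ring_hom (\<lambda>c :: 'c :: comm_ring_1. c)"
  by unfold_locales simp_all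

lemma hom_pconst: "comm_ring_hom (\<lambda>c :: 'c :: comm_ring_1. [:c:])"
  by unfold_locales simp_all

lemma hom_poly: "comm_ring_hom (\<lambda>p :: 'c :: comm_ring_1 poly. poly p x)"
  by unfold_locales simp_all

lemma msubst_hom:
  assumes "comm_ring_hom h" "comm_ring_hom g"
  shows "g (msubst h f p) = msubst (\<lambda>c. g (h c)) (\<lambda>v. g (f v)) p"
proof -
  interpret h: comm_ring_hom h by fact
  interpret g: comm_ring_hom g by fact
  show ?thesis by (simp add: msubst_def g.hom_sum g.hom_prod g.hom_mult g.hom_power)
qed

lemma msubst_msubst:
  assumes h: "comm_ring_hom h"
  shows "msubst h f (msubst mconst g p) = msubst h (\<lambda>v. msubst h f (g v)) p"
  by (subst msubst_hom[OF hom_mconst hom_msubst[OF h]])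
    (simp add: msubst_mconst[OF h])

lemma msubst_mvar_id: "msubst mconst mvar p = p"
proof -
  have mv: "mvar v ^ e = Poly_Mapping.single (Poly_Mapping.single v e) (1 :: 'b)" for v :: 'a and e
  proof (induction e)
    case (Suc e)
    have "Poly_Mapping.single v 1 + Poly_Mapping.single v e = Poly_Mapping.single v (Suc e)"
      by (simp flip: single_add)
    with Suc show ?case by (simp add: mvar_def mult_single)
  qed simp
  have pr: "(\<Prod>v\<in>A. Poly_Mapping.single (f v) (1 :: 'b)) = Poly_Mapping.single (\<Sum>v\<in>A. f v) 1"
    if "finite A" for A and f :: "'a \<Rightarrow> 'a \<Rightarrow>\<^sub>0 nat"
    using that by (induction A) (simp_all add: mult_single)
  show ?thesis
    unfolding msubst_def
    by (subst (4) poly_mapping_sum_single)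
      (simp add: mv pr mconst_def mult_single flip: poly_mapping_sum_single)
qed

subsection \<open>Polynomials in a set of variables\<close>

lemma mpolys_in_0 [simp]: "0 \<in> mpolys_in V"
  by (simp add: mpolys_in_def)

lemma mpolys_in_mconst [simp]: "mconst c \<in> mpolys_in V"
  by (cases "c = 0") (simp_all add: mpolys_in_def mconst_def)

lemma mpolys_in_1 [simp]: "1 \<in> mpolys_in V"
  using mpolys_in_mconst[of 1] by (simp add: mconst_def)

lemma mpolys_in_mvar: "v \<in> V \<Longrightarrow> mvar v \<in> mpolys_in V"
  by (simp add: mpolys_in_def mvar_def)

lemma mpolys_in_add: "p \<in> mpolys_in V \<Longrightarrow> q \<in> mpolys_in V \<Longrightarrow> p + q \<in> mpolys_in V"
  using Poly_Mapping.keys_add[of p q] by (force simp: mpolys_in_def)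

lemma mpolys_in_mult: "p \<in> mpolys_in V \<Longrightarrow> q \<in> mpolys_in V \<Longrightarrow> p * q \<in> mpolys_in V"
proof -
  assume p: "p \<in> mpolys_in V" and q: "q \<in> mpolys_in V"
  show ?thesis unfolding mpolys_in_def
  proof (intro CollectI ballI)
    fix m assume "m \<in> mkeys (p * q)"
    then obtain a b where "m = a + b" "a \<in> mkeys p" "b \<in> mkeys q"
      using Poly_Mapping.keys_mult[of p q] by blast
    then show "mkeys m \<subseteq> V"
      using p q Poly_Mapping.keys_add[of a b] unfolding mpolys_in_def by blast
  qed
qed

lemma mpolys_in_uminus: "p \<in> mpolys_in V \<Longrightarrow> - p \<in> mpolys_in V"
  by (simp add: mpolys_in_def)

lemma mpolys_in_diff: "p \<in> mpolys_in V \<Longrightarrow> q \<in> mpolys_in V \<Longrightarrow> p - q \<in> mpolys_in V"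
  using mpolys_in_add[of p V "- q"] mpolys_in_uminus[of q V] by simp

lemma mpolys_in_sum: "(\<And>x. x \<in> A \<Longrightarrow> f x \<in> mpolys_in V) \<Longrightarrow> sum f A \<in> mpolys_in V"
  by (induction A rule: infinite_finite_induct) (auto intro: mpolys_in_add)

lemma mpolys_in_prod: "(\<And>x. x \<in> A \<Longrightarrow> f x \<in> mpolys_in V) \<Longrightarrow> prod f A \<in> mpolys_in V"
  by (induction A rule: infinite_finite_induct) (auto intro: mpolys_in_mult)

lemma mpolys_in_power: "p \<in> mpolys_in V \<Longrightarrow> p ^ e \<in> mpolys_in V"
  by (induction e) (auto intro: mpolys_in_mult)

lemma mpolys_in_mono: "p \<in> mpolys_in V \<Longrightarrow> V \<subseteq> W \<Longrightarrow> p \<in> mpolys_in W"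
  by (auto simp: mpolys_in_def)

lemma mpolys_in_msubst:
  assumes "p \<in> mpolys_in V" "\<And>v. v \<in> V \<Longrightarrow> f v \<in> mpolys_in W"
  shows "msubst mconst f p \<in> mpolys_in W"
  using assms by (intro msubst_closed[OF hom_mconst]) (auto intro: mpolys_in_add mpolys_in_mult)

lemma mpolys_in_empty: "p \<in> mpolys_in {} \<Longrightarrow> p = mconst (mlookup p 0)"
  by (rule poly_mapping_eqI)
    (auto simp: mpolys_in_def mconst_def lookup_single when_def in_keys_iff)

lemma mpolys_in_signof: "signof q \<in> mpolys_in V"
  by (auto simp: sign_def intro: mpolys_in_uminus)

lemma mpolys_in_det:
  assumes "\<And>r c. r < dim_row A \<Longrightarrow> c < dim_col A \<Longrightarrow> A $$ (r, c) \<in> mpolys_in V"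
  shows "det A \<in> mpolys_in V"
  unfolding det_def
  by (auto intro!: mpolys_in_sum mpolys_in_mult mpolys_in_signof mpolys_in_prod assms simp: permutes_in_image)

abbreviation peval :: "('v \<Rightarrow> 'c :: comm_ring_1) \<Rightarrow> ('v, 'c) mpolynomial \<Rightarrow> 'c" where
  "peval \<equiv> msubst (\<lambda>c. c)"

abbreviation pcurve :: "('v \<Rightarrow> 'c :: comm_ring_1 poly) \<Rightarrow> ('v, 'c) mpolynomial \<Rightarrow> 'c poly" where
  "pcurve \<equiv> msubst (\<lambda>c. [:c:])"

lemma poly_pcurve: "poly (pcurve f p) t = peval (\<lambda>v. poly (f v) t) p"
  by (subst msubst_hom[OF hom_pconst hom_poly]) simp

lemma mpoly_eq_0_if_vanishing:
  fixes p :: "('v, 'c :: field) mpolynomial"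
  assumes inf: "infinite (UNIV :: 'c set)" and "finite V" "p \<in> mpolys_in V" "\<And>x. peval x p = 0"
  shows "p = 0"
  using assms(2-)
proof (induction V arbitrary: p rule: finite_induct)
  case empty
  then show ?case
    using mpolys_in_empty[of p] msubst_mconst[OF hom_id] by (metis mconst_def single_zero)
next
  case (insert w V)
  \<comment> \<open>The polynomial is read as univariate in \<open>w\<close>, with coefficients in
    the remaining variables.\<close>
  define f where "f v = (if v = w then [:0, 1:] else [:mvar v:] :: ('v, 'c) mpolynomial poly)" for v
  define h where "h c = ([:mconst c:] :: ('v, 'c) mpolynomial poly)" for c
  have h: "comm_ring_hom h"
    unfolding h_def by unfold_locales (simp_all add: hom_mconst[THEN comm_ring_hom.axioms(1)] mconst_def single_add mult_single one_pCons mult.commute)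
  define P where "P = msubst h f p"
  have "poly P (mvar w) = msubst (\<lambda>c. poly (h c) (mvar w)) (\<lambda>v. poly (f v) (mvar w)) p"
    unfolding P_def by (rule msubst_hom[OF h hom_poly])
  moreover have "(\<lambda>v. poly (f v) (mvar w)) = mvar" "(\<lambda>c. poly (h c) (mvar w)) = mconst"
    by (auto simp: h_def f_def)
  ultimately have P: "poly P (mvar w) = p" by (simp add: msubst_mvar_id)
  have "P \<in> {P. \<forall>e. pcoeff P e \<in> mpolys_in V}"
    unfolding P_def
    by (rule msubst_closed[OF h insert.prems(1)])
      (auto simp: h_def f_def coeff_pCons coeff_mult intro!: mpolys_in_add mpolys_in_mult mpolys_in_sum mpolys_in_mvar split: nat.split)
  then have PV: "pcoeff P e \<in> mpolys_in V" for e by blast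
  have "pcoeff P e = 0" for e
  proof (rule insert.IH[OF PV])
    fix x :: "'v \<Rightarrow> 'c"
    interpret ev: comm_ring_hom "peval x" by (rule hom_msubst[OF hom_id])
    have "poly (map_poly (peval x) P) t = 0" for t
    proof -
      let ?y = "x(w := t)"
      interpret ev': comm_ring_hom "peval ?y" by (rule hom_msubst[OF hom_id])
      \<comment> \<open>The coefficients do not contain \<open>w\<close>, so the evaluated
        univariate polynomial takes at t the value of \<open>p\<close> at \<open>x(w := t)\<close>,
        which is 0 for every t.\<close>
      have "map_poly (peval x) P = map_poly (peval ?y) P"
      proof (rule poly_eqI)
        fix e
        have "peval x (pcoeff P e) = peval ?y (pcoeff P e)"
          by (rule msubst_cong[OF hom_id PV]) (use insert.hyps in auto)
        then show "pcoeff (map_poly (peval x) P) e = pcoeff (map_poly (peval ?y) P) e"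
          by simp
      qed
      then have "poly (map_poly (peval x) P) t = poly (map_poly (peval ?y) P) (peval ?y (mvar w))"
        by (simp add: msubst_mvar[OF hom_id])
      also have "\<dots> = peval ?y (poly P (mvar w))" by simp
      finally show ?thesis by (simp add: P insert.prems)
    qed
    then have "map_poly (peval x) P = 0"
      using poly_roots_finite[of "map_poly (peval x) P"] inf by auto
    then have "pcoeff (map_poly (peval x) P) e = 0" by simp
    then show "peval x (pcoeff P e) = 0"
      by simp
  qed
  then have "P = 0" by (simp add: poly_eqI)
  with P show ?case by simp
qed

section \<open>Polynomials vanishing on a family of curves\<close>

lemma pcurve_coeff_0: "pcoeff (pcurve f p) 0 = peval (\<lambda>v. pcoeff (f v) 0) p"
  using poly_pcurve[of f p 0] by (simp add: poly_0_coeff_0)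

text \<open>The coefficient of lowest degree of a polynomial along a curve depends only on the initial
  point and on the initial velocity, which may be prescribed.\<close>

lemma mpoly_eq_0_if_vanishing_on_curves:
  fixes p :: "('v, 'c :: field) mpolynomial"
  assumes inf: "infinite (UNIV :: 'c set)" and "finite V" and pV: "p \<in> mpolys_in V"
    and curves: "\<And>u. \<exists>f. (\<forall>v\<in>V. pcoeff (f v) 0 = b v \<and> pcoeff (f v) 1 = u v)
      \<and> pcurve f p = 0"
  shows "p = 0"
proof (rule ccontr)
  assume "p \<noteq> 0"
  \<comment> \<open>Translation moves the initial point \<open>b\<close> to the origin.\<close>
  define q where "q = msubst mconst (\<lambda>v. mvar v + mconst (b v)) p"
  have qV: "q \<in> mpolys_in V"
    unfolding q_def by (intro mpolys_in_msubst[OF pV] mpolys_in_add mpolys_in_mvar mpolys_in_mconst)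
  have "msubst mconst (\<lambda>v. mvar v - mconst (b v)) q = p"
    unfolding q_def msubst_msubst[OF hom_mconst]
    by (simp add: msubst_add[OF hom_mconst] msubst_mvar[OF hom_mconst]
        msubst_mconst[OF hom_mconst] msubst_mvar_id)
  with \<open>p \<noteq> 0\<close> have "q \<noteq> 0" using msubst_0 hom_mconst by metis
  define dg where "dg m = (\<Sum>v\<in>mkeys m. mlookup m v)" for m :: "'v \<Rightarrow>\<^sub>0 nat"
  define d where "d = Min (dg ` mkeys q)"
  \<comment> \<open>The homogeneous component of least degree d; the aim is that it vanishes at
    every velocity \<open>u\<close>.\<close>
  define r where "r = (\<Sum>m | m \<in> mkeys q \<and> dg m = d.
    Poly_Mapping.single m (mlookup q m))"
  have "d \<in> dg ` mkeys q"
    unfolding d_def using \<open>q \<noteq> 0\<close> by (intro Min_in) auto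
  then obtain m0 where m0: "m0 \<in> mkeys q" "dg m0 = d" by auto
  have dmin: "d \<le> dg m" if "m \<in> mkeys q" for m
    unfolding d_def using that by (intro Min_le) auto
  have "r \<in> mpolys_in V"
    unfolding r_def using qV by (intro mpolys_in_sum) (auto simp: mpolys_in_def)
  moreover have "peval u r = 0" for u
  proof -
    obtain f where f: "\<And>v. v \<in> V \<Longrightarrow> pcoeff (f v) 0 = b v"
        "\<And>v. v \<in> V \<Longrightarrow> pcoeff (f v) 1 = u v" and fp: "pcurve f p = 0"
      using curves[of u] by blast
    \<comment> \<open>Each translated coordinate is t times \<open>g v\<close>, and
      \<open>g v\<close> starts at \<open>u v\<close>. A monomial of degree e is thus divisible by
      t^e, and the coefficient of t^d of \<open>q\<close> along the curve is \<open>r\<close> at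
      \<open>u\<close>.\<close>
    define g where "g v = poly_shift 1 (f v)" for v
    have fg: "f v = pCons 0 (g v) + [:b v:]" if "v \<in> V" for v
      unfolding g_def by (rule poly_eqI) (auto simp: coeff_pCons coeff_poly_shift f(1)[OF that] split: nat.split)
    have "pcurve (\<lambda>v. pCons 0 (g v)) q = pcurve (\<lambda>v. pCons 0 (g v) + [:b v:]) p"
      unfolding q_def msubst_msubst[OF hom_pconst]
      by (simp add: msubst_add[OF hom_pconst] msubst_mvar[OF hom_pconst]
        msubst_mconst[OF hom_pconst])
    also have "\<dots> = pcurve f p"
      by (rule msubst_cong[OF hom_pconst pV]) (simp add: fg)
    finally have q0: "pcurve (\<lambda>v. pCons 0 (g v)) q = 0" using fp by simp
    have pc: "pCons 0 P ^ e = Polynomial.monom 1 e * P ^ e" for P :: "'c poly" and e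
    proof -
      have "pCons 0 P ^ e = ([:0, 1:] * P) ^ e" by simp
      also have "\<dots> = [:0, 1:] ^ e * P ^ e" by (rule power_mult_distrib)
      finally show ?thesis by (simp add: monom_altdef)
    qed
    have mon: "(\<Prod>v\<in>A. Polynomial.monom 1 (e v)) = Polynomial.monom (1 :: 'c) (\<Sum>v\<in>A. e v)" for A :: "'v set" and e
      by (induction A rule: infinite_finite_induct) (simp_all add: mult_monom)
    have "0 = pcoeff (pcurve (\<lambda>v. pCons 0 (g v)) q) d" by (simp add: q0)
    also have "\<dots> = (\<Sum>m\<in>mkeys q. mlookup q m *
        pcoeff (Polynomial.monom 1 (dg m) * (\<Prod>v\<in>mkeys m. g v ^ mlookup m v)) d)"
      unfolding msubst_def by (simp add: coeff_sum pc prod.distrib mon dg_def)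
    also have "\<dots> = (\<Sum>m\<in>mkeys q. if dg m = d then mlookup q m *
        (\<Prod>v\<in>mkeys m. u v ^ mlookup m v) else 0)"
    proof (intro sum.cong refl)
      fix m assume m: "m \<in> mkeys q"
      have g0: "poly (g v) 0 = u v" if "v \<in> mkeys m" for v
        using qV m that f(2)[of v] by (auto simp: g_def poly_0_coeff_0 coeff_poly_shift mpolys_in_def)
      have "pcoeff (\<Prod>v\<in>mkeys m. g v ^ mlookup m v) 0
          = (\<Prod>v\<in>mkeys m. u v ^ mlookup m v)"
        unfolding poly_0_coeff_0[symmetric] poly_prod poly_power by (intro prod.cong) (simp_all add: g0)
      with dmin[OF m] show "mlookup q m *
        pcoeff (Polynomial.monom 1 (dg m) * (\<Prod>v\<in>mkeys m. g v ^ mlookup m v)) d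
        = (if dg m = d then mlookup q m *
        (\<Prod>v\<in>mkeys m. u v ^ mlookup m v) else 0)"
        by (auto simp: coeff_monom_mult)
    qed
    also have "\<dots> = peval u r"
      unfolding r_def msubst_sum[OF hom_id] msubst_single[OF hom_id] meval_def
      by (rule sum.mono_neutral_cong_right) auto
    finally show ?thesis by simp
  qed
  ultimately have "r = 0"
    by (rule mpoly_eq_0_if_vanishing[OF inf \<open>finite V\<close>])
  moreover have "mlookup r m0 = mlookup q m0"
    unfolding r_def lookup_sum using m0
    by (subst sum.remove[of _ m0]) (auto simp: lookup_single when_def intro: sum.neutral)
  ultimately show False using m0 by (simp add: in_keys_iff)
qed

section \<open>Triangular systems of polynomials\<close>

text \<open>Variables of \<open>Vs \<gamma>\<close> outside \<open>G\<close> are unrestricted, those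
  inside must have smaller rank. In the application the rank is the row number, so the polynomials
  of two roots of \<open>G\<close> in one row must each avoid the variable of the other.\<close>

locale triangular_system =
  fixes R G :: "'v set" and Vs :: "'v \<Rightarrow> 'v set" and rk :: "'v \<Rightarrow> nat"
    and F c g :: "'v \<Rightarrow> ('v, 'c :: field) mpolynomial"
  assumes infinite_coefficients: "infinite (UNIV :: 'c set)"
    and finite_R: "finite R" and G_R: "G \<subseteq> R"
    and Vs_R: "\<And>\<gamma>. \<gamma> \<in> G \<Longrightarrow> Vs \<gamma> \<subseteq> R"
    and Vs_rk: "\<And>\<gamma> \<delta>. \<gamma> \<in> G \<Longrightarrow> \<delta> \<in> Vs \<gamma> \<Longrightarrow> \<delta> \<in> G \<Longrightarrow> rk \<delta> < rk \<gamma>"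
    and F_eq: "\<And>\<gamma>. \<gamma> \<in> G \<Longrightarrow> F \<gamma> = c \<gamma> * mvar \<gamma> + g \<gamma>"
    and c_in: "\<And>\<gamma>. \<gamma> \<in> G \<Longrightarrow> c \<gamma> \<in> mpolys_in (Vs \<gamma>)"
    and g_in: "\<And>\<gamma>. \<gamma> \<in> G \<Longrightarrow> g \<gamma> \<in> mpolys_in (Vs \<gamma>)"
begin

lemma F_in: "\<gamma> \<in> G \<Longrightarrow> F \<gamma> \<in> mpolys_in (insert \<gamma> (Vs \<gamma>))"
  unfolding F_eq using mpolys_in_mono[OF c_in] mpolys_in_mono[OF g_in]
  by (intro mpolys_in_add mpolys_in_mult mpolys_in_mvar) blast+

text \<open>The differential at \<open>x0\<close> is triangular with the nonzero numbers
  \<open>peval x0 (c \<gamma>)\<close> on the diagonal, so straight lines through \<open>x0\<close>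
  are mapped to curves with every initial velocity. A relation \<open>p\<close> vanishes along all
  these image curves.\<close>

lemma alg_independent_F:
  assumes x0: "\<And>\<gamma>. \<gamma> \<in> G \<Longrightarrow> peval x0 (c \<gamma>) \<noteq> 0"
  shows "alg_independent mconst G (\<lambda>\<gamma>. F \<gamma> - mconst (e \<gamma>))"
  unfolding alg_independent_def
proof (intro ballI impI)
  fix p :: "('v, 'c) mpolynomial"
  assume pG: "p \<in> mpolys_in G" and p0: "msubst mconst (\<lambda>\<gamma>. F \<gamma> - mconst (e \<gamma>)) p = 0"
  have finG: "finite G" using finite_R G_R finite_subset by blast
  note hom = hom_pconst
  show "p = 0"
  proof (rule mpoly_eq_0_if_vanishing_on_curves[OF infinite_coefficients finG pG,
        where b = "\<lambda>\<gamma>. peval x0 (F \<gamma>) - e \<gamma>"])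
    fix u
    define crv where "crv v = (\<lambda>\<delta>. [:x0 \<delta>, v \<delta>:])" for v :: "'v \<Rightarrow> 'c"
    have "\<exists>v. \<forall>\<gamma>\<in>G. rk \<gamma> < N \<longrightarrow> pcoeff (pcurve (crv v) (F \<gamma>)) 1 = u \<gamma>" for N
    proof (induction N)
      case (Suc N)
      then obtain v where v: "\<And>\<gamma>. \<gamma> \<in> G \<Longrightarrow> rk \<gamma> < N \<Longrightarrow>
          pcoeff (pcurve (crv v) (F \<gamma>)) 1 = u \<gamma>" by blast
      \<comment> \<open>Along the line, the coefficient of t in
        \<open>c \<gamma> * mvar \<gamma> + g \<gamma>\<close> is
        \<open>peval x0 (c \<gamma>) * w \<gamma>\<close> plus terms already fixed by the velocities
        of the variables in \<open>Vs \<gamma>\<close>; the equation is solved for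
        \<open>w \<gamma>\<close>.\<close>
      define w where "w \<delta> = (if \<delta> \<in> G \<and> rk \<delta> = N then (u \<delta> - pcoeff (pcurve (crv v) (g \<delta>)) 1
        - pcoeff (pcurve (crv v) (c \<delta>)) 1 * x0 \<delta>) / peval x0 (c \<delta>) else v \<delta>)" for \<delta>
      have "pcoeff (pcurve (crv w) (F \<gamma>)) 1 = u \<gamma>" if \<gamma>: "\<gamma> \<in> G" and "rk \<gamma> < Suc N" for \<gamma>
      proof (cases "rk \<gamma> = N")
        case False
        have w: "w \<delta> = v \<delta>" if "\<delta> \<in> insert \<gamma> (Vs \<gamma>)" for \<delta>
          using that False \<open>rk \<gamma> < Suc N\<close> by (auto simp: w_def dest: Vs_rk[OF \<gamma>])
        have "pcurve (crv w) (F \<gamma>) = pcurve (crv v) (F \<gamma>)"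
          by (rule msubst_cong[OF hom F_in[OF \<gamma>]]) (simp add: crv_def w)
        then show ?thesis using v \<gamma> that False by simp
      next
        case True
        have w: "w \<delta> = v \<delta>" if "\<delta> \<in> Vs \<gamma>" for \<delta>
          using that True by (auto simp: w_def dest: Vs_rk[OF \<gamma>])
        have "pcurve (crv w) (c \<gamma>) = pcurve (crv v) (c \<gamma>)"
          by (rule msubst_cong[OF hom c_in[OF \<gamma>]]) (simp add: crv_def w)
        moreover have "pcurve (crv w) (g \<gamma>) = pcurve (crv v) (g \<gamma>)"
          by (rule msubst_cong[OF hom g_in[OF \<gamma>]]) (simp add: crv_def w)
        ultimately have "pcurve (crv w) (F \<gamma>) = pcurve (crv v) (c \<gamma>) * [:x0 \<gamma>, w \<gamma>:] + pcurve (crv v) (g \<gamma>)"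
          by (simp add: F_eq[OF \<gamma>] msubst_add[OF hom] msubst_mult[OF hom] msubst_mvar[OF hom])
            (simp add: crv_def)
        moreover have "pcoeff (pcurve (crv v) (c \<gamma>)) 0 = peval x0 (c \<gamma>)"
          by (simp add: pcurve_coeff_0 crv_def)
        ultimately show ?thesis
          using x0[OF \<gamma>] True \<gamma> by (simp add: coeff_mult w_def field_simps)
      qed
      then show ?case by blast
    qed simp
    from this[of "Suc (Max (rk ` G))"] obtain v
      where v: "\<And>\<gamma>. \<gamma> \<in> G \<Longrightarrow> pcoeff (pcurve (crv v) (F \<gamma>)) 1 = u \<gamma>"
      using finG by (auto simp: less_Suc_eq_le)
    define f where "f \<gamma> = pcurve (crv v) (F \<gamma> - mconst (e \<gamma>))" for \<gamma>
    have f: "f \<gamma> = pcurve (crv v) (F \<gamma>) - [:e \<gamma>:]" for \<gamma>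
      unfolding f_def by (simp add: msubst_diff[OF hom] msubst_mconst[OF hom])
    have "pcurve f p = pcurve (crv v) (msubst mconst (\<lambda>\<gamma>. F \<gamma> - mconst (e \<gamma>)) p)"
      unfolding msubst_msubst[OF hom] f_def ..
    then have "pcurve f p = 0" by (simp add: p0 msubst_0[OF hom])
    moreover have "pcoeff (f \<gamma>) 0 = peval x0 (F \<gamma>) - e \<gamma>" for \<gamma>
      unfolding f by (simp add: pcurve_coeff_0 crv_def)
    moreover have "pcoeff (f \<gamma>) 1 = u \<gamma>" if "\<gamma> \<in> G" for \<gamma>
      unfolding f by (simp add: v[OF that, simplified])
    ultimately show "\<exists>f. (\<forall>\<gamma>\<in>G. pcoeff (f \<gamma>) 0 = peval x0 (F \<gamma>) - e \<gamma> \<and> pcoeff (f \<gamma>) 1 = u \<gamma>)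
        \<and> pcurve f p = 0" by blast
  qed
qed

text \<open>Modulo the ideal every variable is a polynomial in the variables outside \<open>G\<close>. The coefficient
  \<open>c \<gamma>\<close> is constant modulo the ideal, since it is constant on \<open>Orb\<close> and polynomials
  in the variables outside \<open>G\<close> are determined by their values on \<open>Orb\<close>.\<close>

lemma vanishing_imp_in_ideal:
  assumes J0: "0 \<in> J" and Jadd: "\<And>p q. p \<in> J \<Longrightarrow> q \<in> J \<Longrightarrow> p + q \<in> J"
    and Jmult: "\<And>p q. p \<in> J \<Longrightarrow> q \<in> mpolys_in R \<Longrightarrow> q * p \<in> J"
    and JO: "\<And>p x. p \<in> J \<Longrightarrow> x \<in> Orb \<Longrightarrow> peval x p = 0"
    and JF: "\<And>\<gamma>. \<gamma> \<in> G \<Longrightarrow> F \<gamma> - mconst (e \<gamma>) \<in> J"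
    and cO: "\<And>\<gamma> x. \<gamma> \<in> G \<Longrightarrow> x \<in> Orb \<Longrightarrow> peval x (c \<gamma>) = cval \<gamma>"
    and cval: "\<And>\<gamma>. \<gamma> \<in> G \<Longrightarrow> cval \<gamma> \<noteq> 0"
    and dense: "\<And>p. p \<in> mpolys_in (R - G) \<Longrightarrow> (\<And>x. x \<in> Orb \<Longrightarrow> peval x p = 0) \<Longrightarrow> p = 0"
    and p: "p \<in> mpolys_in R" "\<And>x. x \<in> Orb \<Longrightarrow> peval x p = 0"
  shows "p \<in> J"
proof -
  note ev = msubst_add[OF hom_id] msubst_mconst[OF hom_id]
    msubst_diff[OF hom_id]
  have Jneg: "- p \<in> J" if "p \<in> J" for p
    using Jmult[OF that, of "- 1"] mpolys_in_uminus[OF mpolys_in_1, of R] by simp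
  have Jdiff: "p - q \<in> J" if "p \<in> J" "q \<in> J" for p q
    using Jadd[OF that(1) Jneg[OF that(2)]] by simp
  \<comment> \<open>The polynomials congruent modulo \<open>J\<close> to one in the variables
    outside \<open>G\<close>; they form a subring, and it remains to put the variables of
    \<open>G\<close> into it.\<close>
  define W where "W = {p \<in> mpolys_in R. \<exists>q\<in>mpolys_in (R - G). p - q \<in> J}"
  have W_sub: "q \<in> W" if "q \<in> mpolys_in (R - G)" for q
    using that J0 mpolys_in_mono[of q "R - G" R] unfolding W_def by force
  have W_add: "p + q \<in> W" if "p \<in> W" "q \<in> W" for p q
  proof -
    from that obtain p' q' where "p' \<in> mpolys_in (R - G)" "p - p' \<in> J" "q' \<in> mpolys_in (R - G)" "q - q' \<in> J"
      unfolding W_def by blast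
    then have "p' + q' \<in> mpolys_in (R - G)" "(p + q) - (p' + q') \<in> J"
      using Jadd[of "p - p'" "q - q'"] by (auto intro: mpolys_in_add simp: algebra_simps)
    then show ?thesis using that unfolding W_def by (auto intro: mpolys_in_add)
  qed
  have W_mult: "p * q \<in> W" if pq: "p \<in> W" "q \<in> W" for p q
  proof -
    from that obtain p' q' where p': "p' \<in> mpolys_in (R - G)" "p - p' \<in> J" and q': "q' \<in> mpolys_in (R - G)" "q - q' \<in> J"
      unfolding W_def by blast
    have "q * (p - p') + p' * (q - q') \<in> J"
      using pq p' q' mpolys_in_mono[of p' "R - G" R] by (intro Jadd Jmult) (auto simp: W_def)
    then have "p * q - p' * q' \<in> J" by (simp add: algebra_simps)
    moreover have "p' * q' \<in> mpolys_in (R - G)" by (intro mpolys_in_mult p' q')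
    ultimately show ?thesis using pq unfolding W_def by (auto intro: mpolys_in_mult)
  qed
  have W_poly: "p \<in> W" if "p \<in> mpolys_in V" "\<And>v. v \<in> V \<Longrightarrow> mvar v \<in> W" for p V
    by (subst msubst_mvar_id[symmetric], rule msubst_closed[OF hom_mconst that(1)])
      (auto intro: W_add W_mult W_sub that(2))
  have W_G: "mvar \<gamma> \<in> W" if "\<gamma> \<in> G" for \<gamma>
    using that
  proof (induction "rk \<gamma>" arbitrary: \<gamma> rule: less_induct)
    case less
    have VW: "mvar v \<in> W" if "v \<in> Vs \<gamma>" for v
    proof (cases "v \<in> G")
      case True
      then show ?thesis using less Vs_rk[OF less.prems that] by blast
    next
      case False
      then show ?thesis using Vs_R[OF less.prems] that by (auto intro!: W_sub mpolys_in_mvar)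
    qed
    from W_poly[OF c_in[OF less.prems] VW] obtain c' where
      c': "c' \<in> mpolys_in (R - G)" "c \<gamma> - c' \<in> J" unfolding W_def by blast
    from W_poly[OF g_in[OF less.prems] VW] obtain g' where
      g': "g' \<in> mpolys_in (R - G)" "g \<gamma> - g' \<in> J" unfolding W_def by blast
    \<comment> \<open>\<open>J\<close> vanishes on \<open>Orb\<close>, so c' has there the same
      constant value as \<open>c \<gamma>\<close>; density makes it equal to that constant.\<close>
    have "c' - mconst (cval \<gamma>) = 0"
    proof (rule dense)
      show "c' - mconst (cval \<gamma>) \<in> mpolys_in (R - G)" by (intro mpolys_in_diff c' mpolys_in_mconst)
      fix x assume x: "x \<in> Orb"
      from JO[OF c'(2) x] cO[OF less.prems x] show "peval x (c' - mconst (cval \<gamma>)) = 0"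
        by (simp add: ev)
    qed
    then have c'_eq: "c' = mconst (cval \<gamma>)" by simp
    define k where "k = 1 / cval \<gamma>"
    have k: "mconst k * mconst (cval \<gamma>) = (1 :: ('v, 'c) mpolynomial)"
      unfolding k_def mconst_def using cval[OF less.prems] by (simp add: mult_single)
    have \<gamma>R: "mvar \<gamma> \<in> mpolys_in R" using less.prems G_R by (auto intro: mpolys_in_mvar)
    \<comment> \<open>With \<open>c \<gamma>\<close> replaced by its constant and
      \<open>g \<gamma>\<close> by g', the relation \<open>F \<gamma> - mconst (e \<gamma>)\<close>
      can be solved for \<open>mvar \<gamma>\<close> modulo \<open>J\<close>.\<close>
    have "mconst k * ((F \<gamma> - mconst (e \<gamma>)) - mvar \<gamma> * (c \<gamma> - mconst (cval \<gamma>)) - (g \<gamma> - g')) \<in> J"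
      by (rule Jmult[OF Jdiff[OF Jdiff[OF JF[OF less.prems] Jmult[OF c'(2)[unfolded c'_eq] \<gamma>R]] g'(2)] mpolys_in_mconst])
    also have "mconst k * ((F \<gamma> - mconst (e \<gamma>)) - mvar \<gamma> * (c \<gamma> - mconst (cval \<gamma>)) - (g \<gamma> - g'))
      = mconst k * mconst (cval \<gamma>) * mvar \<gamma> - mconst k * (mconst (e \<gamma>) - g')"
      unfolding F_eq[OF less.prems] by (simp only: algebra_simps)
    finally have "mvar \<gamma> - mconst k * (mconst (e \<gamma>) - g') \<in> J" by (simp add: k)
    moreover have "mconst k * (mconst (e \<gamma>) - g') \<in> mpolys_in (R - G)"
      by (intro mpolys_in_mult mpolys_in_diff mpolys_in_mconst g')
    ultimately show ?case using \<gamma>R unfolding W_def by blast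
  qed
  have "p \<in> W"
    using p(1) by (rule W_poly) (use W_G in \<open>auto intro: W_sub mpolys_in_mvar\<close>)
  then obtain q where q: "q \<in> mpolys_in (R - G)" "p - q \<in> J" unfolding W_def by blast
  have "q = 0"
    using q(1) by (rule dense) (use JO[OF q(2)] p(2) in \<open>auto simp: ev\<close>)
  with q show ?thesis by simp
qed

end

section \<open>Minors\<close>

lemma det_eq_prod_if_lower:
  assumes "\<And>r c. r < c \<Longrightarrow> c < N \<Longrightarrow> f r c = 0"
  shows "det (mat N N (\<lambda>(r, c). f r c)) = (\<Prod>r<N. f r r)"
  by (subst det_lower_triangular[of N])
    (auto simp: assms diag_mat_def prod.list_conv_set_nth atLeast0LessThan intro!: prod.cong)

text \<open>The Leibniz sum has exactly one nonzero term, that of \<pi>.\<close>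

lemma det_monomial_ne_0:
  fixes A :: "'r :: idom mat"
  assumes A: "A \<in> carrier_mat N N" and \<pi>: "\<pi> permutes {0..<N}"
    and nz: "\<And>r c. r < N \<Longrightarrow> c < N \<Longrightarrow> A $$ (r, c) \<noteq> 0 \<longleftrightarrow> c = \<pi> r"
  shows "det A \<noteq> 0"
proof -
  have "det A = (\<Sum>p | p permutes {0..<N}. signof p * (\<Prod>i = 0..<N. A $$ (i, p i)))"
    by (rule det_def'[OF A])
  also have "\<dots> = (\<Sum>p\<in>{\<pi>}. signof p * (\<Prod>i = 0..<N. A $$ (i, p i)))"
  proof (rule sum.mono_neutral_right)
    show "\<forall>p\<in>{p. p permutes {0..<N}} - {\<pi>}. signof p * (\<Prod>i = 0..<N. A $$ (i, p i)) = 0"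
    proof
      fix p assume p: "p \<in> {p. p permutes {0..<N}} - {\<pi>}"
      then obtain i where i: "p i \<noteq> \<pi> i" by auto
      have "i < N"
      proof (rule ccontr)
        assume "\<not> i < N"
        then have "p i = i" "\<pi> i = i" using p \<pi> by (auto simp: permutes_def)
        with i show False by simp
      qed
      moreover have "p i < N" using p \<open>i < N\<close> permutes_in_image[of p "{0..<N}" i] by auto
      ultimately have "A $$ (i, p i) = 0" using nz[of i "p i"] i by auto
      then have "(\<Prod>i = 0..<N. A $$ (i, p i)) = 0" using \<open>i < N\<close> by (intro prod_zero) auto
      then show "signof p * (\<Prod>i = 0..<N. A $$ (i, p i)) = 0" by simp
    qed
  qed (auto simp: \<pi> finite_permutations)
  also have "\<dots> \<noteq> 0"
    using nz permutes_in_image[OF \<pi>] by (auto simp: sign_def)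
  finally show ?thesis .
qed

lemma bij_betw_pick: "finite I \<Longrightarrow> bij_betw (pick I) {..<card I} I"
proof -
  assume I: "finite I"
  have "inj_on (pick I) {..<card I}"
    using pick_mono_le[of _ I] by (intro strict_mono_on_imp_inj_on strict_mono_onI) auto
  moreover have "pick I ` {..<card I} = I"
  proof
    show "I \<subseteq> pick I ` {..<card I}"
    proof
      fix i assume "i \<in> I"
      then have "pick I (card {a \<in> I. a < i}) = i" by (rule pick_card_in_set)
      moreover have "card {a \<in> I. a < i} < card I"
        using I \<open>i \<in> I\<close> by (intro psubset_card_mono) auto
      ultimately show "i \<in> pick I ` {..<card I}" by force
    qed
  qed (auto simp: pick_in_set_le)
  ultimately show ?thesis by (simp add: bij_betw_def)
qed

lemma pick_eqI: "i \<in> I \<Longrightarrow> card {a \<in> I. a < i} = r \<Longrightarrow> pick I r = i"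
  using pick_card_in_set by blast

text \<open>Entries come from a function on 1-based indices, so the same index sets serve the
  generic matrix, its values on the orbit and the matrix of the form. \<open>pick\<close> enumerates
  a set increasingly.\<close>

definition minor :: "(nat \<Rightarrow> nat \<Rightarrow> 'r :: comm_ring_1) \<Rightarrow> nat set \<Rightarrow> nat set \<Rightarrow> 'r" where
  "minor Z I J = det (mat (card I) (card I) (\<lambda>(r, c). Z (pick I r) (pick J c)))"

lemma minor_hom:
  assumes "comm_ring_hom h"
  shows "h (minor Z I J) = minor (\<lambda>r c. h (Z r c)) I J"
proof -
  interpret comm_ring_hom h by fact
  show ?thesis
    unfolding minor_def hom_det[symmetric] by (intro arg_cong[of _ _ det] eq_matI) auto
qed

lemma minor_in_mpolys:
  assumes "finite I" "finite J" "card I = card J" "\<And>r c. r \<in> I \<Longrightarrow> c \<in> J \<Longrightarrow> Z r c \<in> mpolys_in V"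
  shows "minor Z I J \<in> mpolys_in V"
  unfolding minor_def using assms by (intro mpolys_in_det) (auto simp: pick_in_set_le)

text \<open>Since the sums run over I and J only, the submatrix itself factors into three square
  matrices. Increasing enumeration keeps the outer factors lower unitriangular, hence of determinant
  1.\<close>

lemma minor_unitriangular_mult:
  assumes fin: "finite I" "finite J" and card: "card I = card J"
    and Y: "\<And>r c. r \<in> I \<Longrightarrow> c \<in> J \<Longrightarrow> Y r c = (\<Sum>i\<in>I. \<Sum>j\<in>J. h r i * Z i j * u j c)"
    and h: "\<And>r c. r < c \<Longrightarrow> h r c = 0" "\<And>r. r \<in> I \<Longrightarrow> h r r = 1"
    and u: "\<And>r c. r < c \<Longrightarrow> u r c = 0" "\<And>r. r \<in> J \<Longrightarrow> u r r = 1"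
  shows "minor Y I J = minor Z I J"
proof -
  let ?N = "card I"
  let ?M = "\<lambda>W I J. mat ?N ?N (\<lambda>(r, c). W (pick I r) (pick J c))"
  have sum_pick: "(\<Sum>i\<in>K. f i) = (\<Sum>r<card K. f (pick K r))" if "finite K" for K and f :: "nat \<Rightarrow> 'a"
    using sum.reindex_bij_betw[OF bij_betw_pick[OF that], of f] by simp
  have "?M Y I J = ?M h I I * (?M Z I J * ?M u J J)"
  proof (rule eq_matI)
    fix r c assume "r < dim_row (?M h I I * (?M Z I J * ?M u J J))" "c < dim_col (?M h I I * (?M Z I J * ?M u J J))"
    then have rc: "r < ?N" "c < ?N" by auto
    then have "pick I r \<in> I" "pick J c \<in> J" using card by (auto simp: pick_in_set_le)
    then have "?M Y I J $$ (r, c) = (\<Sum>i<?N. \<Sum>j<?N. h (pick I r) (pick I i) * Z (pick I i) (pick J j) * u (pick J j) (pick J c))"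
      using rc by (simp add: Y sum_pick[OF fin(1)] sum_pick[OF fin(2)] card del: pick.simps)
    also have "\<dots> = (?M h I I * (?M Z I J * ?M u J J)) $$ (r, c)"
      using rc by (simp add: scalar_prod_def sum_distrib_left mult.assoc atLeast0LessThan)
    finally show "?M Y I J $$ (r, c) = (?M h I I * (?M Z I J * ?M u J J)) $$ (r, c)" .
  qed auto
  moreover have "det (?M h I I) = 1"
    by (subst det_eq_prod_if_lower) (auto simp: h pick_mono_le pick_in_set_le intro!: prod.neutral)
  moreover have "det (?M u J J) = 1"
    by (subst det_eq_prod_if_lower) (auto simp: u card pick_mono_le pick_in_set_le intro!: prod.neutral)
  moreover have "det (?M h I I * (?M Z I J * ?M u J J)) = det (?M h I I) * (det (?M Z I J) * det (?M u J J))"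
    by (subst det_mult[of _ ?N], auto, subst det_mult[of _ ?N], auto)
  ultimately show ?thesis unfolding minor_def by simp
qed

lemma minor_monomial_ne_0:
  fixes Z :: "nat \<Rightarrow> nat \<Rightarrow> 'r :: idom"
  assumes \<Gamma>: "finite \<Gamma>" "inj_on fst \<Gamma>" "inj_on snd \<Gamma>"
    and nz: "\<And>r c. r \<in> fst ` \<Gamma> \<Longrightarrow> c \<in> snd ` \<Gamma> \<Longrightarrow> Z r c \<noteq> 0 \<longleftrightarrow> (r, c) \<in> \<Gamma>"
  shows "minor Z (fst ` \<Gamma>) (snd ` \<Gamma>) \<noteq> 0"
proof -
  let ?I = "fst ` \<Gamma>" and ?J = "snd ` \<Gamma>" and ?N = "card (fst ` \<Gamma>)"
  have cards: "card ?I = card ?J" using \<Gamma> by (simp add: card_image)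
  note pI = bij_betw_pick[of ?I] and pJ = bij_betw_pick[of ?J]
  define \<sigma> where "\<sigma> = snd \<circ> inv_into \<Gamma> fst"
  have \<sigma>: "bij_betw \<sigma> ?I ?J"
    unfolding \<sigma>_def using \<Gamma> by (intro bij_betw_trans[of _ _ \<Gamma>] bij_betw_inv_into) (auto simp: bij_betw_def)
  have \<sigma>_iff: "(r, c) \<in> \<Gamma> \<longleftrightarrow> c = \<sigma> r" if "r \<in> ?I" for r c
  proof
    assume "(r, c) \<in> \<Gamma>"
    then have "inv_into \<Gamma> fst r = (r, c)" using \<Gamma> inv_into_f_f[of fst \<Gamma> "(r, c)"] by simp
    then show "c = \<sigma> r" by (simp add: \<sigma>_def)
  next
    assume "c = \<sigma> r"
    moreover have "inv_into \<Gamma> fst r \<in> \<Gamma>" "fst (inv_into \<Gamma> fst r) = r"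
      using that by (auto intro: inv_into_into f_inv_into_f)
    ultimately show "(r, c) \<in> \<Gamma>" by (metis \<sigma>_def comp_apply prod.collapse)
  qed
  define \<pi>' where "\<pi>' = inv_into {..<?N} (pick ?J) \<circ> (\<sigma> \<circ> pick ?I)"
  have \<pi>': "bij_betw \<pi>' {..<?N} {..<?N}"
    unfolding \<pi>'_def using pI pJ \<sigma> cards \<Gamma>(1)
    by (intro bij_betw_trans[of _ _ ?J] bij_betw_trans[of _ _ ?I] bij_betw_inv_into) auto
  define \<pi> where "\<pi> r = (if r < ?N then \<pi>' r else r)" for r
  have \<pi>: "\<pi> permutes {0..<?N}"
  proof (rule bij_imp_permutes)
    show "bij_betw \<pi> {0..<?N} {0..<?N}"
      using \<pi>' unfolding atLeast0LessThan by (subst bij_betw_cong[of _ _ \<pi>']) (auto simp: \<pi>_def)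
  qed (auto simp: \<pi>_def)
  show ?thesis unfolding minor_def
  proof (rule det_monomial_ne_0[OF _ \<pi>])
    fix r c assume rc: "r < ?N" "c < ?N"
    then have r: "pick ?I r \<in> ?I" and c: "pick ?J c \<in> ?J"
      using cards pick_in_set_le[of r ?I] pick_in_set_le[of c ?J] by simp_all
    have "pick ?J (\<pi> r) = \<sigma> (pick ?I r)"
    proof -
      have "\<sigma> (pick ?I r) \<in> pick ?J ` {..<?N}"
        using r \<sigma> pJ \<Gamma>(1) cards by (auto simp: bij_betw_def)
      then show ?thesis using rc by (simp add: \<pi>_def \<pi>'_def f_inv_into_f)
    qed
    moreover have "\<pi> r < ?N" using rc \<pi>' by (auto simp: \<pi>_def bij_betw_def)
    ultimately have "pick ?J c = \<sigma> (pick ?I r) \<longleftrightarrow> c = \<pi> r"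
      using rc bij_betw_imp_inj_on[OF pJ] \<Gamma>(1) cards by (auto simp: inj_on_def)
    then show "mat ?N ?N (\<lambda>(r, c). Z (pick ?I r) (pick ?J c)) $$ (r, c) \<noteq> 0 \<longleftrightarrow> c = \<pi> r"
      using rc nz[OF r c] \<sigma>_iff[OF r] by simp
  qed auto
qed

text \<open>The sign is obtained before the entries are chosen, so it depends on the order of the
  columns alone.\<close>

lemma minor_permuted_columns:
  assumes "finite I" "finite J" "card I = card J" and f: "bij_betw f {..<card I} J"
  obtains s :: "'r :: comm_ring_1" where "s = 1 \<or> s = -1"
    "\<And>Z. det (mat (card I) (card I) (\<lambda>(r, c). Z (pick I r) (f c))) = s * minor Z I J"
proof -
  let ?N = "card I"
  define \<pi>' where "\<pi>' = inv_into {..<?N} (pick J) \<circ> f"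
  have pJ: "bij_betw (pick J) {..<?N} J" using bij_betw_pick assms by metis
  have \<pi>': "bij_betw \<pi>' {..<?N} {..<?N}"
    unfolding \<pi>'_def by (intro bij_betw_trans[OF f] bij_betw_inv_into pJ)
  define \<pi> where "\<pi> r = (if r < ?N then \<pi>' r else r)" for r
  have \<pi>: "\<pi> permutes {0..<?N}"
  proof (rule bij_imp_permutes)
    show "bij_betw \<pi> {0..<?N} {0..<?N}"
      using \<pi>' unfolding atLeast0LessThan by (subst bij_betw_cong[of _ _ \<pi>']) (auto simp: \<pi>_def)
  qed (auto simp: \<pi>_def)
  have fc: "f c = pick J (\<pi> c)" if "c < ?N" for c
  proof -
    have "f c \<in> pick J ` {..<?N}" using f pJ that by (auto simp: bij_betw_def)
    then show ?thesis using that by (simp add: \<pi>_def \<pi>'_def f_inv_into_f)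
  qed
  have lt: "\<pi> c < ?N" if "c < ?N" for c
    using permutes_in_image[OF \<pi>, of c] that by auto
  show ?thesis
  proof (rule that)
    show "signof \<pi> = (1 :: 'r) \<or> signof \<pi> = (-1 :: 'r)" by (simp add: sign_def)
    fix Z :: "nat \<Rightarrow> nat \<Rightarrow> 'r"
    let ?M = "mat ?N ?N (\<lambda>(r, c). Z (pick I r) (pick J c))"
    let ?T = "mat ?N ?N (\<lambda>(c, r). ?M $$ (r, c))"
    have "det (mat ?N ?N (\<lambda>(r, c). Z (pick I r) (f c)))
        = det (transpose_mat (mat ?N ?N (\<lambda>(r, c). Z (pick I r) (f c))))"
      by (rule det_transpose[symmetric]) auto
    also have "transpose_mat (mat ?N ?N (\<lambda>(r, c). Z (pick I r) (f c))) = mat ?N ?N (\<lambda>(c, r). ?T $$ (\<pi> c, r))"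
      by (rule eq_matI) (auto simp: fc lt)
    also have "det \<dots> = signof \<pi> * det ?T" by (rule det_permute_rows[OF _ \<pi>]) auto
    also have "det ?T = det (transpose_mat ?T)" by (rule det_transpose[symmetric]) auto
    also have "transpose_mat ?T = ?M" by (rule eq_matI) auto
    finally show "det (mat ?N ?N (\<lambda>(r, c). Z (pick I r) (f c))) = signof \<pi> * minor Z I J"
      unfolding minor_def .
  qed
qed

text \<open>Laplace expansion along the last row, with the term of the lower left corner split off.
  A root \<gamma> is that corner of its own minor, because all other roots of \<open>S_gamma\<close>
  lie above and to the right.\<close>

lemma minor_expand_corner:
  fixes Z :: "nat \<Rightarrow> nat \<Rightarrow> 'r :: comm_ring_1"
  assumes fin: "finite I" "finite J" and card: "card I = card J"
    and i: "i \<in> I" "\<And>r. r \<in> I \<Longrightarrow> r \<le> i" and j: "j \<in> J" "\<And>c. c \<in> J \<Longrightarrow> j \<le> c"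
  shows "minor Z I J = (-1) ^ (card I - 1) * minor Z (I - {i}) (J - {j}) * Z i j
    + (\<Sum>c\<in>{1..<card I}. Z i (pick J c) *
        cofactor (mat (card I) (card I) (\<lambda>(r, c). Z (pick I r) (pick J c))) (card I - 1) c)"
proof -
  define N where "N = card I - 1"
  have N: "card I = Suc N" "card J = Suc N" "card (I - {i}) = N" "card (J - {j}) = N"
    using fin card i(1) j(1) card_gt_0_iff[of I] by (auto simp: N_def)
  let ?A = "mat (Suc N) (Suc N) (\<lambda>(r, c). Z (pick I r) (pick J c))"
  have pi: "pick I N = i"
  proof (rule pick_eqI[OF i(1)])
    have "{a \<in> I. a < i} = I - {i}" using i(2) by fastforce
    then show "card {a \<in> I. a < i} = N" using N by simp
  qed
  have pj: "pick J 0 = j"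
  proof (rule pick_eqI[OF j(1)])
    have "{a \<in> J. a < j} = {}" using j(2) by fastforce
    then show "card {a \<in> J. a < j} = 0" by (metis card.empty)
  qed
  have pI: "pick (I - {i}) r = pick I r" if "r < N" for r
  proof (rule pick_eqI)
    have r: "r < card I" using that N by simp
    have lt: "pick I r < i" using pick_mono_le[of N I r] that N pi by simp
    then show "pick I r \<in> I - {i}" using pick_in_set_le[OF r] by simp
    have "{a \<in> I - {i}. a < pick I r} = {a \<in> I. a < pick I r}" using lt by auto
    then show "card {a \<in> I - {i}. a < pick I r} = r" using card_pick_le[OF r] by simp
  qed
  have pJ: "pick (J - {j}) c = pick J (Suc c)" if "c < N" for c
  proof (rule pick_eqI)
    have c: "Suc c < card J" using that N by simp
    have lt: "j < pick J (Suc c)" using pick_mono_le[OF c, of 0] pj by simp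
    then show "pick J (Suc c) \<in> J - {j}" using pick_in_set_le[OF c] by simp
    have "{a \<in> J - {j}. a < pick J (Suc c)} = {a \<in> J. a < pick J (Suc c)} - {j}" by auto
    then show "card {a \<in> J - {j}. a < pick J (Suc c)} = c" using card_pick_le[OF c] lt j(1) fin by simp
  qed
  have "mat_delete ?A N 0 = mat N N (\<lambda>(r, c). Z (pick (I - {i}) r) (pick (J - {j}) c))"
    unfolding mat_delete_def by (rule eq_matI) (auto simp: pI pJ)
  then have cof: "cofactor ?A N 0 = (-1) ^ N * minor Z (I - {i}) (J - {j})"
    unfolding cofactor_def minor_def N by simp
  have "minor Z I J = (\<Sum>c<Suc N. ?A $$ (N, c) * cofactor ?A N c)"
    unfolding minor_def N by (rule laplace_expansion_row) auto
  also have "{..<Suc N} = insert 0 {1..<Suc N}" by auto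
  also have "(\<Sum>c\<in>insert 0 {1..<Suc N}. ?A $$ (N, c) * cofactor ?A N c)
      = ?A $$ (N, 0) * cofactor ?A N 0 + (\<Sum>c\<in>{1..<Suc N}. ?A $$ (N, c) * cofactor ?A N c)"
    by (subst sum.insert) auto
  also have "(\<Sum>c\<in>{1..<Suc N}. ?A $$ (N, c) * cofactor ?A N c)
      = (\<Sum>c\<in>{1..<Suc N}. Z i (pick J c) * cofactor ?A N c)"
    by (rule sum.cong) (auto simp: pi)
  also have "?A $$ (N, 0) * cofactor ?A N 0 = (-1) ^ N * minor Z (I - {i}) (J - {j}) * Z i j"
    by (simp add: cof pi pj mult_ac del: pick.simps)
  finally show ?thesis using N by simp
qed

lemma det_submatrix_eq_minor:
  assumes I: "finite I" "I \<subseteq> {1..n}" and J: "finite J" "J \<subseteq> {1..n}" and card: "card I = card J"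
    and A: "A \<in> carrier_mat n n" "\<And>r c. r \<in> I \<Longrightarrow> c \<in> J \<Longrightarrow> A $$ (r - 1, c - 1) = Z r c"
  shows "det (submatrix A ((\<lambda>i. i - 1) ` I) ((\<lambda>j. j - 1) ` J)) = minor Z I J"
proof -
  have inj_shift: "inj_on (\<lambda>i. i - 1) K" if "K \<subseteq> {1..n}" for K
  proof (rule inj_onI)
    fix x y assume "x \<in> K" "y \<in> K" "x - 1 = y - 1"
    with that have "1 \<le> x" "1 \<le> y" by auto
    with \<open>x - 1 = y - 1\<close> show "x = y" by simp
  qed
  have card_shift: "card {i. i < n \<and> i \<in> (\<lambda>i. i - 1) ` K} = card K" if "K \<subseteq> {1..n}" for K
  proof -
    have "{i. i < n \<and> i \<in> (\<lambda>i. i - 1) ` K} = (\<lambda>i. i - 1) ` K" using that by force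
    moreover have "inj_on (\<lambda>i. i - 1) K" by (rule inj_shift) fact
    ultimately show ?thesis by (simp add: card_image)
  qed
  have pick_shift: "pick ((\<lambda>i. i - 1) ` K) r = pick K r - 1" if "K \<subseteq> {1..n}" "r < card K" for K r
  proof (rule pick_eqI)
    have k: "pick K r \<in> K" by (rule pick_in_set_le) fact
    then show "pick K r - 1 \<in> (\<lambda>i. i - 1) ` K" by simp
    have "{a \<in> (\<lambda>i. i - 1) ` K. a < pick K r - 1} = (\<lambda>i. i - 1) ` {a \<in> K. a < pick K r}"
      using that(1) k by force
    moreover have "inj_on (\<lambda>i. i - 1) {a \<in> K. a < pick K r}"
      using inj_shift[OF that(1)] by (rule inj_on_subset) auto
    ultimately show "card {a \<in> (\<lambda>i. i - 1) ` K. a < pick K r - 1} = r"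
      using card_pick_le[OF that(2)] by (simp add: card_image)
  qed
  have dims: "dim_row A = n" "dim_col A = n" using A(1) by auto
  have "submatrix A ((\<lambda>i. i - 1) ` I) ((\<lambda>j. j - 1) ` J)
      = mat (card I) (card I) (\<lambda>(r, c). Z (pick I r) (pick J c))"
    unfolding submatrix_def dims card_shift[OF I(2)] card_shift[OF J(2)] card[symmetric]
  proof (rule cong_mat)
    fix r c assume rc: "r < card I" "c < card I"
    then have rc': "c < card J" using card by simp
    show "(case (r, c) of (i, j) \<Rightarrow> A $$ (pick ((\<lambda>i. i - 1) ` I) i, pick ((\<lambda>j. j - 1) ` J) j))
        = (case (r, c) of (r, c) \<Rightarrow> Z (pick I r) (pick J c))"
      unfolding prod.case pick_shift[OF I(2) rc(1)] pick_shift[OF J(2) rc']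
      by (rule A(2)) (use rc(1) rc' in \<open>simp_all only: pick_in_set_le\<close>)
  qed simp_all
  then show ?thesis by (simp add: minor_def)
qed

section \<open>The derivative of the determinant\<close>

text \<open>The derivative of the determinant at A in direction Q, that is, the trace of adj A times
  Q; the formula with cofactors is meaningful over every commutative ring.\<close>

definition det_deriv :: "'r :: comm_ring_1 mat \<Rightarrow> 'r mat \<Rightarrow> 'r" where
  "det_deriv A Q = (\<Sum>r<dim_row A. \<Sum>c<dim_row A. Q $$ (r, c) * cofactor A r c)"

text \<open>The product rule for the factors q + p t. The claim on the second highest coefficient
  needs the other two in the induction step.\<close>

lemma coeff_prod_linear:
  fixes q p :: "'b \<Rightarrow> 'r :: comm_ring_1"
  assumes "finite B"
  shows "pcoeff (\<Prod>r\<in>B. [:q r, p r:]) (card B) = (\<Prod>r\<in>B. p r) \<and>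
    (\<forall>k>card B. pcoeff (\<Prod>r\<in>B. [:q r, p r:]) k = 0) \<and>
    (\<forall>k. Suc k = card B \<longrightarrow> pcoeff (\<Prod>r\<in>B. [:q r, p r:]) k = (\<Sum>r\<in>B. q r * (\<Prod>s\<in>B - {r}. p s)))"
  using assms
proof (induction B rule: finite_induct)
  case (insert x B)
  let ?P = "\<Prod>r\<in>B. [:q r, p r:]"
  have P: "(\<Prod>r\<in>insert x B. [:q r, p r:]) = Polynomial.smult (q x) ?P + pCons 0 (Polynomial.smult (p x) ?P)"
    using insert by simp
  have "(\<Sum>r\<in>B. q r * (\<Prod>s\<in>insert x B - {r}. p s)) = (\<Sum>r\<in>B. p x * (q r * (\<Prod>s\<in>B - {r}. p s)))"
  proof (rule sum.cong[OF refl])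
    fix r assume "r \<in> B"
    then have "insert x B - {r} = insert x (B - {r})" using insert by auto
    then show "q r * (\<Prod>s\<in>insert x B - {r}. p s) = p x * (q r * (\<Prod>s\<in>B - {r}. p s))"
      using insert by (simp add: mult_ac)
  qed
  then have sm: "(\<Sum>r\<in>insert x B. q r * (\<Prod>s\<in>insert x B - {r}. p s))
      = q x * (\<Prod>s\<in>B. p s) + p x * (\<Sum>r\<in>B. q r * (\<Prod>s\<in>B - {r}. p s))"
    using insert by (simp add: sum_distrib_left)
  show ?case unfolding P sm using insert
    by (cases "card B") (auto simp: coeff_pCons split: nat.split)
qed simp

lemma det_row_replaced:
  assumes "A \<in> carrier_mat N N" "r < N"
  shows "det (mat N N (\<lambda>(r', c). if r' = r then q c else A $$ (r', c))) = (\<Sum>c<N. q c * cofactor A r c)"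
proof -
  let ?B = "mat N N (\<lambda>(r', c). if r' = r then q c else A $$ (r', c))"
  have "mat_delete ?B r c = mat_delete A r c" for c
    unfolding mat_delete_def using assms by (intro eq_matI) auto
  then have "cofactor ?B r c = cofactor A r c" for c by (simp add: cofactor_def)
  with assms show ?thesis by (subst laplace_expansion_row[of _ N r]) auto
qed

text \<open>The pencil is Q + t A, whose determinant is formally t^N det (A + Q / t); the
  coefficient of t^(N - 1) is therefore the first order term in Q.\<close>

lemma coeff_det_pencil:
  assumes A: "A \<in> carrier_mat N N" and "0 < N"
  shows "pcoeff (det (mat N N (\<lambda>(r, c). [:Q $$ (r, c), A $$ (r, c):]))) (N - 1) = det_deriv A Q"
proof -
  let ?B = "mat N N (\<lambda>(r, c). [:Q $$ (r, c), A $$ (r, c):])"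
  let ?R = "\<lambda>r. mat N N (\<lambda>(r', c). if r' = r then Q $$ (r, c) else A $$ (r', c))"
  have cs: "pcoeff (signof p * x) k = signof p * pcoeff x k" for p x and k :: nat
    by (simp add: sign_def)
  have "pcoeff (det ?B) (N - 1) = (\<Sum>p | p permutes {0..<N}. signof p *
      pcoeff (\<Prod>i = 0..<N. [:Q $$ (i, p i), A $$ (i, p i):]) (N - 1))"
    by (subst det_def'[of _ N]) (auto simp: coeff_sum cs permutes_in_image intro!: sum.cong prod.cong
        arg_cong2[of _ _ _ _ pcoeff] arg_cong2[of _ _ _ _ times])
  also have "\<dots> = (\<Sum>p | p permutes {0..<N}. \<Sum>r\<in>{0..<N}. signof p *
      (Q $$ (r, p r) * (\<Prod>s\<in>{0..<N} - {r}. A $$ (s, p s))))"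
  proof (rule sum.cong[OF refl])
    fix p
    have "pcoeff (\<Prod>i = 0..<N. [:Q $$ (i, p i), A $$ (i, p i):]) (N - 1)
        = (\<Sum>r\<in>{0..<N}. Q $$ (r, p r) * (\<Prod>s\<in>{0..<N} - {r}. A $$ (s, p s)))"
      using coeff_prod_linear[of "{0..<N}" "\<lambda>i. Q $$ (i, p i)" "\<lambda>i. A $$ (i, p i)"] \<open>0 < N\<close> by simp
    then show "signof p * pcoeff (\<Prod>i = 0..<N. [:Q $$ (i, p i), A $$ (i, p i):]) (N - 1)
        = (\<Sum>r\<in>{0..<N}. signof p * (Q $$ (r, p r) * (\<Prod>s\<in>{0..<N} - {r}. A $$ (s, p s))))"
      by (simp add: sum_distrib_left)
  qed
  also have "\<dots> = (\<Sum>r\<in>{0..<N}. \<Sum>p | p permutes {0..<N}. signof p *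
      (Q $$ (r, p r) * (\<Prod>s\<in>{0..<N} - {r}. A $$ (s, p s))))"
    by (rule sum.swap)
  also have "\<dots> = (\<Sum>r\<in>{0..<N}. det (?R r))"
  proof (rule sum.cong[OF refl])
    fix r assume r: "r \<in> {0..<N}"
    have "(\<Prod>i = 0..<N. ?R r $$ (i, p i)) = Q $$ (r, p r) * (\<Prod>s\<in>{0..<N} - {r}. A $$ (s, p s))"
      if "p permutes {0..<N}" for p
    proof -
      have lt: "p i < N" if "i < N" for i using permutes_in_image[OF \<open>p permutes _\<close>, of i] that by simp
      show ?thesis
        using r lt by (subst prod.remove[of _ r]) (auto intro!: arg_cong2[of _ _ _ _ times] prod.cong)
    qed
    then show "(\<Sum>p | p permutes {0..<N}. signof p * (Q $$ (r, p r) * (\<Prod>s\<in>{0..<N} - {r}. A $$ (s, p s)))) = det (?R r)"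
      by (subst det_def'[of "?R r" N]) (auto intro!: sum.cong)
  qed
  also have "\<dots> = det_deriv A Q"
    unfolding det_deriv_def using A
    by (auto simp: atLeast0LessThan det_row_replaced intro!: sum.cong)
  finally show ?thesis .
qed

lemma det_deriv_eq_sum_det:
  assumes A: "A \<in> carrier_mat N N"
  shows "det_deriv A Q = (\<Sum>r<N. det (mat N N (\<lambda>(r', c). if r' = r then Q $$ (r, c) else A $$ (r', c))))"
  unfolding det_deriv_def using A by (auto simp: det_row_replaced intro!: sum.cong)

lemma det_deriv_add:
  assumes "A \<in> carrier_mat N N" "Q \<in> carrier_mat N N" "Q' \<in> carrier_mat N N"
  shows "det_deriv A (Q + Q') = det_deriv A Q + det_deriv A Q'"
  unfolding det_deriv_def using assms by (simp add: algebra_simps sum.distrib)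

lemma map_mat_pconst_mult:
  assumes "A \<in> carrier_mat a b" "B \<in> carrier_mat b c"
  shows "map_mat (\<lambda>x. [:x:]) (A * B) = map_mat (\<lambda>x :: 'r :: comm_ring_1. [:x:]) A * map_mat (\<lambda>x. [:x:]) B"
  using hom_pconst assms
  by (metis comm_ring_hom.axioms(1) comm_semiring_hom.axioms(1) ring_hom.axioms(1) semiring_hom.mat_hom_mult)

lemma det_map_mat_pconst: "det (map_mat (\<lambda>x. [:x:]) A) = [:det A:]"
  by (rule comm_ring_hom.hom_det[OF hom_pconst])

text \<open>Both sides are the same coefficient of the determinant of a pencil, and multiplying the
  pencil by H and U does not change that determinant. Size 0 is separate because N - 1 is then
  truncated.\<close>

lemma det_deriv_unimodular:
  fixes A :: "'r :: comm_ring_1 mat"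
  assumes c: "A \<in> carrier_mat N N" "Q \<in> carrier_mat N N" "H \<in> carrier_mat N N" "U \<in> carrier_mat N N"
    and det: "det H = 1" "det U = 1"
  shows "det_deriv (H * A * U) (H * Q * U) = det_deriv A Q"
proof (cases "N = 0")
  case False
  let ?h = "map_mat (\<lambda>x. [:x:])"
  let ?pen = "\<lambda>A Q. mat N N (\<lambda>(r, c). [:Q $$ (r, c), A $$ (r, c):])"
  have pen: "?pen A Q = ?h Q + [:0, 1:] \<cdot>\<^sub>m ?h A" if "A \<in> carrier_mat N N" "Q \<in> carrier_mat N N" for A Q :: "'r mat"
    using that by (intro eq_matI) (auto simp: mult.commute)
  have hc: "?h M \<in> carrier_mat N N" if "M \<in> carrier_mat N N" for M :: "'r mat" using that by simp
  have "?pen (H * A * U) (H * Q * U) = ?h (H * Q * U) + [:0, 1:] \<cdot>\<^sub>m ?h (H * A * U)"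
    using c by (intro pen) auto
  also have "\<dots> = ?h H * ?h Q * ?h U + [:0, 1:] \<cdot>\<^sub>m (?h H * ?h A * ?h U)"
    using c by (simp add: map_mat_pconst_mult[of _ N N _ N])
  also have "[:0, 1:] \<cdot>\<^sub>m (?h H * ?h A * ?h U) = ?h H * ([:0, 1:] \<cdot>\<^sub>m ?h A) * ?h U"
    using hc[OF c(1)] hc[OF c(3)] hc[OF c(4)]
    by (simp add: mult_smult_distrib[of _ N N _ N] mult_smult_assoc_mat[of _ N N _ N])
  also have "?h H * ?h Q * ?h U + ?h H * ([:0, 1:] \<cdot>\<^sub>m ?h A) * ?h U = ?h H * ?pen A Q * ?h U"
    unfolding pen[OF c(1,2)] using hc[OF c(1)] hc[OF c(2)] hc[OF c(3)] hc[OF c(4)]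
    by (simp add: mult_add_distrib_mat[of _ N N _ N] add_mult_distrib_mat[of _ N N _ _ N])
  finally have eq: "?pen (H * A * U) (H * Q * U) = ?h H * ?pen A Q * ?h U" .
  have "det (?pen (H * A * U) (H * Q * U)) = det (?h H * ?pen A Q) * det (?h U)"
    unfolding eq by (rule det_mult) (use hc c in auto)
  also have "det (?h H * ?pen A Q) = det (?h H) * det (?pen A Q)"
    by (rule det_mult) (use hc c in auto)
  finally have "det (?pen (H * A * U) (H * Q * U)) = det (?pen A Q)"
    by (simp only: det_map_mat_pconst det one_pCons[symmetric] mult_1_left mult_1_right)
  then show ?thesis
    using False c coeff_det_pencil[of "H * A * U" N "H * Q * U"] coeff_det_pencil[of A N Q] by simp
qed (use c in \<open>simp add: det_deriv_def\<close>)

text \<open>In the trace, adj A meets A, and their product is det A times the identity, hence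
  0.\<close>

lemma det_deriv_mult_singular:
  assumes A: "A \<in> carrier_mat N N" and E: "E \<in> carrier_mat N N" and det: "det A = 0"
  shows "det_deriv A (E * A) = 0" "det_deriv A (A * E) = 0"
proof -
  have dA: "dim_row A = N" "dim_col A = N" using A by auto
  have adj: "(\<Sum>c<N. A $$ (k, c) * cofactor A r c) = 0" if "r < N" "k < N" for r k
  proof -
    have "(\<Sum>c<N. A $$ (k, c) * cofactor A r c) = (A * adj_mat A) $$ (k, r)"
      using that dA adj_mat(1)[OF A] by (simp add: scalar_prod_def adj_mat_def atLeast0LessThan)
    also have "\<dots> = 0" using that by (simp add: adj_mat(2)[OF A] det)
    finally show ?thesis .
  qed
  have adj': "(\<Sum>r<N. A $$ (r, k) * cofactor A r c) = 0" if "c < N" "k < N" for c k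
  proof -
    have "(\<Sum>r<N. A $$ (r, k) * cofactor A r c) = (adj_mat A * A) $$ (c, k)"
      using that dA adj_mat(1)[OF A] by (simp add: scalar_prod_def adj_mat_def atLeast0LessThan mult.commute)
    also have "\<dots> = 0" using that by (simp add: adj_mat(3)[OF A] det)
    finally show ?thesis .
  qed
  have "det_deriv A (E * A) = (\<Sum>r<N. \<Sum>c<N. \<Sum>k<N. E $$ (r, k) * (A $$ (k, c) * cofactor A r c))"
    unfolding det_deriv_def using dA E
    by (auto simp: scalar_prod_def sum_distrib_right mult.assoc atLeast0LessThan intro!: sum.cong)
  also have "\<dots> = (\<Sum>r<N. \<Sum>k<N. \<Sum>c<N. E $$ (r, k) * (A $$ (k, c) * cofactor A r c))"
    by (rule sum.cong[OF refl sum.swap])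
  also have "\<dots> = 0" by (simp add: adj flip: sum_distrib_left)
  finally show "det_deriv A (E * A) = 0" .
  have "det_deriv A (A * E) = (\<Sum>r<N. \<Sum>c<N. \<Sum>k<N. E $$ (k, c) * (A $$ (r, k) * cofactor A r c))"
    unfolding det_deriv_def using dA E
    by (auto simp: scalar_prod_def sum_distrib_left sum_distrib_right mult_ac atLeast0LessThan intro!: sum.cong)
  also have "\<dots> = (\<Sum>c<N. \<Sum>r<N. \<Sum>k<N. E $$ (k, c) * (A $$ (r, k) * cofactor A r c))"
    by (rule sum.swap)
  also have "\<dots> = (\<Sum>c<N. \<Sum>k<N. \<Sum>r<N. E $$ (k, c) * (A $$ (r, k) * cofactor A r c))"
    by (rule sum.cong[OF refl sum.swap])
  also have "\<dots> = 0" by (simp add: adj' flip: sum_distrib_left)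
  finally show "det_deriv A (A * E) = 0" .
qed

text \<open>The three arguments are the blocks A, U, V after a block lower triangular conjugation.
  As u2 and h2 cancel, the new product is h1 (U V + terms with a factor A on one side) u3, and those
  terms contribute nothing.\<close>

lemma det_deriv_triangular_conj:
  assumes A: "A \<in> carrier_mat i i" and U: "U \<in> carrier_mat i m" and V: "V \<in> carrier_mat m i"
    and h1: "h1 \<in> carrier_mat i i" and h2: "h2 \<in> carrier_mat m m" and h21: "h21 \<in> carrier_mat m i"
    and u3: "u3 \<in> carrier_mat i i" and u2: "u2 \<in> carrier_mat m m" and u32: "u32 \<in> carrier_mat i m"
    and inv: "u2 * h2 = 1\<^sub>m m" and det: "det h1 = 1" "det u3 = 1" "det A = 0"
  shows "det_deriv (h1 * A * u3) ((h1 * (U * u2 + A * u32)) * ((h2 * V + h21 * A) * u3)) = det_deriv A (U * V)"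
proof -
  note c = assms(1-9)
  have e1: "U * u2 * (h2 * V) = U * V"
  proof -
    have "U * u2 * (h2 * V) = U * (u2 * h2 * V)"
      using c by (simp add: assoc_mult_mat[of _ i m _ m _ i] assoc_mult_mat[of _ m m _ m _ i])
    then show ?thesis using V by (simp add: inv)
  qed
  have "(h1 * (U * u2 + A * u32)) * ((h2 * V + h21 * A) * u3)
      = h1 * ((U * u2 + A * u32) * (h2 * V + h21 * A)) * u3"
  proof -
    let ?X = "U * u2 + A * u32" and ?Y = "h2 * V + h21 * A"
    have X: "?X \<in> carrier_mat i m" and Y: "?Y \<in> carrier_mat m i" using c by auto
    have "h1 * ?X * (?Y * u3) = h1 * ?X * ?Y * u3"
      by (rule assoc_mult_mat[of _ i m _ i _ i, symmetric]) (use h1 u3 X Y in auto)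
    also have "h1 * ?X * ?Y = h1 * (?X * ?Y)"
      by (rule assoc_mult_mat) (use h1 X Y in auto)
    finally show ?thesis .
  qed
  also have "(U * u2 + A * u32) * (h2 * V + h21 * A)
      = (U * V + A * (u32 * (h2 * V))) + ((U * u2 * h21) * A + A * (u32 * (h21 * A)))"
  proof -
    have "U * u2 * (h21 * A) = U * u2 * h21 * A"
      by (rule assoc_mult_mat[of _ i m _ i _ i, symmetric]) (use c in auto)
    moreover have "A * u32 * (h2 * V) = A * (u32 * (h2 * V))" "A * u32 * (h21 * A) = A * (u32 * (h21 * A))"
      by (rule assoc_mult_mat[of _ i i _ m _ i]; use c in auto)+
    ultimately show ?thesis
      using c by (simp add: add_mult_distrib_mat[of _ i m _ _ i] mult_add_distrib_mat[of _ i m _ i] e1)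
  qed
  finally have eq: "(h1 * (U * u2 + A * u32)) * ((h2 * V + h21 * A) * u3)
      = h1 * ((U * V + A * (u32 * (h2 * V))) + ((U * u2 * h21) * A + A * (u32 * (h21 * A)))) * u3" .
  have "det_deriv (h1 * A * u3) ((h1 * (U * u2 + A * u32)) * ((h2 * V + h21 * A) * u3))
      = det_deriv A ((U * V + A * (u32 * (h2 * V))) + ((U * u2 * h21) * A + A * (u32 * (h21 * A))))"
    unfolding eq by (rule det_deriv_unimodular[OF A _ h1 u3 det(1,2)]) (use c in auto)
  also have "\<dots> = det_deriv A (U * V)"
  proof -
    define E1 E2 E3 where "E1 = U * u2 * h21" and "E2 = u32 * (h2 * V)" and "E3 = u32 * (h21 * A)"
    have "E1 \<in> carrier_mat i i" "E2 \<in> carrier_mat i i" "E3 \<in> carrier_mat i i"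
      unfolding E1_def E2_def E3_def using c by auto
    then show ?thesis
      unfolding E1_def[symmetric] E2_def[symmetric] E3_def[symmetric]
      using c by (simp add: det_deriv_add[of _ i] det_deriv_mult_singular[OF A _ det(3)])
  qed
  finally show ?thesis .
qed

lemma sum_lessThan_add:
  fixes f :: "nat \<Rightarrow> 'r :: comm_monoid_add"
  shows "(\<Sum>r<i + m. f r) = (\<Sum>r<i. f r) + (\<Sum>j<m. f (i + j))"
  by (induction m) (simp_all add: add.assoc)

text \<open>Multiplying the characteristic matrix by \<open>[[V, 1], [\<tau>, 0]]\<close> yields a pencil
  \<open>Q + \<tau> P\<close> in which \<open>P = diag(A, -1)\<close>.\<close>

lemma coeff_det_corner_char_mat:
  fixes A :: "'r :: idom mat"
  assumes A: "A \<in> carrier_mat i i" and U: "U \<in> carrier_mat i m" and V: "V \<in> carrier_mat m i"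
    and D: "D \<in> carrier_mat m m" "\<And>r c. c \<le> r \<Longrightarrow> r < m \<Longrightarrow> D $$ (r, c) = 0" and "0 < m"
  shows "pcoeff (det (four_block_mat (map_mat (\<lambda>x. [:x:]) U) (map_mat (\<lambda>x. [:x:]) A)
      (map_mat (\<lambda>x. [:x:]) D - [:0, 1:] \<cdot>\<^sub>m 1\<^sub>m m) (map_mat (\<lambda>x. [:x:]) V))) (m - 1)
    = (-1) ^ (m * i + m) * det_deriv A (U * V)"
proof -
  let ?h = "map_mat (\<lambda>x :: 'r. [:x:])"
  let ?t = "[:0, 1:] :: 'r poly"
  let ?T = "four_block_mat (?h U) (?h A) (?h D - ?t \<cdot>\<^sub>m 1\<^sub>m m) (?h V)"
  let ?C = "four_block_mat (?h V) (1\<^sub>m m) (?t \<cdot>\<^sub>m 1\<^sub>m i) (0\<^sub>m i m)"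
  let ?P = "four_block_mat A (0\<^sub>m i m) (0\<^sub>m m i) ((-1) \<cdot>\<^sub>m 1\<^sub>m m)"
  let ?Q = "four_block_mat (U * V) U (D * V) D"
  let ?N = "i + m"
  have TC: "?T * ?C = mat ?N ?N (\<lambda>(r, c). [:?Q $$ (r, c), ?P $$ (r, c):])"
  proof -
    \<comment> \<open>In the lower left block the multiples of \<tau> cancel: (D - \<tau>) V + V
      \<tau> = D V.\<close>
    have "?T * ?C = four_block_mat (?h U * ?h V + ?h A * (?t \<cdot>\<^sub>m 1\<^sub>m i)) (?h U * 1\<^sub>m m + ?h A * 0\<^sub>m i m)
      ((?h D - ?t \<cdot>\<^sub>m 1\<^sub>m m) * ?h V + ?h V * (?t \<cdot>\<^sub>m 1\<^sub>m i)) ((?h D - ?t \<cdot>\<^sub>m 1\<^sub>m m) * 1\<^sub>m m + ?h V * 0\<^sub>m i m)"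
      using A U V D by (intro mult_four_block_mat) auto
    also have "?h U * ?h V + ?h A * (?t \<cdot>\<^sub>m 1\<^sub>m i) = ?h (U * V) + ?t \<cdot>\<^sub>m ?h A"
      using A U V by (simp add: map_mat_pconst_mult[of _ i m _ i] mult_smult_distrib[of _ i i _ i])
    also have "?h U * 1\<^sub>m m + ?h A * 0\<^sub>m i m = ?h U" using A U by simp
    also have "(?h D - ?t \<cdot>\<^sub>m 1\<^sub>m m) * ?h V + ?h V * (?t \<cdot>\<^sub>m 1\<^sub>m i) = ?h (D * V)"
    proof -
      have "(?h D - ?t \<cdot>\<^sub>m 1\<^sub>m m) * ?h V = ?h D * ?h V - ?t \<cdot>\<^sub>m ?h V"
        using D V by (simp add: minus_mult_distrib_mat[of _ m m _ _ i] mult_smult_assoc_mat[of _ m m _ i])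
      moreover have "?h V * (?t \<cdot>\<^sub>m 1\<^sub>m i) = ?t \<cdot>\<^sub>m ?h V"
        using V by (simp add: mult_smult_distrib[of _ m i _ i])
      moreover have "?h D * ?h V - ?t \<cdot>\<^sub>m ?h V + ?t \<cdot>\<^sub>m ?h V = ?h D * ?h V"
        using D V by (intro eq_matI) auto
      ultimately show ?thesis using D V by (simp add: map_mat_pconst_mult[of _ m m _ i])
    qed
    also have "(?h D - ?t \<cdot>\<^sub>m 1\<^sub>m m) * 1\<^sub>m m + ?h V * 0\<^sub>m i m = ?h D - ?t \<cdot>\<^sub>m 1\<^sub>m m"
    proof -
      have Dt: "?h D - ?t \<cdot>\<^sub>m 1\<^sub>m m \<in> carrier_mat m m" using D by auto
      show ?thesis using V by (simp add: right_add_zero_mat[OF Dt] right_mult_one_mat[OF Dt])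
    qed
    also have "four_block_mat (?h (U * V) + ?t \<cdot>\<^sub>m ?h A) (?h U) (?h (D * V)) (?h D - ?t \<cdot>\<^sub>m 1\<^sub>m m)
        = mat ?N ?N (\<lambda>(r, c). [:?Q $$ (r, c), ?P $$ (r, c):])"
      using A U V D(1) by (intro eq_matI) (auto simp: one_pCons simp del: index_mult_mat(1))
    finally show ?thesis .
  qed
  have Cc: "?C \<in> carrier_mat (m + i) (m + i)" using V by (auto simp: add.commute)
  \<comment> \<open>Swapping the block columns gives an upper triangular matrix of determinant
    \<tau>^i; this shifts the coefficient m - 1 of \<open>det ?T\<close> to i + m - 1, where
    \<open>coeff_det_pencil\<close> applies.\<close>
  have "det ?C = (-1) ^ (m * i) * det (mat (m + i) (m + i) (\<lambda>(r, c). ?C $$ (r, if c < m then c + i else c - m)))"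
    by (rule det_swap_cols[OF Cc])
  also have "mat (m + i) (m + i) (\<lambda>(r, c). ?C $$ (r, if c < m then c + i else c - m))
      = four_block_mat (1\<^sub>m m) (?h V) (0\<^sub>m i m) (?t \<cdot>\<^sub>m 1\<^sub>m i)"
    using V by (intro eq_matI) auto
  also have "det \<dots> = det (1\<^sub>m m :: 'r poly mat) * det (?t \<cdot>\<^sub>m 1\<^sub>m i)"
    using V by (intro det_four_block_mat_lower_left_zero) auto
  also have "\<dots> = Polynomial.monom 1 i" by (simp add: monom_altdef)
  finally have detC: "det ?C = (-1) ^ (m * i) * Polynomial.monom 1 i" .
  have dT: "det ?T * det ?C = det (mat ?N ?N (\<lambda>(r, c). [:?Q $$ (r, c), ?P $$ (r, c):]))"
  proof -
    have "?T \<in> carrier_mat ?N ?N" using A U V D by (auto simp: add.commute)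
    moreover have "?C \<in> carrier_mat ?N ?N" using Cc by (simp add: add.commute)
    ultimately show ?thesis unfolding TC[symmetric] by (rule det_mult[symmetric])
  qed
  have P: "?P \<in> carrier_mat ?N ?N" using A by auto
  let ?R = "\<lambda>r. mat ?N ?N (\<lambda>(r', c). if r' = r then ?Q $$ (r, c) else ?P $$ (r', c))"
  have R1: "det (?R r) = det (mat i i (\<lambda>(r', c). if r' = r then (U * V) $$ (r, c) else A $$ (r', c))) * (-1) ^ m"
    if "r < i" for r
  proof -
    have "?R r = four_block_mat (mat i i (\<lambda>(r', c). if r' = r then (U * V) $$ (r, c) else A $$ (r', c)))
        (mat i m (\<lambda>(r', c). if r' = r then U $$ (r, c) else 0)) (0\<^sub>m m i) ((-1) \<cdot>\<^sub>m 1\<^sub>m m)"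
      using that A U V D by (intro eq_matI) (auto simp del: index_mult_mat(1))
    also have "det \<dots> = det (mat i i (\<lambda>(r', c). if r' = r then (U * V) $$ (r, c) else A $$ (r', c)))
        * det ((-1 :: 'r) \<cdot>\<^sub>m 1\<^sub>m m)"
      by (rule det_four_block_mat_lower_left_zero) auto
    finally show ?thesis by simp
  qed
  \<comment> \<open>Row j of -1 is replaced by row j of D, which puts a 0 on the diagonal of a
    triangular matrix.\<close>
  have R2: "det (?R (i + j)) = 0" if "j < m" for j
  proof -
    let ?E = "mat m m (\<lambda>(j', c). if j' = j then D $$ (j, c) else ((-1) \<cdot>\<^sub>m 1\<^sub>m m) $$ (j', c))"
    have "?R (i + j) = four_block_mat A (0\<^sub>m i m) (mat m i (\<lambda>(j', c). if j' = j then (D * V) $$ (j, c) else 0)) ?E"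
      using that A U V D by (intro eq_matI) (auto simp del: index_mult_mat(1))
    also have "det \<dots> = det A * det ?E"
      using A by (intro det_four_block_mat_upper_right_zero) auto
    also have "det ?E = 0"
    proof -
      have "upper_triangular ?E" using D(2) by (auto simp: upper_triangular_def)
      moreover have "0 \<in> set (diag_mat ?E)" using that D(2)[of j j] by (force simp: diag_mat_def)
      ultimately show ?thesis using upper_triangular_imp_det_eq_0_iff[of ?E m] by auto
    qed
    finally show ?thesis by simp
  qed
  have "pcoeff (det ?T * det ?C) (?N - 1) = det_deriv ?P ?Q"
    unfolding dT using \<open>0 < m\<close> by (intro coeff_det_pencil P) auto
  also have "\<dots> = (\<Sum>r<i + m. det (?R r))" by (rule det_deriv_eq_sum_det[OF P])
  also have "\<dots> = (\<Sum>r<i. det (?R r)) + (\<Sum>j<m. det (?R (i + j)))"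
    by (rule sum_lessThan_add)
  also have "\<dots> = (-1) ^ m * det_deriv A (U * V)"
    by (simp add: R1 R2 det_deriv_eq_sum_det[OF A] sum_distrib_left mult.commute)
  finally have "pcoeff (det ?T * det ?C) (?N - 1) = (-1) ^ m * det_deriv A (U * V)" .
  moreover have "pcoeff (det ?T * det ?C) (?N - 1) = (-1) ^ (m * i) * pcoeff (det ?T) (m - 1)"
  proof -
    have sg: "(-1) ^ (m * i) * Polynomial.monom 1 i = Polynomial.monom ((-1) ^ (m * i) :: 'r) i"
      by (cases "even (m * i)") (simp_all add: minus_monom)
    have "det ?T * det ?C = Polynomial.monom ((-1) ^ (m * i)) i * det ?T"
      unfolding detC sg by (rule mult.commute)
    moreover have "pcoeff (Polynomial.monom c i * x) (?N - 1) = c * pcoeff x (m - 1)"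
      for c and x :: "'r poly" using \<open>0 < m\<close> by (simp add: coeff_monom_mult)
    ultimately show ?thesis by (simp only:)
  qed
  ultimately have eq: "(-1) ^ (m * i) * pcoeff (det ?T) (m - 1) = (-1) ^ m * det_deriv A (U * V)" by simp
  have "pcoeff (det ?T) (m - 1) = (-1) ^ (m * i) * ((-1) ^ (m * i) * pcoeff (det ?T) (m - 1))"
    by (simp flip: mult.assoc power_mult_distrib)
  also have "\<dots> = (-1) ^ (m * i + m) * det_deriv A (U * V)"
    unfolding eq by (simp add: power_add mult.assoc)
  finally show ?thesis .
qed

section \<open>The roots of \<open>S\<close> and \<open>L\<^sub>S\<close>\<close>

locale root_subset =
  fixes n :: nat and S :: "root set"
  assumes n: "2 < n" and S: "S \<subseteq> Pi_roots n"
begin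

abbreviation k :: nat where "k \<equiv> kk n"

lemma k_bounds: "1 \<le> k" "2 * k < n" "n \<le> 2 * k + 2"
  using n by (auto simp: kk_def)

lemma k_odd: "odd n \<Longrightarrow> n \<le> 2 * k + 1"
  using n unfolding kk_def by presburger

lemma k_even: "even n \<Longrightarrow> 2 * k + 2 \<le> n"
  using n unfolding kk_def by presburger

definition rows :: "nat set" where "rows = {i. (i, n - i) \<in> S}"

lemma rows_bounds: "i \<in> rows \<Longrightarrow> 1 \<le> i \<and> i \<le> k"
  using S by (auto simp: rows_def Pi_roots_def)

lemma in_S_iff: "(i, j) \<in> S \<longleftrightarrow> i \<in> rows \<and> j = n - i"
  using S by (auto simp: rows_def Pi_roots_def)

text \<open>Makes the maximum in \<open>pd\<close> range over a nonempty set; the value 0 stands for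
  the last column n.\<close>

lemma zero_notin_rows: "0 \<notin> rows"
  using rows_bounds by force

text \<open>The root of \<open>L\<^sub>S\<close> in row \<open>i \<le> k\<close> is \<open>(i, n - pd i)\<close>.\<close>

definition pd :: "nat \<Rightarrow> nat" where "pd i = Max {m. m < i \<and> m \<notin> rows}"

lemma pd_props:
  assumes "1 \<le> i"
  shows "pd i < i" "pd i \<notin> rows" "m < i \<Longrightarrow> m \<notin> rows \<Longrightarrow> m \<le> pd i"
proof -
  have "pd i \<in> {m. m < i \<and> m \<notin> rows}"
    unfolding pd_def using assms zero_notin_rows by (intro Max_in) (auto intro!: exI[of _ 0])
  then show "pd i < i" "pd i \<notin> rows" by auto
  show "m \<le> pd i" if "m < i" "m \<notin> rows"
    unfolding pd_def using that by (intro Max_ge) auto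
qed

lemma pd_between: "1 \<le> i \<Longrightarrow> pd i < m \<Longrightarrow> m < i \<Longrightarrow> m \<in> rows"
  using pd_props(3)[of i m] by force

lemma pd_eqI:
  assumes "m < i" "m \<notin> rows" "\<And>m'. m < m' \<Longrightarrow> m' < i \<Longrightarrow> m' \<in> rows"
  shows "pd i = m"
proof -
  have "1 \<le> i" using assms(1) by simp
  note pd = pd_props[OF this]
  show ?thesis using assms pd(1,2) pd(3)[of m] by (metis le_neq_implies_less)
qed

text \<open>The offset of the pivot of row i: the root of S if the row has one, otherwise the root
  of \<open>L_zero\<close>.\<close>

definition pcol :: "nat \<Rightarrow> nat" where "pcol i = (if i \<in> rows then i else pd i)"

lemma pcol_le: "1 \<le> i \<Longrightarrow> pcol i \<le> i"
  using pd_props(1)[of i] by (simp add: pcol_def)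

text \<open>If x is in \<open>rows\<close>, then \<open>pcol x\<close> = x is too, but
  \<open>pd y\<close> is not. Otherwise \<open>pd y\<close> is at least x, while
  \<open>pcol x\<close> = \<open>pd x\<close> is smaller than x.\<close>

lemma pcol_ne_pd: "1 \<le> x \<Longrightarrow> x < y \<Longrightarrow> pcol x \<noteq> pd y"
  using pd_props[of x] pd_props[of y] by (auto simp: pcol_def split: if_splits) force

lemma pcol_inj: "1 \<le> x \<Longrightarrow> 1 \<le> y \<Longrightarrow> pcol x = pcol y \<Longrightarrow> x = y"
proof (induction x y rule: linorder_wlog)
  case (le x y)
  show ?case
  proof (rule ccontr)
    assume "x \<noteq> y"
    with le have "x < y" by simp
    with pcol_ne_pd[of x y] le pcol_le[of x] show False by (auto simp: pcol_def[of y] split: if_splits)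
  qed
qed auto

text \<open>The converse of \<open>pd\<close>: an offset outside \<open>rows\<close> with a later
  such offset is the pivot offset of the next one, so its column contains a pivot when that one is
  at most k.\<close>

lemma next_nonrow:
  assumes "m \<notin> rows" "m < t" "t \<notin> rows"
  obtains c where "m < c" "c \<le> t" "c \<notin> rows" "pd c = m"
proof -
  let ?c = "LEAST c. m < c \<and> c \<notin> rows"
  have c: "m < ?c" "?c \<notin> rows" using LeastI[of "\<lambda>c. m < c \<and> c \<notin> rows" t] assms by auto
  have "?c \<le> t" using assms by (intro Least_le) auto
  moreover have "pd ?c = m"
  proof (rule pd_eqI)
    show "m' \<in> rows" if "m < m'" "m' < ?c" for m'
      using not_less_Least[OF that(2)] that(1) by blast
  qed (use c assms in auto)
  ultimately show ?thesis using that c by blast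
qed

text \<open>The root (m, n - m) lies above and left of (i, j) exactly if n - j < m < i; the bound on
  i keeps such m at most k.\<close>

lemma above_left_iff:
  assumes "j \<le> n" "i \<le> k + 1"
  shows "above_left_in n S (i, j) \<longleftrightarrow> (\<forall>m. n - j < m \<longrightarrow> m < i \<longrightarrow> m \<in> rows)"
proof
  assume L: "above_left_in n S (i, j)"
  show "\<forall>m. n - j < m \<longrightarrow> m < i \<longrightarrow> m \<in> rows"
  proof (intro allI impI)
    fix m assume m: "n - j < m" "m < i"
    then have "(m, n - m) \<in> Pi_roots n" using assms by (auto simp: Pi_roots_def)
    moreover have "n - m < j" using m assms k_bounds by linarith
    ultimately show "m \<in> rows" using L m by (auto simp: above_left_in_def rows_def)
  qed
next
  assume R: "\<forall>m. n - j < m \<longrightarrow> m < i \<longrightarrow> m \<in> rows"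
  show "above_left_in n S (i, j)"
    unfolding above_left_in_def
  proof (intro ballI impI)
    fix \<beta> assume \<beta>: "\<beta> \<in> Pi_roots n" "fst \<beta> < fst (i, j) \<and> snd \<beta> < snd (i, j)"
    then obtain m where m: "\<beta> = (m, n - m)" "1 \<le> m" "m \<le> k" by (auto simp: Pi_roots_def)
    with \<beta> have "n - m < j" "m < i" by auto
    with m assms k_bounds have "n - j < m" by linarith
    with R \<open>m < i\<close> have "m \<in> rows" by blast
    then show "\<beta> \<in> S" by (simp add: m in_S_iff)
  qed
qed

lemma no_row_iff: "no_root_in_row S i \<longleftrightarrow> i \<notin> rows"
  by (auto simp: no_root_in_row_def in_S_iff Ball_def)

lemma no_column_iff:
  assumes "j \<le> n"
  shows "no_root_in_column S j \<longleftrightarrow> n - j \<notin> rows"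
proof -
  have "(\<exists>\<beta>\<in>S. snd \<beta> = j) \<longleftrightarrow> n - j \<in> rows"
  proof
    assume "\<exists>\<beta>\<in>S. snd \<beta> = j"
    then obtain i where "(i, j) \<in> S" by auto
    then have "i \<in> rows" "j = n - i" by (simp_all add: in_S_iff)
    with rows_bounds[of i] k_bounds show "n - j \<in> rows" by simp
  next
    assume "n - j \<in> rows"
    with assms have "(n - j, j) \<in> S" by (simp add: in_S_iff)
    then show "\<exists>\<beta>\<in>S. snd \<beta> = j" by force
  qed
  then show ?thesis by (auto simp: no_root_in_column_def)
qed

text \<open>In terms of n - j the three conditions say: smaller than i, not in \<open>rows\<close>,
  and everything strictly between in \<open>rows\<close>. This characterises
  \<open>pd i\<close>.\<close>

lemma column_eq_pd:
  assumes "1 \<le> i" "i \<le> k + 1" "j \<le> n"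
  shows "(i + j \<ge> n + 1 \<and> no_root_in_column S j \<and> above_left_in n S (i, j)) \<longleftrightarrow> j = n - pd i"
proof
  assume L: "i + j \<ge> n + 1 \<and> no_root_in_column S j \<and> above_left_in n S (i, j)"
  have "pd i = n - j"
    using L assms by (intro pd_eqI) (auto simp: no_column_iff above_left_iff)
  then show "j = n - pd i" using assms by simp
next
  assume j: "j = n - pd i"
  have pd: "pd i < i" by (rule pd_props) fact
  have "n - j = pd i" using j pd assms k_bounds by simp
  then show "i + j \<ge> n + 1 \<and> no_root_in_column S j \<and> above_left_in n S (i, j)"
    using assms pd pd_props(2)[of i] j k_bounds
    by (auto simp: no_column_iff above_left_iff intro: pd_between[OF assms(1)])
qed

lemma pd_root: "1 \<le> i \<Longrightarrow> 2 * i \<le> n \<Longrightarrow> (i, n - pd i) \<in> roots n"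
  using pd_props(1)[of i] by (auto simp: roots_def)

lemma L_zero_iff: "(i, j) \<in> L_zero n S \<longleftrightarrow> 1 \<le> i \<and> i \<le> k \<and> i \<notin> rows \<and> j = n - pd i"
  using column_eq_pd[of i j] pd_root[of i] k_bounds
  by (auto simp: L_zero_def no_row_iff roots_def)

lemma L_plus_iff: "(i, j) \<in> L_plus n S \<longleftrightarrow> i \<in> rows \<and> j = n - pd i"
  using column_eq_pd[of i j] pd_root[of i] k_bounds rows_bounds[of i]
  by (auto simp: L_plus_def in_S_iff roots_def)

lemma L_minus_iff: "(a, b) \<in> L_minus n S \<longleftrightarrow> (\<exists>i\<in>rows. a = n - i \<and> b = n - pd i)"
  by (auto simp: L_minus_def L_plus_iff)

lemma L_zerozero_iff: "(i, j) \<in> L_zerozero n S \<longleftrightarrow> even n \<and> i = k + 1 \<and> j = n - pd (k + 1)"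
proof -
  have "k + 1 + j \<ge> n + 1" if "(k + 1, j) \<in> roots n" "even n" using that k_bounds by (auto simp: roots_def)
  moreover have "k + 1 \<notin> rows" using rows_bounds by force
  ultimately show ?thesis
    using column_eq_pd[of "k + 1" j] pd_root[of "k + 1"] k_bounds k_even
    by (auto simp: L_zerozero_def no_row_iff roots_def)
qed

section \<open>Pivots, and the index sets of the minors\<close>

definition pivots :: "root set" where "pivots = S \<union> L_zero n S"

lemma pivots_iff: "(a, b) \<in> pivots \<longleftrightarrow> 1 \<le> a \<and> a \<le> k \<and> b = n - pcol a"
  using rows_bounds[of a] by (auto simp: pivots_def in_S_iff L_zero_iff pcol_def)

definition upper :: "root set" where
  "upper = S \<union> L_plus n S \<union> L_zero n S \<union> L_zerozero n S"

lemma upper_iff: "(a, b) \<in> upper \<longleftrightarrow> (a \<in> rows \<and> b = n - a) \<or>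
    (1 \<le> a \<and> (a \<le> k \<or> even n \<and> a = k + 1) \<and> b = n - pd a)"
  using rows_bounds[of a] by (auto simp: upper_def in_S_iff L_plus_iff L_zero_iff L_zerozero_iff)

abbreviation G :: "root set" where "G \<equiv> S \<union> L_roots n S"

lemma G_eq: "G = upper \<union> L_minus n S"
  by (auto simp: L_roots_def upper_def)

lemma upper_bounds:
  assumes "(a, b) \<in> upper"
  shows "1 \<le> a" "2 * a \<le> n" "a \<le> k + 1" "a < b" "b \<le> n"
proof -
  show a: "1 \<le> a" "2 * a \<le> n" "a \<le> k + 1"
    using assms rows_bounds[of a] k_bounds k_even by (auto simp: upper_iff)
  show "a < b" "b \<le> n"
    using assms rows_bounds[of a] k_bounds pd_props(1)[OF a(1)] a by (auto simp: upper_iff)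
qed

lemma L_minus_bounds:
  assumes "(a, b) \<in> L_minus n S"
  shows "k + 1 \<le> a" "even n \<Longrightarrow> k + 2 \<le> a" "a < b" "b \<le> n"
proof -
  from assms obtain i where i: "i \<in> rows" "a = n - i" "b = n - pd i" by (auto simp: L_minus_iff)
  with rows_bounds[OF i(1)] k_bounds k_even show "k + 1 \<le> a" "even n \<Longrightarrow> k + 2 \<le> a" by auto
  show "a < b" "b \<le> n" using i rows_bounds[OF i(1)] pd_props(1)[of i] k_bounds by auto
qed

text \<open>Stronger than disjointness: the two kinds of roots occupy different rows, which is what
  makes the row number usable as rank.\<close>

lemma upper_L_minus_disjoint: "(a, b) \<in> upper \<Longrightarrow> (a, c) \<notin> L_minus n S"
  using L_minus_bounds[of a c] rows_bounds[of a] by (auto simp: upper_iff)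

lemma G_subset_roots: "G \<subseteq> roots n"
proof
  fix \<gamma> assume "\<gamma> \<in> G"
  then obtain a b where "\<gamma> = (a, b)" "(a, b) \<in> upper \<or> (a, b) \<in> L_minus n S"
    unfolding G_eq by (cases \<gamma>) auto
  then show "\<gamma> \<in> roots n" using upper_bounds[of a b] L_minus_bounds[of a b] by (auto simp: roots_def)
qed

lemma finite_roots: "finite (roots n)"
  by (rule finite_subset[of _ "{..n} \<times> {..n}"]) (auto simp: roots_def)

text \<open>The positions at which \<open>\<lambda>\<^sub>S\<^sub>,\<^sub>a\<close> may be nonzero.\<close>

definition support :: "root set" where
  "support = (Pi0_roots n - Pi_roots n) \<union> pivots \<union> L_zerozero n S \<union> L_minus n S"

lemma supportE:
  assumes "(a, b) \<in> support"
  obtains "1 \<le> a" "a \<le> k" "b = a + 1" "a + b \<noteq> n"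
  | "1 \<le> a" "a \<le> k" "b = n - pcol a"
  | "even n" "a = k + 1" "b = n - pd (k + 1)"
  | i where "i \<in> rows" "a = n - i" "b = n - pd i"
proof -
  have "a + b \<noteq> n" if "(a, b) \<notin> Pi_roots n" "1 \<le> a" "a \<le> k"
    using that by (auto simp: Pi_roots_def)
  then show ?thesis
    using assms that by (auto simp: support_def Pi0_roots_def pivots_iff L_zerozero_iff L_minus_iff)
qed

definition above_right :: "root \<Rightarrow> root set" where
  "above_right \<gamma> = {\<beta> \<in> pivots. fst \<beta> < fst \<gamma> \<and> snd \<gamma> < snd \<beta>}"

abbreviation "S_rows \<gamma> \<equiv> fst ` S_gamma n S \<gamma>"
abbreviation "S_cols \<gamma> \<equiv> snd ` S_gamma n S \<gamma>"
abbreviation "NE_rows \<gamma> \<equiv> fst ` above_right \<gamma>"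
abbreviation "NE_cols \<gamma> \<equiv> snd ` above_right \<gamma>"

lemma S_gamma_eq: "S_gamma n S \<gamma> = insert \<gamma> (above_right \<gamma>)"
  by (auto simp: S_gamma_def above_right_def pivots_def)

lemma upper_column_pivot:
  assumes \<gamma>: "(i, j) \<in> upper" and a: "1 \<le> a" "a < i" "a \<le> k"
  shows "n - pcol a \<noteq> j" "n - pcol a \<noteq> n - pd i"
proof -
  have "pcol a \<le> a" "pcol a \<noteq> pd i" using pcol_le pcol_ne_pd a by auto
  moreover have "pd i < i" using a pd_props(1)[of i] by simp
  ultimately show "n - pcol a \<noteq> j" "n - pcol a \<noteq> n - pd i"
    using \<gamma> a k_bounds rows_bounds[of i] upper_bounds[OF \<gamma>] by (auto simp: upper_iff)
qed

text \<open>Reason for the monomial shape of the minors. Entries next to the diagonal reach the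
  quadrant only at \<gamma> itself, \<open>L_minus\<close> lies in lower rows, and each row above
  that of \<gamma> contributes its pivot only.\<close>

lemma support_above_right:
  assumes \<gamma>: "(i, j) \<in> upper" and ab: "(a, b) \<in> support" "a \<le> i" "j \<le> b"
  shows "(a, b) \<in> S_gamma n S (i, j)"
proof -
  note bd = upper_bounds[OF \<gamma>]
  have pi: "pd i < i" using bd pd_props(1)[of i] by simp
  from ab(1) show ?thesis
  proof (cases rule: supportE)
    case 1
    then have "a = i" "b = j" using ab bd by auto
    then show ?thesis by (simp add: S_gamma_eq)
  next
    case 2
    show ?thesis
    proof (cases "a = i")
      case True
      have "b = j"
        using \<gamma> 2 True ab pi bd k_bounds by (auto simp: upper_iff pcol_def split: if_splits)
      with True show ?thesis by (simp add: S_gamma_eq)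
    next
      case False
      then have "b \<noteq> j" using upper_column_pivot[OF \<gamma>, of a] 2 ab by auto
      then show ?thesis using False 2 ab by (auto simp: S_gamma_eq above_right_def pivots_iff)
    qed
  next
    case 3
    then have "a = i" using ab bd k_bounds by auto
    then have "b = j" using \<gamma> 3 rows_bounds[of i] by (auto simp: upper_iff)
    with \<open>a = i\<close> show ?thesis by (simp add: S_gamma_eq)
  next
    case (4 m)
    then have "(a, b) \<in> L_minus n S" by (auto simp: L_minus_iff)
    from L_minus_bounds[OF this] ab \<gamma> have False using rows_bounds[of i] by (auto simp: upper_iff)
    then show ?thesis ..
  qed
qed

lemma finite_pivots: "finite pivots"
proof -
  have "pivots \<subseteq> {..n} \<times> {..n}" using k_bounds by (auto simp: pivots_iff)
  then show ?thesis by (rule finite_subset) simp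
qed

lemma inj_fst_pivots: "inj_on fst pivots"
  by (auto simp: inj_on_def pivots_iff)

lemma inj_snd_pivots: "inj_on snd pivots"
proof (intro inj_onI)
  fix x y assume xy: "x \<in> pivots" "y \<in> pivots" "snd x = snd y"
  obtain a b where x: "x = (a, b)" by (cases x)
  obtain c d where y: "y = (c, d)" by (cases y)
  have ac: "1 \<le> a" "1 \<le> c" "a \<le> k" "c \<le> k" "n - pcol a = n - pcol c"
    using xy by (simp_all add: x y pivots_iff)
  with pcol_le[of a] pcol_le[of c] k_bounds have "pcol a = pcol c" by linarith
  then have "a = c" by (rule pcol_inj[OF ac(1,2)])
  with xy show "x = y" by (simp add: x y)
qed

lemma above_right_facts:
  shows "finite (above_right \<gamma>)" "inj_on fst (above_right \<gamma>)" "inj_on snd (above_right \<gamma>)"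
    "\<gamma> \<notin> above_right \<gamma>"
    "\<And>r. r \<in> NE_rows \<gamma> \<Longrightarrow> 1 \<le> r \<and> r < fst \<gamma>" 
    "\<And>c. c \<in> NE_cols \<gamma> \<Longrightarrow> snd \<gamma> < c \<and> c \<le> n"
proof -
  have sub: "above_right \<gamma> \<subseteq> pivots" by (auto simp: above_right_def)
  show "finite (above_right \<gamma>)" "inj_on fst (above_right \<gamma>)" "inj_on snd (above_right \<gamma>)"
    using finite_subset[OF sub finite_pivots] inj_on_subset[OF inj_fst_pivots sub]
      inj_on_subset[OF inj_snd_pivots sub] by auto
  show "\<gamma> \<notin> above_right \<gamma>" by (simp add: above_right_def)
  show "1 \<le> r \<and> r < fst \<gamma>" if "r \<in> NE_rows \<gamma>" for r
    using that by (auto simp: above_right_def pivots_iff)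
  show "snd \<gamma> < c \<and> c \<le> n" if "c \<in> NE_cols \<gamma>" for c
    using that by (auto simp: above_right_def pivots_iff)
qed

lemma S_gamma_facts:
  shows "finite (S_gamma n S \<gamma>)" "inj_on fst (S_gamma n S \<gamma>)" "inj_on snd (S_gamma n S \<gamma>)"
    "S_rows \<gamma> - {fst \<gamma>} = NE_rows \<gamma>"
    "S_cols \<gamma> - {snd \<gamma>} = NE_cols \<gamma>"
proof -
  have f: "fst \<gamma> \<notin> NE_rows \<gamma>" and s: "snd \<gamma> \<notin> NE_cols \<gamma>"
    by (force simp: above_right_def)+
  show "finite (S_gamma n S \<gamma>)" by (simp add: S_gamma_eq above_right_facts)
  show "inj_on fst (S_gamma n S \<gamma>)" "inj_on snd (S_gamma n S \<gamma>)"
    using f s by (simp_all add: S_gamma_eq above_right_facts(2-4))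
  show "S_rows \<gamma> - {fst \<gamma>} = NE_rows \<gamma>"
    "S_cols \<gamma> - {snd \<gamma>} = NE_cols \<gamma>"
    using f s unfolding S_gamma_eq image_insert by blast+
qed

text \<open>Row i may hold two roots of \<open>G\<close>, in columns n - i and n -
  \<open>pd i\<close>. The further columns of the minor belong to pivots of earlier rows, which
  avoid both.\<close>

lemma row_upper_not_G:
  assumes \<gamma>: "(i, j) \<in> upper" and c: "c \<in> NE_cols (i, j)"
  shows "(i, c) \<notin> G"
proof
  assume G: "(i, c) \<in> G"
  from c have jc: "j < c" using above_right_facts(6)[of c "(i, j)"] by simp
  from c obtain a where a: "1 \<le> a" "a < i" "a \<le> k" "c = n - pcol a"
    by (auto simp: above_right_def pivots_iff)
  from upper_column_pivot[OF \<gamma> a(1-3)] a have c': "c \<noteq> n - pd i" by simp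
  from G upper_L_minus_disjoint[OF \<gamma>] have "(i, c) \<in> upper" by (auto simp: G_eq)
  with c' have "i \<in> rows" "c = n - i" by (auto simp: upper_iff)
  moreover have "pcol a \<le> a" using a by (intro pcol_le)
  ultimately show False using a k_bounds rows_bounds[of i] by auto
qed

lemma L_minus_row_unique:
  assumes "i \<in> rows" "(n - i, b) \<in> G"
  shows "b = n - pd i"
proof -
  have "(n - i, n - pd i) \<in> L_minus n S" using assms by (auto simp: L_minus_iff)
  then have "(n - i, b) \<notin> upper" using upper_L_minus_disjoint by blast
  with assms have "(n - i, b) \<in> L_minus n S" by (auto simp: G_eq)
  then obtain m where "m \<in> rows" "n - i = n - m" "b = n - pd m" by (auto simp: L_minus_iff)
  with rows_bounds[of m] rows_bounds[of i] assms k_bounds show ?thesis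
    by (metis (no_types, lifting) add_leD1 diff_diff_cancel le_trans less_imp_le mult_2)
qed

section \<open>The commutator form\<close>

definition type1 :: "root \<Rightarrow> bool" where
  "type1 \<delta> \<longleftrightarrow> fst \<delta> \<le> k \<and> snd \<delta> < n - pcol (fst \<delta>)"

text \<open>A root outside \<open>G\<close> that is not left of the pivot of its row lies below the
  pivot of its column.\<close>

lemma type2_cover:
  assumes \<delta>: "(a, b) \<in> roots n - G" "\<not> type1 (a, b)"
  shows "\<exists>c. 1 \<le> c \<and> c \<le> k \<and> c < a \<and> b = n - pcol c"
proof -
  define m where "m = n - b"
  have ab: "1 \<le> a" "a < b" "b \<le> n" "b = n - m" "m \<le> n" using \<delta> by (auto simp: roots_def m_def)
  have nG: "(a, b) \<notin> upper" "(a, b) \<notin> L_minus n S" using \<delta> by (auto simp: G_eq)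
  have row: ?thesis if "m \<in> rows" "m < a"
    using that rows_bounds[of m] ab by (intro exI[of _ m]) (auto simp: pcol_def)
  have nonrow: ?thesis if "m \<notin> rows" "m < t" "t \<notin> rows" "t < a" "t \<le> k" for t
  proof -
    from next_nonrow[OF that(1-3)] obtain c where "m < c" "c \<le> t" "c \<notin> rows" "pd c = m" .
    with that ab show ?thesis by (intro exI[of _ c]) (auto simp: pcol_def)
  qed
  show ?thesis
  proof (cases "a \<le> k")
    case True
    note pda = pd_props[OF ab(1)]
    have "(a, n - pcol a) \<in> upper" using True ab by (auto simp: upper_iff pcol_def)
    with nG have "b \<noteq> n - pcol a" by auto
    with \<delta> True have "n - pcol a < b" by (simp add: type1_def)
    then have m: "m < pcol a" using ab pcol_le[of a] by linarith
    show ?thesis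
    proof (cases "m \<in> rows")
      case True
      then show ?thesis using m pcol_le[of a] ab by (intro row) auto
    next
      case m_nonrow: False
      have "m \<noteq> pd a" using nG ab True by (auto simp: upper_iff)
      moreover have "m \<le> pd a" using pda m m_nonrow pcol_le[of a] ab by simp
      ultimately show ?thesis using pda True m_nonrow by (intro nonrow[of "pd a"]) auto
    qed
  next
    case False
    have mk: "m \<le> k" using ab False k_bounds by linarith
    show ?thesis
    proof (cases "m \<in> rows")
      case True
      then show ?thesis using mk False by (intro row) auto
    next
      case m_nonrow: False
      have pdk: "pd (k + 1) < k + 1" "pd (k + 1) \<notin> rows" "m \<le> pd (k + 1)"
        using pd_props[of "k + 1"] m_nonrow mk by auto
      show ?thesis
      proof (cases "m = pd (k + 1)")
        \<comment> \<open>This is the column without pivot. Below row k it consists of roots of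
          \<open>L_zerozero\<close> and \<open>L_minus\<close> only, so the case contradicts
          \<delta> being outside \<open>G\<close>.\<close>
        case True
        define i where "i = n - a"
        have i: "m < i" "a = n - i" "1 \<le> i" using ab by (auto simp: i_def)
        have "\<not> (even n \<and> a = k + 1)" using nG True ab by (auto simp: upper_iff)
        then have "i \<le> k" using False k_bounds k_odd ab by (auto simp: i_def)
        then have "i \<in> rows" using pd_between[of "k + 1" i] i True by simp
        have "pd i = m"
          using i \<open>i \<le> k\<close> True m_nonrow pd_between[of "k + 1"] by (intro pd_eqI) auto
        with \<open>i \<in> rows\<close> i ab nG show ?thesis by (auto simp: L_minus_iff)
      next
        case False
        with pdk m_nonrow \<open>\<not> a \<le> k\<close> show ?thesis by (intro nonrow[of "pd (k + 1)"]) auto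
      qed
    qed
  qed
qed

text \<open>Chosen so that the commutator of the two matrix units is, up to sign, the unit of a
  pivot: the pivot in the row of \<delta> for \<open>type1\<close>, in its column otherwise.\<close>

definition partner :: "root \<Rightarrow> root" where
  "partner \<delta> = (if type1 \<delta> then (snd \<delta>, n - pcol (fst \<delta>))
     else (SOME c. 1 \<le> c \<and> c \<le> k \<and> c < fst \<delta> \<and> snd \<delta> = n - pcol c, fst \<delta>))"

lemma partner_type2:
  assumes "(a, b) \<in> roots n - G" "\<not> type1 (a, b)"
  obtains c where "partner (a, b) = (c, a)" "1 \<le> c" "c \<le> k" "c < a" "b = n - pcol c"
proof -
  let ?P = "\<lambda>c. 1 \<le> c \<and> c \<le> k \<and> c < a \<and> b = n - pcol c"
  have "?P (SOME c. ?P c)" using type2_cover[OF assms] by (rule someI_ex)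
  then show ?thesis using that[of "SOME c. ?P c"] assms by (simp add: partner_def)
qed

text \<open>The value of the linear form with coefficients \<open>f\<close> on the commutator of the matrix units
  of \<open>\<delta>\<close> and \<open>\<eta>\<close>.\<close>

definition bform :: "(root \<Rightarrow> 'c :: field) \<Rightarrow> root \<Rightarrow> root \<Rightarrow> 'c" where
  "bform f \<delta> \<eta> = (if snd \<delta> = fst \<eta> then f (fst \<delta>, snd \<eta>) else 0)
     - (if fst \<delta> = snd \<eta> then f (fst \<eta>, snd \<delta>) else 0)"

context
  fixes f :: "root \<Rightarrow> 'c :: field"
  assumes f_supp: "\<And>\<gamma>. f \<gamma> \<noteq> 0 \<Longrightarrow> \<gamma> \<in> support"
    and f_piv: "\<And>\<gamma>. \<gamma> \<in> pivots \<Longrightarrow> f \<gamma> \<noteq> 0"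
begin

lemma partner_root:
  assumes "\<delta> \<in> roots n - G" shows "partner \<delta> \<in> roots n"
proof (cases "type1 \<delta>")
  case True
  then show ?thesis using assms by (auto simp: partner_def type1_def roots_def)
next
  case False
  obtain a b where \<delta>: "\<delta> = (a, b)" by (cases \<delta>)
  from partner_type2[OF assms[unfolded \<delta>] False[unfolded \<delta>]] obtain c
    where "partner (a, b) = (c, a)" "1 \<le> c" "c < a" by metis
  then show ?thesis using assms \<delta> by (auto simp: roots_def)
qed

lemma bform_partner_diag:
  assumes "\<delta> \<in> roots n - G" shows "bform f \<delta> (partner \<delta>) \<noteq> 0"
proof -
  obtain a b where \<delta>: "\<delta> = (a, b)" by (cases \<delta>)
  have ab: "1 \<le> a" "a < b" using assms by (auto simp: \<delta> roots_def)
  show ?thesis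
  proof (cases "type1 \<delta>")
    case True
    have "pcol a \<le> a" by (rule pcol_le) fact
    moreover have "a \<le> k" using True by (simp add: \<delta> type1_def)
    ultimately have "a \<noteq> n - pcol a" using k_bounds by linarith
    moreover have "f (a, n - pcol a) \<noteq> 0" using \<open>a \<le> k\<close> ab by (intro f_piv) (simp add: pivots_iff)
    ultimately show ?thesis using True by (simp add: bform_def partner_def \<delta>)
  next
    case False
    from partner_type2[OF assms[unfolded \<delta>] False[unfolded \<delta>]] obtain c
      where c: "partner (a, b) = (c, a)" "1 \<le> c" "c \<le> k" "c < a" "b = n - pcol c" .
    have "f (c, b) \<noteq> 0" using c by (intro f_piv) (simp add: pivots_iff)
    then show ?thesis using c ab by (simp add: bform_def \<delta>)
  qed
qed

text \<open>Any other nonzero value would need a second position of the support in the row of a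
  pivot, or two pivots in one column, or a root of \<open>L_minus\<close>. The last is why those
  roots had to be put into \<open>G\<close>.\<close>

lemma bform_partner_off_diag:
  assumes \<delta>: "\<delta> \<in> roots n - G" and \<eta>: "\<eta> \<in> roots n - G" and "\<delta> \<noteq> \<eta>" and t: "type1 \<delta> \<or> \<not> type1 \<eta>"
  shows "bform f \<delta> (partner \<eta>) = 0"
proof -
  obtain a b where \<delta>_eq: "\<delta> = (a, b)" by (cases \<delta>)
  obtain a' b' where \<eta>_eq: "\<eta> = (a', b')" by (cases \<eta>)
  have ab: "1 \<le> a" "a < b" "1 \<le> a'" "a' < b'" using \<delta> \<eta> by (auto simp: \<delta>_eq \<eta>_eq roots_def)
  show ?thesis
  proof (cases "type1 \<eta>")
    case True
    then have a': "a' \<le> k" and "type1 \<delta>" using t by (auto simp: \<eta>_eq type1_def)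
    then have a: "a \<le> k" by (simp add: \<delta>_eq type1_def)
    have pc: "pcol a' \<le> a'" "pcol a \<le> a" using ab by (auto intro: pcol_le)
    have "f (a, n - pcol a') = 0" if "b = b'"
    proof (rule ccontr)
      assume "f (a, n - pcol a') \<noteq> 0"
      from f_supp[OF this] show False
      proof (cases rule: supportE)
        case 1
        then show False using pc a' k_bounds by linarith
      next
        case 2
        then have "pcol a = pcol a'" using pc a a' k_bounds by linarith
        then have "a = a'" by (rule pcol_inj[OF ab(1,3)])
        with that \<open>\<delta> \<noteq> \<eta>\<close> show False by (simp add: \<delta>_eq \<eta>_eq)
      next
        case 3
        then show False using a by simp
      next
        case (4 i)
        then show False using a rows_bounds[of i] k_bounds by linarith
      qed
    qed
    moreover have "a \<noteq> n - pcol a'" using a a' pc k_bounds by linarith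
    ultimately show ?thesis using True by (simp add: bform_def partner_def \<delta>_eq \<eta>_eq)
  next
    case False
    from partner_type2[OF \<eta>[unfolded \<eta>_eq] False[unfolded \<eta>_eq]] obtain c
      where c: "partner (a', b') = (c, a')" "1 \<le> c" "c \<le> k" "c < a'" "b' = n - pcol c" .
    have pc: "pcol c \<le> c" using c by (intro pcol_le)
    have "f (a, a') = 0" if "b = c"
    proof (rule ccontr)
      have ac: "a < c" using that ab by simp
      have pca: "pcol a \<le> a" using ab by (intro pcol_le)
      assume "f (a, a') \<noteq> 0"
      from f_supp[OF this] show False
      proof (cases rule: supportE)
        case 1
        then show False using ac c by simp
      next
        case 2
        \<comment> \<open>From a < c this forces c outside \<open>rows\<close>, a in
          \<open>rows\<close> and \<open>pd a\<close> = \<open>pd c\<close>, so \<eta> would be the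
          \<open>L_minus\<close> root of row n - a.\<close>
        then have lt: "pcol c < pcol a" using ab c by linarith
        with pca ac have "pcol c < c" by simp
        then have cn: "c \<notin> rows" "pcol c = pd c" by (auto simp: pcol_def split: if_splits)
        have an: "a \<in> rows" using pd_between[of c a] lt pca cn ac c by simp
        have "pd a = pd c"
          using lt pca cn ac c pd_props[of c] pd_between[of c] by (intro pd_eqI) auto
        then have "(a', b') \<in> L_minus n S" using an 2 c cn by (auto simp: L_minus_iff pcol_def)
        then show False using \<eta> by (auto simp: \<eta>_eq G_eq)
      next
        case 3
        then show False using ac c by simp
      next
        case (4 i)
        then show False using ac c rows_bounds[of i] k_bounds by linarith
      qed
    qed
    moreover have "f (c, b) = 0" if "a = a'"
    proof (rule ccontr)
      assume "f (c, b) \<noteq> 0"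
      from f_supp[OF this] show False
      proof (cases rule: supportE)
        case 1
        then show False using that ab c by simp
      next
        case 2
        then show False using that c \<open>\<delta> \<noteq> \<eta>\<close> by (simp add: \<delta>_eq \<eta>_eq)
      next
        case 3
        then show False using c by simp
      next
        case (4 i)
        then show False using c rows_bounds[of i] k_bounds by linarith
      qed
    qed
    ultimately show ?thesis using c by (simp add: bform_def \<delta>_eq \<eta>_eq)
  qed
qed

text \<open>The matrix of the form with respect to the roots outside \<open>G\<close> and their partners is block
  triangular, with the roots satisfying \<open>type1\<close> in one block and the others in the other.\<close>

lemma bform_surjective:
  fixes u :: "root \<Rightarrow> 'c"
  obtains y where "\<And>\<delta>. \<delta> \<in> roots n - G \<Longrightarrow> (\<Sum>\<eta>\<in>roots n - G. y \<eta> * bform f \<delta> (partner \<eta>)) = u \<delta>"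
proof -
  let ?D = "roots n - G"
  \<comment> \<open>The equations of \<open>type1\<close> involve a single unknown each. Once these
    are solved, each remaining equation has one further unknown.\<close>
  define y1 where "y1 \<eta> = (if type1 \<eta> then u \<eta> / bform f \<eta> (partner \<eta>) else 0)" for \<eta>
  define y where "y \<eta> = (if type1 \<eta> then y1 \<eta> else
    (u \<eta> - (\<Sum>\<zeta>\<in>?D - {\<eta>}. y1 \<zeta> * bform f \<eta> (partner \<zeta>))) / bform f \<eta> (partner \<eta>))" for \<eta>
  have fin: "finite ?D" using finite_roots by simp
  have "(\<Sum>\<eta>\<in>?D. y \<eta> * bform f \<delta> (partner \<eta>)) = u \<delta>" if \<delta>: "\<delta> \<in> ?D" for \<delta>
  proof -
    have "(\<Sum>\<eta>\<in>?D. y \<eta> * bform f \<delta> (partner \<eta>))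
        = y \<delta> * bform f \<delta> (partner \<delta>) + (\<Sum>\<eta>\<in>?D - {\<delta>}. y \<eta> * bform f \<delta> (partner \<eta>))"
      using fin \<delta> by (rule sum.remove)
    also have "(\<Sum>\<eta>\<in>?D - {\<delta>}. y \<eta> * bform f \<delta> (partner \<eta>))
        = (\<Sum>\<eta>\<in>?D - {\<delta>}. y1 \<eta> * bform f \<delta> (partner \<eta>))"
      by (rule sum.cong[OF refl])
        (use bform_partner_off_diag[OF \<delta>] in \<open>auto simp: y_def y1_def\<close>)
    also have "y \<delta> * bform f \<delta> (partner \<delta>) + \<dots> = u \<delta>"
    proof (cases "type1 \<delta>")
      case True
      then have "(\<Sum>\<eta>\<in>?D - {\<delta>}. y1 \<eta> * bform f \<delta> (partner \<eta>)) = 0"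
        using bform_partner_off_diag[OF \<delta>] by (intro sum.neutral) auto
      then show ?thesis using True bform_partner_diag[OF \<delta>] by (simp add: y_def y1_def)
    qed (use bform_partner_diag[OF \<delta>] in \<open>simp add: y_def\<close>)
    finally show ?thesis .
  qed
  then show ?thesis by (rule that)
qed

end

end

section \<open>The coadjoint action\<close>

lemma mult_mat_index:
  assumes "A \<in> carrier_mat n n" "B \<in> carrier_mat n n" "r < n" "c < n"
  shows "(A * B) $$ (r, c) = (\<Sum>l<n. A $$ (r, l) * B $$ (l, c))"
  using assms by (simp add: scalar_prod_def atLeast0LessThan)

lemma unitriangular_left_inverse:
  fixes g h :: "'c :: field mat"
  assumes g: "g \<in> unitriangular n" and h: "h \<in> carrier_mat n n" and hg: "h * g = 1\<^sub>m n"
  shows "h \<in> unitriangular n"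
proof -
  have gc: "g \<in> carrier_mat n n" and gu: "upper_triangular g" and g1: "\<And>r. r < n \<Longrightarrow> g $$ (r, r) = 1"
    using g by (auto simp: unitriangular_def)
  have step: "h $$ (r, c) = (if r = c then 1 else 0)" if "r < n" "c \<le> r" for r c
    using that(2)
  proof (induction c rule: less_induct)
    case (less c)
    have "c < n" using less that by simp
    have "(if r = c then 1 else 0) = (\<Sum>l<n. h $$ (r, l) * g $$ (l, c))"
      using mult_mat_index[OF h gc that(1) \<open>c < n\<close>] that(1) \<open>c < n\<close> by (simp add: hg)
    also have "\<dots> = (\<Sum>l\<in>{c}. h $$ (r, l) * g $$ (l, c))"
    proof (rule sum.mono_neutral_right)
      show "\<forall>l\<in>{..<n} - {c}. h $$ (r, l) * g $$ (l, c) = 0"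
      proof
        fix l assume l: "l \<in> {..<n} - {c}"
        show "h $$ (r, l) * g $$ (l, c) = 0"
        proof (cases "l < c")
          case True
          then show ?thesis using less by simp
        next
          case False
          then have "c < l" "l < dim_row g" using l gc by auto
          then show ?thesis using upper_triangularD[OF gu] by simp
        qed
      qed
    qed (use \<open>c < n\<close> in auto)
    finally show ?case using g1[OF \<open>c < n\<close>] by simp
  qed
  show ?thesis
    unfolding unitriangular_def upper_triangular_def using h step by auto
qed

lemma unitriangular_inv_eqI:
  fixes g h :: "'c :: field mat"
  assumes g: "g \<in> carrier_mat n n" and h: "h \<in> carrier_mat n n" and gh: "g * h = 1\<^sub>m n"
  shows "inv\<^bsub>ring_mat TYPE('c) n ()\<^esub> g = h"
proof -
  interpret ring "ring_mat TYPE('c) n ()" by (rule ring_mat)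
  have "h * g = 1\<^sub>m n" by (rule mat_mult_left_right_inverse[OF g h gh])
  then show ?thesis using g h gh by (intro inv_unique'[symmetric]) (auto simp: ring_mat_simps)
qed

lemma unitriangular_inverse:
  fixes g :: "'c :: field mat"
  assumes "g \<in> unitriangular n"
  obtains h where "h \<in> carrier_mat n n" "g * h = 1\<^sub>m n" "h * g = 1\<^sub>m n"
proof -
  have g: "g \<in> carrier_mat n n" "upper_triangular g" "\<And>r. r < n \<Longrightarrow> g $$ (r, r) = 1"
    using assms by (auto simp: unitriangular_def)
  have "det g = prod_list (diag_mat g)" by (rule det_upper_triangular[OF g(2,1)])
  also have "\<dots> = 1" using g by (auto simp: diag_mat_def intro!: prod_list_neutral)
  finally have det: "det g = 1" .
  have "1 \<cdot>\<^sub>m 1\<^sub>m n = (1\<^sub>m n :: 'c mat)" by (intro eq_matI) auto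
  then show ?thesis using that[of "adj_mat g"] adj_mat[OF g(1)] by (simp add: det)
qed

text \<open>The entry (a, b) of h E g, for the matrix unit E of \<delta>, is a product of one entry
  of h and one of g. Passing the inverse h explicitly lets the formula be used over univariate
  polynomials as well.\<close>

definition coadjoint_entry ::
    "nat \<Rightarrow> (root \<Rightarrow> 'c :: comm_ring_1) \<Rightarrow> 'c mat \<Rightarrow> 'c mat \<Rightarrow> root \<Rightarrow> 'c" where
  "coadjoint_entry n f g h \<delta> = (\<Sum>a=1..n. \<Sum>b=1..n.
     h $$ (a - 1, fst \<delta> - 1) * f (a, b) * g $$ (snd \<delta> - 1, b - 1))"

lemma coadjoint_mat_unit:
  fixes g h :: "'c :: field mat"
  assumes g: "g \<in> unitriangular n" and h: "h \<in> carrier_mat n n" and gh: "g * h = 1\<^sub>m n"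
    and f: "\<And>\<gamma>. f \<gamma> \<noteq> 0 \<Longrightarrow> \<gamma> \<in> roots n" and \<delta>: "\<delta> \<in> roots n"
  shows "coadjoint n g (form_with n f) (mat_unit n \<delta>) = coadjoint_entry n f g h \<delta>"
proof -
  obtain i j where ij: "\<delta> = (i, j)" by (cases \<delta>)
  have b: "1 \<le> i" "i < j" "j \<le> n" using \<delta> by (auto simp: ij roots_def)
  have gc: "g \<in> carrier_mat n n" using g by (auto simp: unitriangular_def)
  have hg: "h * g = 1\<^sub>m n" by (rule mat_mult_left_right_inverse[OF gc h gh])
  have hu: "h \<in> unitriangular n" by (rule unitriangular_left_inverse[OF g h hg])
  let ?E = "mat_unit n \<delta> :: 'c mat"
  have E: "?E \<in> carrier_mat n n" by (simp add: mat_unit_def)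
  have hE: "h * ?E \<in> carrier_mat n n" using h E by simp
  have Ei: "?E $$ (r, c) = (if r = i - 1 \<and> c = j - 1 then 1 else 0)" if "r < n" "c < n" for r c
    using that b by (auto simp: mat_unit_def ij)
  have hEi: "(h * ?E) $$ (r, c) = (if c = j - 1 then h $$ (r, i - 1) else 0)" if "r < n" "c < n" for r c
  proof -
    have "(h * ?E) $$ (r, c) = (\<Sum>l<n. if l = i - 1 then (if c = j - 1 then h $$ (r, i - 1) else 0) else 0)"
      unfolding mult_mat_index[OF h E that] by (rule sum.cong) (auto simp: Ei that)
    then show ?thesis using b by simp
  qed
  have ent: "(h * ?E * g) $$ (r, c) = h $$ (r, i - 1) * g $$ (j - 1, c)" if "r < n" "c < n" for r c
  proof -
    have "(h * ?E * g) $$ (r, c) = (\<Sum>l<n. if l = j - 1 then h $$ (r, i - 1) * g $$ (j - 1, c) else 0)"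
      unfolding mult_mat_index[OF hE gc that] by (rule sum.cong) (auto simp: hEi that)
    then show ?thesis using b by simp
  qed
  have upper0: "m $$ (r, c) = 0" if "m \<in> unitriangular n" "c < r" "r < n" for m :: "'c mat" and r c
    using that by (auto simp: unitriangular_def upper_triangular_def)
  have "?E \<in> strict_upper n" using b by (auto simp: strict_upper_def mat_unit_def ij)
  \<comment> \<open>\<open>form_with\<close> is restricted to \<open>strict_upper n\<close>, so
    membership is needed before it can be evaluated.\<close>
  moreover have "h * ?E * g \<in> strict_upper n"
    unfolding strict_upper_def
  proof (intro CollectI conjI allI impI)
    show "h * ?E * g \<in> carrier_mat n n" using hE gc by simp
    fix r c assume rc: "r < n" "c < n" "c \<le> r"
    show "(h * ?E * g) $$ (r, c) = 0"
    proof (cases "i - 1 < r")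
      case True
      then show ?thesis using upper0[OF hu True] rc by (simp add: ent)
    next
      case False
      then have lt: "c < j - 1" using rc b by linarith
      show ?thesis using upper0[OF g lt] rc b by (simp add: ent)
    qed
  qed
  ultimately have "coadjoint n g (form_with n f) ?E
      = (\<Sum>\<gamma>\<in>roots n. f \<gamma> * (h * ?E * g) $$ (fst \<gamma> - 1, snd \<gamma> - 1))"
    by (simp add: coadjoint_def form_with_def unitriangular_inv_eqI[OF gc h gh])
  also have "\<dots> = (\<Sum>\<gamma>\<in>{1..n} \<times> {1..n}. h $$ (fst \<gamma> - 1, i - 1) * f \<gamma> * g $$ (j - 1, snd \<gamma> - 1))"
  proof (rule sum.mono_neutral_cong_left)
    show "\<forall>\<gamma>\<in>{1..n} \<times> {1..n} - roots n. h $$ (fst \<gamma> - 1, i - 1) * f \<gamma> * g $$ (j - 1, snd \<gamma> - 1) = 0"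
      using f by fastforce
    show "f \<gamma> * (h * ?E * g) $$ (fst \<gamma> - 1, snd \<gamma> - 1) = h $$ (fst \<gamma> - 1, i - 1) * f \<gamma> * g $$ (j - 1, snd \<gamma> - 1)"
      if "\<gamma> \<in> roots n" for \<gamma> using that by (subst ent) (auto simp: roots_def)
  qed (auto simp: roots_def)
  also have "\<dots> = coadjoint_entry n f g h \<delta>"
    by (simp add: coadjoint_entry_def sum.cartesian_product ij case_prod_unfold)
  finally show ?thesis .
qed

text \<open>In terms of the matrix of a linear form the coadjoint action is conjugation by a lower
  unitriangular matrix followed by truncation.\<close>

locale lower_conjugation =
  fixes n :: nat and h u :: "nat \<Rightarrow> nat \<Rightarrow> 'c :: field" and f y :: "nat \<Rightarrow> nat \<Rightarrow> 'c"
  assumes h0: "\<And>r c. r < c \<Longrightarrow> c \<le> n \<Longrightarrow> h r c = 0" and h1: "\<And>r. 1 \<le> r \<Longrightarrow> r \<le> n \<Longrightarrow> h r r = 1"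
    and u0: "\<And>r c. r < c \<Longrightarrow> c \<le> n \<Longrightarrow> u r c = 0" and u1: "\<And>r. 1 \<le> r \<Longrightarrow> r \<le> n \<Longrightarrow> u r r = 1"
    and uh: "\<And>a c. 1 \<le> a \<Longrightarrow> a \<le> n \<Longrightarrow> 1 \<le> c \<Longrightarrow> c \<le> n \<Longrightarrow>
      (\<Sum>b=1..n. u a b * h b c) = (if a = c then 1 else 0)"
    and y: "\<And>r c. 1 \<le> r \<Longrightarrow> r < c \<Longrightarrow> c \<le> n \<Longrightarrow> y r c = (\<Sum>a=1..n. \<Sum>b=1..n. h r a * f a b * u b c)"
begin

text \<open>By triangularity an entry of \<open>y\<close> in the quadrant of rows up to r0 and
  columns from c0 on only sees entries of \<open>f\<close> in the same quadrant, and these are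
  supported on \<Gamma>. So \<open>minor_unitriangular_mult\<close> applies.\<close>

lemma minor_invariant:
  assumes \<Gamma>: "finite \<Gamma>" "inj_on fst \<Gamma>" "inj_on snd \<Gamma>"
    and range: "\<And>r. r \<in> fst ` \<Gamma> \<Longrightarrow> 1 \<le> r \<and> r \<le> r0" "\<And>c. c \<in> snd ` \<Gamma> \<Longrightarrow> c0 \<le> c \<and> c \<le> n" "r0 < c0"
    and supp: "\<And>a b. f a b \<noteq> 0 \<Longrightarrow> a \<le> r0 \<Longrightarrow> c0 \<le> b \<Longrightarrow> (a, b) \<in> \<Gamma>"
  shows "minor y (fst ` \<Gamma>) (snd ` \<Gamma>) = minor f (fst ` \<Gamma>) (snd ` \<Gamma>)"
proof -
  let ?I = "fst ` \<Gamma>" and ?J = "snd ` \<Gamma>"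
  \<comment> \<open>The cut-off extends triangularity, known for indices up to n, to all
    indices.\<close>
  let ?h = "\<lambda>r c. if c \<le> n then h r c else 0" and ?u = "\<lambda>r c. if c \<le> n then u r c else 0"
  show ?thesis
  proof (rule minor_unitriangular_mult[where h = ?h and u = ?u])
    show "finite ?I" "finite ?J" "card ?I = card ?J" using \<Gamma> by (simp_all add: card_image)
    fix r c assume r: "r \<in> ?I" and c: "c \<in> ?J"
    have rc: "1 \<le> r" "r \<le> r0" "c0 \<le> c" "c \<le> n" "r < c" "r \<le> n" using range(1)[OF r] range(2)[OF c] range(3) by auto
    have z: "h r a * f a b * u b c = 0" if "a \<in> {1..n}" "b \<in> {1..n}" "\<not> (a \<in> ?I \<and> b \<in> ?J)" for a b
    proof -
      have "r < a \<or> b < c \<or> f a b = 0"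
      proof (rule ccontr)
        assume "\<not> (r < a \<or> b < c \<or> f a b = 0)"
        then have "(a, b) \<in> \<Gamma>" using rc by (intro supp) auto
        with that(3) show False by force
      qed
      then show ?thesis using h0[of r a] u0[of b c] that rc by auto
    qed
    have sub: "?I \<subseteq> {1..n}" "?J \<subseteq> {1..n}" using range rc by fastforce+
    have "y r c = (\<Sum>a=1..n. \<Sum>b=1..n. h r a * f a b * u b c)" using rc by (intro y) auto
    also have "\<dots> = (\<Sum>a\<in>?I. \<Sum>b=1..n. h r a * f a b * u b c)"
    proof (intro sum.mono_neutral_right)
      show "\<forall>a\<in>{1..n} - ?I. (\<Sum>b=1..n. h r a * f a b * u b c) = 0"
        using z by (intro ballI sum.neutral) blast
    qed (use sub in auto)
    also have "\<dots> = (\<Sum>a\<in>?I. \<Sum>b\<in>?J. h r a * f a b * u b c)"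
    proof (rule sum.cong[OF refl])
      fix a assume "a \<in> ?I"
      then show "(\<Sum>b=1..n. h r a * f a b * u b c) = (\<Sum>b\<in>?J. h r a * f a b * u b c)"
      proof (intro sum.mono_neutral_right)
        show "\<forall>b\<in>{1..n} - ?J. h r a * f a b * u b c = 0" using z sub \<open>a \<in> ?I\<close> by blast
      qed (use sub in auto)
    qed
    also have "\<dots> = (\<Sum>a\<in>?I. \<Sum>b\<in>?J. ?h r a * f a b * ?u b c)"
      using sub rc by (intro sum.cong) auto
    finally show "y r c = (\<Sum>a\<in>?I. \<Sum>b\<in>?J. ?h r a * f a b * ?u b c)" .
  next
    show "?h r r = 1" if "r \<in> ?I" for r
    proof -
      have "?J \<noteq> {}" using that by auto
      then obtain c where "c \<in> ?J" by blast
      then show ?thesis using range(1)[OF that] range(2)[of c] range(3) h1[of r] by simp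
    qed
    show "?u r r = 1" if "r \<in> ?J" for r
    proof -
      have "?I \<noteq> {}" using that by auto
      then obtain r' where "r' \<in> ?I" by blast
      then show ?thesis using range(1)[of r'] range(2)[OF that] range(3) u1[of r] by simp
    qed
  qed (auto simp: h0 u0)
qed

end

section \<open>Blocks of the matrix of a form, and invariance of the corner trace\<close>

definition block :: "(nat \<Rightarrow> nat \<Rightarrow> 'c) \<Rightarrow> nat \<Rightarrow> nat \<Rightarrow> nat \<Rightarrow> nat \<Rightarrow> 'c mat" where
  "block f r0 c0 p q = mat p q (\<lambda>(r, c). f (r0 + r + 1) (c0 + c + 1))"

lemma block_carrier [simp]: "block f r0 c0 p q \<in> carrier_mat p q"
  by (simp add: block_def)

lemma block_dim [simp]: "dim_row (block f r0 c0 p q) = p" "dim_col (block f r0 c0 p q) = q"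
  by (simp_all add: block_def)

lemma block_index [simp]: "r < p \<Longrightarrow> c < q \<Longrightarrow> block f r0 c0 p q $$ (r, c) = f (r0 + r + 1) (c0 + c + 1)"
  by (simp add: block_def)

text \<open>Up to sign, the value of \<open>P\<^sub>\<gamma>\<^sub>,\<^sub>1\<close> for \<open>\<gamma>\<close> in row \<open>n - i\<close>.\<close>

definition corner_trace :: "nat \<Rightarrow> (nat \<Rightarrow> nat \<Rightarrow> 'c :: comm_ring_1) \<Rightarrow> nat \<Rightarrow> 'c" where
  "corner_trace n f i = det_deriv (block f 0 (n - i) i i)
     (block f 0 i i (n - 2 * i) * block f i (n - i) (n - 2 * i) i)"

lemma sum_three_blocks:
  fixes F :: "nat \<Rightarrow> 'c :: comm_monoid_add"
  assumes "2 * i \<le> n"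
  shows "(\<Sum>a=1..n. F a) = (\<Sum>r<i. F (r + 1)) + (\<Sum>j<n - 2 * i. F (i + j + 1)) + (\<Sum>r<i. F (n - i + r + 1))"
proof -
  have "(\<Sum>a=1..n. F a) = (\<Sum>a<n. F (a + 1))"
    by (rule sum.reindex_bij_witness[of _ "\<lambda>a. a + 1" "\<lambda>a. a - 1"]) auto
  also have "\<dots> = (\<Sum>a<i + (n - 2 * i) + i. F (a + 1))" using assms by simp
  also have "(\<Sum>a<i + (n - 2 * i) + i. F (a + 1)) = (\<Sum>r<i. F (r + 1)) + (\<Sum>j<n - 2 * i. F (i + j + 1))
      + (\<Sum>r<i. F (i + (n - 2 * i) + r + 1))"
    unfolding sum_lessThan_add ..
  also have "i + (n - 2 * i) = n - i" using assms by simp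
  finally show ?thesis .
qed

context lower_conjugation
begin

text \<open>All three blocks lie above the diagonal, so truncation does not touch them; splitting
  the summation at i and n - i gives the situation of
  \<open>det_deriv_triangular_conj\<close>.\<close>

lemma corner_trace_invariant:
  assumes i: "1 \<le> i" "2 * i \<le> n" and det0: "det (block f 0 (n - i) i i) = 0"
  shows "corner_trace n y i = corner_trace n f i"
proof -
  let ?m = "n - 2 * i"
  let ?A = "block f 0 (n - i) i i" and ?U = "block f 0 i i ?m" and ?V = "block f i (n - i) ?m i"
  let ?h1 = "block h 0 0 i i" and ?h2 = "block h i i ?m ?m" and ?h21 = "block h i 0 ?m i"
  let ?u3 = "block u (n - i) (n - i) i i" and ?u2 = "block u i i ?m ?m" and ?u32 = "block u (n - i) i i ?m"
  note split = sum_three_blocks[OF i(2)]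
  have uh': "?u2 * ?h2 = 1\<^sub>m ?m"
  proof (rule eq_matI)
    fix r c assume "r < dim_row (1\<^sub>m ?m)" "c < dim_col (1\<^sub>m ?m)"
    then have rc: "r < ?m" "c < ?m" by auto
    have "(\<Sum>b=1..n. u (i + r + 1) b * h b (i + c + 1)) = (\<Sum>j<?m. u (i + r + 1) (i + j + 1) * h (i + j + 1) (i + c + 1))"
      unfolding split using rc i by (auto simp: h0 u0 intro!: sum.neutral)
    moreover have "(\<Sum>b=1..n. u (i + r + 1) b * h b (i + c + 1)) = (if r = c then 1 else 0)"
      using rc by (subst uh) auto
    ultimately show "(?u2 * ?h2) $$ (r, c) = 1\<^sub>m ?m $$ (r, c)"
      using rc by (simp add: scalar_prod_def atLeast0LessThan)
  qed auto
  have d1: "det ?h1 = 1"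
    unfolding block_def using i by (subst det_eq_prod_if_lower) (auto simp: h0 h1 intro!: prod.neutral)
  have d3: "det ?u3 = 1"
    unfolding block_def using i by (subst det_eq_prod_if_lower) (auto simp: u0 u1 intro!: prod.neutral)
  have A': "block y 0 (n - i) i i = ?h1 * ?A * ?u3"
  proof (rule eq_matI)
    fix r c assume "r < dim_row (?h1 * ?A * ?u3)" "c < dim_col (?h1 * ?A * ?u3)"
    then have rc: "r < i" "c < i" by auto
    have "y (r + 1) (n - i + c + 1) = (\<Sum>a=1..n. \<Sum>b=1..n. h (r + 1) a * f a b * u b (n - i + c + 1))"
      using rc i by (intro y) auto
    also have "\<dots> = (\<Sum>a<i. \<Sum>b<i. h (r + 1) (a + 1) * f (a + 1) (n - i + b + 1) * u (n - i + b + 1) (n - i + c + 1))"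
      unfolding split using rc i by (simp add: h0 u0)
    also have "\<dots> = (?h1 * ?A * ?u3) $$ (r, c)"
      using rc by (simp add: scalar_prod_def atLeast0LessThan sum_distrib_right)
        (rule sum.swap)
    finally show "block y 0 (n - i) i i $$ (r, c) = (?h1 * ?A * ?u3) $$ (r, c)" using rc by simp
  qed auto
  have U': "block y 0 i i ?m = ?h1 * (?U * ?u2 + ?A * ?u32)"
  proof (rule eq_matI)
    fix r c assume "r < dim_row (?h1 * (?U * ?u2 + ?A * ?u32))" "c < dim_col (?h1 * (?U * ?u2 + ?A * ?u32))"
    then have rc: "r < i" "c < ?m" by auto
    have "y (r + 1) (i + c + 1) = (\<Sum>a=1..n. \<Sum>b=1..n. h (r + 1) a * f a b * u b (i + c + 1))"
      using rc i by (intro y) auto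
    also have "\<dots> = (\<Sum>a<i. (\<Sum>b<?m. h (r + 1) (a + 1) * f (a + 1) (i + b + 1) * u (i + b + 1) (i + c + 1))
        + (\<Sum>b<i. h (r + 1) (a + 1) * f (a + 1) (n - i + b + 1) * u (n - i + b + 1) (i + c + 1)))"
      unfolding split using rc i by (simp add: h0 u0)
    also have "\<dots> = (?h1 * (?U * ?u2 + ?A * ?u32)) $$ (r, c)"
      using rc by (simp add: scalar_prod_def atLeast0LessThan sum_distrib_left distrib_left mult.assoc)
    finally show "block y 0 i i ?m $$ (r, c) = (?h1 * (?U * ?u2 + ?A * ?u32)) $$ (r, c)" using rc by simp
  qed auto
  have V': "block y i (n - i) ?m i = (?h2 * ?V + ?h21 * ?A) * ?u3"
  proof (rule eq_matI)
    fix r c assume "r < dim_row ((?h2 * ?V + ?h21 * ?A) * ?u3)" "c < dim_col ((?h2 * ?V + ?h21 * ?A) * ?u3)"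
    then have rc: "r < ?m" "c < i" by auto
    have "y (i + r + 1) (n - i + c + 1) = (\<Sum>a=1..n. \<Sum>b=1..n. h (i + r + 1) a * f a b * u b (n - i + c + 1))"
      using rc i by (intro y) auto
    also have "\<dots> = (\<Sum>a<i. \<Sum>b<i. h (i + r + 1) (a + 1) * f (a + 1) (n - i + b + 1) * u (n - i + b + 1) (n - i + c + 1))
        + (\<Sum>a<?m. \<Sum>b<i. h (i + r + 1) (i + a + 1) * f (i + a + 1) (n - i + b + 1) * u (n - i + b + 1) (n - i + c + 1))"
      unfolding split using rc i by (simp add: h0 u0)
    also have "\<dots> = (\<Sum>b<i. \<Sum>a<?m. h (i + r + 1) (i + a + 1) * f (i + a + 1) (n - i + b + 1) * u (n - i + b + 1) (n - i + c + 1))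
        + (\<Sum>b<i. \<Sum>a<i. h (i + r + 1) (a + 1) * f (a + 1) (n - i + b + 1) * u (n - i + b + 1) (n - i + c + 1))"
      by (subst add.commute) (intro arg_cong2[of _ _ _ _ plus] sum.swap)
    also have "\<dots> = ((?h2 * ?V + ?h21 * ?A) * ?u3) $$ (r, c)"
      using rc by (simp add: scalar_prod_def atLeast0LessThan sum_distrib_right distrib_right sum.distrib)
    finally show "block y i (n - i) ?m i $$ (r, c) = ((?h2 * ?V + ?h21 * ?A) * ?u3) $$ (r, c)" using rc by simp
  qed auto
  show ?thesis
    unfolding corner_trace_def A' U' V'
    by (rule det_deriv_triangular_conj) (use uh' d1 d3 det0 in auto)
qed

end

section \<open>Density of the orbit\<close>

lemma map_mat_poly_hom:
  assumes "A \<in> carrier_mat n n" "B \<in> carrier_mat n n"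
  shows "map_mat (\<lambda>p. poly p t) (A * B) = map_mat (\<lambda>p. poly p (t :: 'c :: comm_ring_1)) A * map_mat (\<lambda>p. poly p t) B"
  by (rule semiring_hom.mat_hom_mult[OF _ assms]) (unfold_locales, simp_all)

context root_subset
begin

lemma support_subset_roots: "support \<subseteq> roots n"
proof
  fix \<gamma> assume "\<gamma> \<in> support"
  then consider "\<gamma> \<in> Pi0_roots n" | "\<gamma> \<in> G"
    by (auto simp: support_def pivots_def L_roots_def)
  then show "\<gamma> \<in> roots n"
  proof cases
    case 1
    then show ?thesis using k_bounds by (auto simp: Pi0_roots_def roots_def)
  qed (use G_subset_roots in blast)
qed

text \<open>All that the orbit arguments need to know about the form.\<close>

definition admissible :: "(root \<Rightarrow> 'c :: field) \<Rightarrow> bool" where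
  "admissible f \<longleftrightarrow> (\<forall>\<gamma>. f \<gamma> \<noteq> 0 \<longrightarrow> \<gamma> \<in> support) \<and> (\<forall>\<gamma>\<in>pivots. f \<gamma> \<noteq> 0)"

text \<open>The points of the orbit as functions on the roots; their values outside \<open>roots n\<close> are
  irrelevant to polynomials in \<open>sym_alg n\<close>.\<close>

definition orbit_points :: "(root \<Rightarrow> 'c :: field) \<Rightarrow> (root \<Rightarrow> 'c) set" where
  "orbit_points f = {x. \<exists>g\<in>unitriangular n. \<exists>h\<in>carrier_mat n n.
     g * h = 1\<^sub>m n \<and> (\<forall>\<delta>\<in>roots n. x \<delta> = coadjoint_entry n f g h \<delta>)}"

text \<open>The curve through the group is 1 + t W, with inverse 1 - t W + ...; hence the velocity
  at \<delta> is the value of the form on the commutator of the matrix unit of \<delta> with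
  W.\<close>

lemma coadjoint_curve:
  fixes f :: "root \<Rightarrow> 'c :: field" and W :: "nat \<Rightarrow> nat \<Rightarrow> 'c"
  assumes W: "\<And>r c. c \<le> r \<Longrightarrow> W r c = 0" and f: "\<And>\<gamma>. f \<gamma> \<noteq> 0 \<Longrightarrow> \<gamma> \<in> roots n"
  obtains \<phi> :: "root \<Rightarrow> 'c poly" where "\<And>t. (\<lambda>\<delta>. poly (\<phi> \<delta>) t) \<in> orbit_points f"
    "\<And>\<delta>. \<delta> \<in> roots n \<Longrightarrow> pcoeff (\<phi> \<delta>) 0 = f \<delta>"
    "\<And>\<delta>. \<delta> \<in> roots n \<Longrightarrow> pcoeff (\<phi> \<delta>) 1
      = (\<Sum>b=1..n. f (fst \<delta>, b) * W (snd \<delta>) b) - (\<Sum>a=1..n. W a (fst \<delta>) * f (a, snd \<delta>))"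
proof -
  let ?e = "\<lambda>r c. if r = c then 1 else 0 :: 'c"
  define M where "M = mat n n (\<lambda>(r, c). [:?e r c, W (r + 1) (c + 1):])"
  \<comment> \<open>As det M = 1, the adjugate is an inverse with polynomial entries.\<close>
  define H where "H = adj_mat M"
  have M: "M \<in> carrier_mat n n" by (simp add: M_def)
  have Mi: "M $$ (r, c) = [:?e r c, W (r + 1) (c + 1):]" if "r < n" "c < n" for r c
    using that by (simp add: M_def)
  have ut: "upper_triangular M" by (auto simp: M_def W upper_triangular_def)
  have "det M = prod_list (diag_mat M)" by (rule det_upper_triangular[OF ut M])
  also have "\<dots> = 1" using M by (auto simp: diag_mat_def Mi W intro!: prod_list_neutral)
  finally have det: "det M = 1" .
  have H: "H \<in> carrier_mat n n" unfolding H_def by (rule adj_mat(1)[OF M])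
  have MH: "M * H = 1\<^sub>m n"
  proof -
    have "1 \<cdot>\<^sub>m 1\<^sub>m n = (1\<^sub>m n :: 'c poly mat)" by (intro eq_matI) auto
    then show ?thesis using adj_mat(2)[OF M] by (simp add: H_def det)
  qed
  have MHi: "(\<Sum>l<n. M $$ (r, l) * H $$ (l, c)) = [:?e r c:]" if "r < n" "c < n" for r c
  proof -
    have "(\<Sum>l<n. M $$ (r, l) * H $$ (l, c)) = 1\<^sub>m n $$ (r, c)"
      by (simp only: mult_mat_index[OF M H that, symmetric] MH)
    also have "\<dots> = [:?e r c:]" using that by (simp add: one_pCons)
    finally show ?thesis .
  qed
  have H0: "pcoeff (H $$ (r, c)) 0 = ?e r c" if rc: "r < n" "c < n" for r c
  proof -
    have "?e r c = (\<Sum>l<n. pcoeff (M $$ (r, l) * H $$ (l, c)) 0)"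
      using arg_cong[OF MHi[OF rc], of "\<lambda>p. pcoeff p 0"] by (simp add: coeff_sum)
    also have "\<dots> = (\<Sum>l<n. if l = r then pcoeff (H $$ (r, c)) 0 else 0)"
      using rc by (intro sum.cong) (auto simp: Mi coeff_mult)
    finally show ?thesis using rc by simp
  qed
  have H1: "pcoeff (H $$ (r, c)) 1 = - W (r + 1) (c + 1)" if rc: "r < n" "c < n" for r c
  proof -
    have "0 = (\<Sum>l<n. pcoeff (M $$ (r, l) * H $$ (l, c)) 1)"
      using arg_cong[OF MHi[OF rc], of "\<lambda>p. pcoeff p 1"] by (simp add: coeff_sum)
    also have "\<dots> = (\<Sum>l<n. (if l = r then pcoeff (H $$ (r, c)) 1 else 0)
        + (if l = c then W (r + 1) (c + 1) else 0))"
      using rc by (intro sum.cong) (auto simp: Mi coeff_mult H0)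
    also have "\<dots> = pcoeff (H $$ (r, c)) 1 + W (r + 1) (c + 1)"
      using rc by (simp add: sum.distrib)
    finally show ?thesis by (simp add: eq_neg_iff_add_eq_0)
  qed
  define \<phi> where "\<phi> = coadjoint_entry n (\<lambda>\<gamma>. [:f \<gamma>:]) M H"
  have "(\<lambda>\<delta>. poly (\<phi> \<delta>) t) \<in> orbit_points f" for t
  proof -
    let ?ev = "map_mat (\<lambda>p. poly p t)"
    have "?ev M \<in> unitriangular n"
      using M by (auto simp: unitriangular_def upper_triangular_def Mi W)
    moreover have "?ev H \<in> carrier_mat n n" using H by simp
    moreover have "?ev M * ?ev H = 1\<^sub>m n"
      unfolding map_mat_poly_hom[OF M H, symmetric] MH by (intro eq_matI) auto
    moreover have "poly (\<phi> \<delta>) t = coadjoint_entry n f (?ev M) (?ev H) \<delta>" if "\<delta> \<in> roots n" for \<delta>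
      using M H that unfolding \<phi>_def coadjoint_entry_def
      by (auto simp: poly_sum roots_def intro!: sum.cong)
    ultimately show ?thesis unfolding orbit_points_def by blast
  qed
  moreover have "pcoeff (\<phi> \<delta>) 0 = f \<delta> \<and> pcoeff (\<phi> \<delta>) 1
      = (\<Sum>b=1..n. f (fst \<delta>, b) * W (snd \<delta>) b) - (\<Sum>a=1..n. W a (fst \<delta>) * f (a, snd \<delta>))"
    if \<delta>: "\<delta> \<in> roots n" for \<delta>
  proof -
    obtain i j where ij: "\<delta> = (i, j)" by (cases \<delta>)
    have b: "1 \<le> i" "i \<le> n" "1 \<le> j" "j \<le> n" using \<delta> by (auto simp: ij roots_def)
    have c3: "pcoeff (p * [:x:] * q) 0 = pcoeff p 0 * x * pcoeff q 0"
      "pcoeff (p * [:x:] * q) 1 = pcoeff p 1 * x * pcoeff q 0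
        + pcoeff p 0 * x * pcoeff q 1" for p q :: "'c poly" and x
      by (simp_all add: coeff_mult algebra_simps)
    have H': "pcoeff (H $$ (a - 1, i - 1)) 0 = ?e a i" "pcoeff (H $$ (a - 1, i - 1)) 1 = - W a i"
      "pcoeff (M $$ (j - 1, a - 1)) 0 = ?e a j" "pcoeff (M $$ (j - 1, a - 1)) 1 = W j a"
      if "a \<in> {1..n}" for a
    proof -
      have a: "1 \<le> a" "a \<le> n" using that by auto
      have eq: "a - 1 = i - 1 \<longleftrightarrow> a = i" "j - 1 = a - 1 \<longleftrightarrow> a = j" using a b by auto
      have lt: "a - 1 < n" "i - 1 < n" "j - 1 < n" using a b by auto
      show "pcoeff (H $$ (a - 1, i - 1)) 0 = ?e a i" using H0[OF lt(1,2)] by (simp only: eq)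
      show "pcoeff (H $$ (a - 1, i - 1)) 1 = - W a i" using H1[OF lt(1,2)] a b by simp
      show "pcoeff (M $$ (j - 1, a - 1)) 0 = ?e a j" using Mi[OF lt(3,1)] by (simp only: eq coeff_pCons_0)
      show "pcoeff (M $$ (j - 1, a - 1)) 1 = W j a" using Mi[OF lt(3,1)] a b by simp
    qed
    have "pcoeff (\<phi> \<delta>) 0 = (\<Sum>a=1..n. \<Sum>b=1..n. ?e a i * f (a, b) * ?e b j)"
      unfolding \<phi>_def coadjoint_entry_def coeff_sum c3 ij fst_conv snd_conv
      by (intro sum.cong refl) (simp only: H')
    also have "\<dots> = (\<Sum>a=1..n. if a = i then f (i, j) else 0)"
    proof (rule sum.cong[OF refl])
      fix a
      have "(\<Sum>b=1..n. ?e a i * f (a, b) * ?e b j) = (\<Sum>b=1..n. if b = j then ?e a i * f (a, j) else 0)"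
        by (rule sum.cong) auto
      then show "(\<Sum>b=1..n. ?e a i * f (a, b) * ?e b j) = (if a = i then f (i, j) else 0)"
        using b by simp
    qed
    also have "\<dots> = f (i, j)" using b by simp
    finally have c0: "pcoeff (\<phi> \<delta>) 0 = f \<delta>" by (simp add: ij)
    have "pcoeff (\<phi> \<delta>) 1 = (\<Sum>a=1..n. \<Sum>b=1..n.
        (if b = j then - W a i * f (a, j) else 0) + (if a = i then f (i, b) * W j b else 0))"
      unfolding \<phi>_def coadjoint_entry_def coeff_sum c3 ij fst_conv snd_conv
      by (intro sum.cong refl) (simp add: H'[simplified])
    also have "\<dots> = (\<Sum>a=1..n. - (W a i * f (a, j))) + (\<Sum>a=1..n. if a = i then (\<Sum>b=1..n. f (i, b) * W j b) else 0)"
    proof -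
      have "(\<Sum>b=1..n. if b = j then - W a i * f (a, j) else 0) = - (W a i * f (a, j))" for a
        using b by simp
      moreover have "(\<Sum>b=1..n. if a = i then f (i, b) * W j b else 0) = (if a = i then (\<Sum>b=1..n. f (i, b) * W j b) else 0)" for a
        by simp
      ultimately show ?thesis by (simp only: sum.distrib)
    qed
    also have "\<dots> = (\<Sum>b=1..n. f (i, b) * W j b) - (\<Sum>a=1..n. W a i * f (a, j))"
      using b by (simp add: sum_negf)
    finally show ?thesis using c0 by (simp add: ij)
  qed
  ultimately show ?thesis using that by blast
qed

lemma orbit_dense:
  fixes f :: "root \<Rightarrow> 'c :: field"
  assumes inf: "infinite (UNIV :: 'c set)" and f: "admissible f"
    and p: "p \<in> mpolys_in (roots n - G)" and van: "\<And>x. x \<in> orbit_points f \<Longrightarrow> peval x p = 0"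
  shows "p = 0"
proof (rule mpoly_eq_0_if_vanishing_on_curves[OF inf _ p])
  let ?D = "roots n - G"
  show "finite ?D" using finite_roots by simp
  have fs: "\<And>\<gamma>. f \<gamma> \<noteq> 0 \<Longrightarrow> \<gamma> \<in> support" and fp: "\<And>\<gamma>. \<gamma> \<in> pivots \<Longrightarrow> f \<gamma> \<noteq> 0"
    using f by (auto simp: admissible_def)
  have fr: "\<gamma> \<in> roots n" if "f \<gamma> \<noteq> 0" for \<gamma> using fs[OF that] support_subset_roots by blast
  fix u :: "root \<Rightarrow> 'c"
  from bform_surjective[where f = f and u = u, OF fs fp] obtain y where
    y: "\<And>\<delta>. \<delta> \<in> ?D \<Longrightarrow> (\<Sum>\<eta>\<in>?D. y \<eta> * bform f \<delta> (partner \<eta>)) = u \<delta>" by blast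
  \<comment> \<open>W is the sum of the matrix units of the partners, weighted by
    \<open>y\<close>.\<close>
  define W where "W r c = (\<Sum>\<eta>\<in>?D. if partner \<eta> = (r, c) then y \<eta> else 0)" for r c
  have pr: "partner \<eta> \<in> roots n" if "\<eta> \<in> ?D" for \<eta>
    by (rule partner_root[where f = f, OF fs fp that])
  have W0: "W r c = 0" if "c \<le> r" for r c
    unfolding W_def
  proof (intro sum.neutral ballI)
    fix \<eta> assume "\<eta> \<in> ?D"
    from pr[OF this] that have "partner \<eta> \<noteq> (r, c)" by (auto simp: roots_def)
    then show "(if partner \<eta> = (r, c) then y \<eta> else 0) = 0" by simp
  qed
  show "\<exists>\<phi>. (\<forall>\<delta>\<in>?D. pcoeff (\<phi> \<delta>) 0 = f \<delta> \<and> pcoeff (\<phi> \<delta>) 1 = u \<delta>) \<and> pcurve \<phi> p = 0"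
  proof (rule coadjoint_curve[of W f, OF W0 fr])
    fix \<phi> :: "root \<Rightarrow> 'c poly"
    assume \<phi>: "\<And>t. (\<lambda>\<delta>. poly (\<phi> \<delta>) t) \<in> orbit_points f"
      "\<And>\<delta>. \<delta> \<in> roots n \<Longrightarrow> pcoeff (\<phi> \<delta>) 0 = f \<delta>"
      "\<And>\<delta>. \<delta> \<in> roots n \<Longrightarrow> pcoeff (\<phi> \<delta>) 1
        = (\<Sum>b=1..n. f (fst \<delta>, b) * W (snd \<delta>) b) - (\<Sum>a=1..n. W a (fst \<delta>) * f (a, snd \<delta>))"
  have "pcoeff (\<phi> \<delta>) 1 = u \<delta>" if \<delta>: "\<delta> \<in> ?D" for \<delta>
  proof -
    obtain i j where ij: "\<delta> = (i, j)" by (cases \<delta>)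
    have sel: "(\<Sum>b=1..n. F b * (\<Sum>\<eta>\<in>?D. if partner \<eta> = q b then y \<eta> else 0))
        = (\<Sum>\<eta>\<in>?D. y \<eta> * H \<eta>)"
      if "\<And>\<eta>. \<eta> \<in> ?D \<Longrightarrow> (\<Sum>b=1..n. if partner \<eta> = q b then F b else 0) = H \<eta>" for F q H
    proof -
      have "(\<Sum>b=1..n. F b * (\<Sum>\<eta>\<in>?D. if partner \<eta> = q b then y \<eta> else 0))
          = (\<Sum>\<eta>\<in>?D. y \<eta> * (\<Sum>b=1..n. if partner \<eta> = q b then F b else 0))"
        unfolding sum_distrib_left by (subst sum.swap) (auto intro!: sum.cong)
      also have "\<dots> = (\<Sum>\<eta>\<in>?D. y \<eta> * H \<eta>)"
        by (intro sum.cong refl) (simp only: that)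
      finally show ?thesis .
    qed
    have range: "fst (partner \<eta>) \<in> {1..n}" "snd (partner \<eta>) \<in> {1..n}" if "\<eta> \<in> ?D" for \<eta>
      using pr[OF that] by (auto simp: roots_def)
    have s1: "(\<Sum>b=1..n. f (i, b) * W j b) = (\<Sum>\<eta>\<in>?D. y \<eta> * (if j = fst (partner \<eta>) then f (i, snd (partner \<eta>)) else 0))"
      unfolding W_def
    proof (rule sel)
      fix \<eta> assume "\<eta> \<in> ?D"
      have "(\<Sum>b=1..n. if partner \<eta> = (j, b) then f (i, b) else 0)
          = (\<Sum>b=1..n. if b = snd (partner \<eta>) then (if j = fst (partner \<eta>) then f (i, b) else 0) else 0)"
        by (rule sum.cong) (auto simp: prod_eq_iff)
      then show "(\<Sum>b=1..n. if partner \<eta> = (j, b) then f (i, b) else 0)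
          = (if j = fst (partner \<eta>) then f (i, snd (partner \<eta>)) else 0)"
        using range(2)[OF \<open>\<eta> \<in> ?D\<close>] by simp
    qed
    have s2: "(\<Sum>a=1..n. W a i * f (a, j)) = (\<Sum>\<eta>\<in>?D. y \<eta> * (if i = snd (partner \<eta>) then f (fst (partner \<eta>), j) else 0))"
      unfolding W_def mult.commute[of _ "f (_, j)"]
    proof (rule sel)
      fix \<eta> assume "\<eta> \<in> ?D"
      have "(\<Sum>a=1..n. if partner \<eta> = (a, i) then f (a, j) else 0)
          = (\<Sum>a=1..n. if a = fst (partner \<eta>) then (if i = snd (partner \<eta>) then f (a, j) else 0) else 0)"
        by (rule sum.cong) (auto simp: prod_eq_iff)
      then show "(\<Sum>a=1..n. if partner \<eta> = (a, i) then f (a, j) else 0)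
          = (if i = snd (partner \<eta>) then f (fst (partner \<eta>), j) else 0)"
        using range(1)[OF \<open>\<eta> \<in> ?D\<close>] by simp
    qed
    have "pcoeff (\<phi> \<delta>) 1 = (\<Sum>\<eta>\<in>?D. y \<eta> * bform f \<delta> (partner \<eta>))"
    proof -
      have "pcoeff (\<phi> \<delta>) 1 = (\<Sum>b=1..n. f (i, b) * W j b) - (\<Sum>a=1..n. W a i * f (a, j))"
        using \<phi>(3)[of \<delta>] \<delta> unfolding ij fst_conv snd_conv by blast
      then show ?thesis
        unfolding s1 s2 bform_def ij fst_conv snd_conv right_diff_distrib sum_subtractf .
    qed
    with y[OF \<delta>] show ?thesis by simp
  qed
  moreover have "pcurve \<phi> p = 0"
  proof (rule ccontr)
    assume "pcurve \<phi> p \<noteq> 0"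
    then have "finite {t. poly (pcurve \<phi> p) t = 0}" by (rule poly_roots_finite)
    moreover have "poly (pcurve \<phi> p) t = 0" for t
      unfolding poly_pcurve by (rule van[OF \<phi>(1)])
    ultimately show False using inf by simp
  qed
  ultimately show "\<exists>\<phi>. (\<forall>\<delta>\<in>?D. pcoeff (\<phi> \<delta>) 0 = f \<delta> \<and> pcoeff (\<phi> \<delta>) 1 = u \<delta>) \<and> pcurve \<phi> p = 0"
    using \<phi>(2) by blast
  qed
qed

lemma orbit_lower_conjugation:
  fixes f :: "root \<Rightarrow> 'c :: field"
  assumes "x \<in> orbit_points f"
  obtains h u where "lower_conjugation n h u (\<lambda>a b. f (a, b)) (\<lambda>r c. if r < c then x (r, c) else 0)"
proof -
  from assms obtain g h where g: "g \<in> unitriangular n" and h: "h \<in> carrier_mat n n" and gh: "g * h = 1\<^sub>m n"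
    and x: "\<And>\<delta>. \<delta> \<in> roots n \<Longrightarrow> x \<delta> = coadjoint_entry n f g h \<delta>"
    by (auto simp: orbit_points_def)
  have gc: "g \<in> carrier_mat n n" using g by (auto simp: unitriangular_def)
  have hg: "h * g = 1\<^sub>m n" by (rule mat_mult_left_right_inverse[OF gc h gh])
  have hu: "h \<in> unitriangular n" by (rule unitriangular_left_inverse[OF g h hg])
  have z: "m $$ (c - 1, r - 1) = 0" if "m \<in> unitriangular n" "1 \<le> r" "r < c" "c \<le> n" for m :: "'c mat" and r c
  proof -
    have "r - 1 < c - 1" "c - 1 < n" using that by auto
    then show ?thesis using that(1) by (auto simp: unitriangular_def upper_triangular_def)
  qed
  have o: "m $$ (r - 1, r - 1) = 1" if "m \<in> unitriangular n" "1 \<le> r" "r \<le> n" for m :: "'c mat" and r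
    using that by (auto simp: unitriangular_def)
  show ?thesis
  proof (rule that, unfold_locales)
    \<comment> \<open>Transposition makes the factors lower triangular. The locale also speaks of
      index 0, where r - 1 is truncated to the first row; the guard sets those values to 0.\<close>
    let ?h = "\<lambda>r a. if 1 \<le> r then h $$ (a - 1, r - 1) else 0" and ?u = "\<lambda>b c. if 1 \<le> b then g $$ (c - 1, b - 1) else 0"
    show "?h r c = 0" "?u r c = 0" if "r < c" "c \<le> n" for r c
      using that z[OF hu] z[OF g] by auto
    show "?h r r = 1" "?u r r = 1" if "1 \<le> r" "r \<le> n" for r
      using that o[OF hu] o[OF g] by auto
    show "(\<Sum>b=1..n. ?u a b * ?h b c) = (if a = c then 1 else 0)"
      if "1 \<le> a" "a \<le> n" "1 \<le> c" "c \<le> n" for a c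
    proof -
      have "(\<Sum>b=1..n. ?u a b * ?h b c) = (\<Sum>b<n. h $$ (c - 1, b) * g $$ (b, a - 1))"
        using that by (intro sum.reindex_bij_witness[of _ "\<lambda>b. b + 1" "\<lambda>b. b - 1"]) auto
      also have "\<dots> = (h * g) $$ (c - 1, a - 1)"
        using that by (intro mult_mat_index[OF h gc, symmetric]) auto
      finally show ?thesis using that by (auto simp: hg)
    qed
    show "(if r < c then x (r, c) else 0) = (\<Sum>a=1..n. \<Sum>b=1..n. ?h r a * f (a, b) * ?u b c)"
      if "1 \<le> r" "r < c" "c \<le> n" for r c
    proof -
      have "(r, c) \<in> roots n" using that by (simp add: roots_def)
      then show ?thesis using that by (simp add: x coadjoint_entry_def)
    qed
  qed
qed

end

section \<open>The polynomials \<open>\<F>\<^sub>\<gamma>\<close>\<close>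

lemma mpoly_eqI:
  fixes p q :: "('v, 'c :: field) mpolynomial"
  assumes "infinite (UNIV :: 'c set)" "\<And>x. peval x p = peval x q"
  shows "p = q"
proof -
  let ?V = "\<Union>m\<in>mkeys (p - q). mkeys m"
  have "p - q = 0"
  proof (rule mpoly_eq_0_if_vanishing[OF assms(1)])
    show "finite ?V" by simp
    show "p - q \<in> mpolys_in ?V" by (auto simp: mpolys_in_def)
    show "peval x (p - q) = 0" for x by (simp add: msubst_diff[OF hom_id] assms(2))
  qed
  then show ?thesis by simp
qed

definition upfun :: "(root \<Rightarrow> 'c :: comm_ring_1) \<Rightarrow> nat \<Rightarrow> nat \<Rightarrow> 'c" where
  "upfun x r c = (if r < c then x (r, c) else 0)"

lemma peval_upfun_mvar: "peval x (upfun mvar r c) = upfun x r c"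
  by (simp add: upfun_def msubst_mvar[OF hom_id] msubst_0[OF hom_id])

lemma peval_minor: "peval x (minor (upfun mvar) I J) = minor (upfun x) I J"
  by (simp add: minor_hom[OF hom_msubst[OF hom_id]] peval_upfun_mvar)

lemma upfun_in_mpolys: "(r < c \<Longrightarrow> (r, c) \<in> V) \<Longrightarrow> upfun mvar r c \<in> mpolys_in V"
  by (simp add: upfun_def mpolys_in_mvar)

lemma cofactor_hom:
  assumes "comm_ring_hom h"
  shows "h (cofactor A r c) = cofactor (map_mat h A) r c"
proof -
  interpret comm_ring_hom h by fact
  have "map_mat h (mat_delete A r c) = mat_delete (map_mat h A) r c"
    unfolding mat_delete_def by (intro eq_matI) auto
  then show ?thesis
    by (simp add: cofactor_def hom_mult hom_power hom_uminus hom_det[symmetric] del: hom_det)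
qed

lemma corner_trace_hom:
  assumes h: "comm_ring_hom h"
  shows "h (corner_trace n F i) = corner_trace n (\<lambda>r c. h (F r c)) i"
proof -
  interpret comm_ring_hom h by fact
  have bl: "map_mat h (block F r0 c0 p q) = block (\<lambda>r c. h (F r c)) r0 c0 p q" for r0 c0 p q
    by (intro eq_matI) auto
  have "h (\<Sum>r<i. \<Sum>c<i. (block F 0 i i (n - 2 * i) * block F i (n - i) (n - 2 * i) i) $$ (r, c)
      * cofactor (block F 0 (n - i) i i) r c) =
    (\<Sum>r<i. \<Sum>c<i. (block (\<lambda>r c. h (F r c)) 0 i i (n - 2 * i) * block (\<lambda>r c. h (F r c)) i (n - i) (n - 2 * i) i) $$ (r, c)
      * cofactor (block (\<lambda>r c. h (F r c)) 0 (n - i) i i) r c)"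
    by (auto simp: hom_sum hom_mult cofactor_hom[OF h] bl scalar_prod_def intro!: sum.cong arg_cong2[of _ _ _ _ times])
  then show ?thesis by (simp add: corner_trace_def det_deriv_def)
qed

lemma cofactor_in_mpolys:
  assumes "A \<in> carrier_mat N N" "\<And>r' c'. r' < N \<Longrightarrow> c' < N \<Longrightarrow> r' \<noteq> r \<Longrightarrow> A $$ (r', c') \<in> mpolys_in V"
  shows "cofactor A r c \<in> mpolys_in V"
  unfolding cofactor_def
  by (intro mpolys_in_mult mpolys_in_power mpolys_in_uminus mpolys_in_1 mpolys_in_det)
    (use assms in \<open>auto simp: mat_delete_def\<close>)

lemma det_column_replaced:
  assumes "A \<in> carrier_mat N N" "c < N"
  shows "det (mat N N (\<lambda>(r, c'). if c' = c then q r else A $$ (r, c'))) = (\<Sum>r<N. q r * cofactor A r c)"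
proof -
  let ?B = "mat N N (\<lambda>(r, c'). if c' = c then q r else A $$ (r, c'))"
  have "mat_delete ?B r c = mat_delete A r c" for r
    unfolding mat_delete_def using assms by (intro eq_matI) auto
  then have "cofactor ?B r c = cofactor A r c" for r by (simp add: cofactor_def)
  with assms show ?thesis by (subst laplace_expansion_column[of _ N c]) auto
qed

text \<open>The deleted matrix has blocks U, A in its first i rows and D - \<tau>, V below: the
  diagonal of the full characteristic matrix survives only in its middle rows. Here D is strictly
  upper triangular.\<close>

lemma peval_P_poly:
  fixes x :: "root \<Rightarrow> 'c :: field"
  assumes i: "1 \<le> i" "2 * i < n"
  shows "peval x (P_poly n (n - i, b) 1)
    = (-1) ^ ((n - 2 * i) * i + (n - 2 * i)) * corner_trace n (upfun x) i"
proof -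
  let ?m = "n - 2 * i"
  let ?T = "tau_char_mat n :: (root, 'c) mpolynomial poly mat"
  let ?c = "map_mat (\<lambda>x :: 'c. [:x:])"
  let ?bl = "block (upfun x)"
  interpret ev: comm_ring_hom "peval x" by (rule hom_msubst[OF hom_id])
  interpret mp: map_poly_comm_ring_hom "peval x" ..
  have pick1: "pick {..<n - i} r = r" if "r < n - i" for r
  proof (rule pick_eqI)
    have "{a \<in> {..<n - i}. a < r} = {..<r}" using that by auto
    then show "card {a \<in> {..<n - i}. a < r} = r" by simp
  qed (use that in auto)
  have pick2: "pick {i..<n} c = i + c" if "c < n - i" for c
  proof (rule pick_eqI)
    have "{a \<in> {i..<n}. a < i + c} = {i..<i + c}" using that by auto
    then show "card {a \<in> {i..<n}. a < i + c} = c" by simp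
  qed (use that in auto)
  have sets: "{r. r < n \<and> r \<in> {..<n - i}} = {..<n - i}" "{c. c < n \<and> c \<in> {i..<n}} = {i..<n}" by auto
  have Tdim: "dim_row ?T = n" "dim_col ?T = n"
    by (simp_all add: tau_char_mat_def generic_mat_def)
  have Tent: "map_poly (peval x) (?T $$ (r, c)) = [:upfun x (r + 1) (c + 1):] - (if r = c then [:0, 1:] else 0)"
    if "r < n" "c < n" for r c
  proof -
    have T: "?T $$ (r, c) = [:upfun mvar (r + 1) (c + 1):] - (if r = c then [:0, 1:] else 0)"
      using that by (simp add: tau_char_mat_def generic_mat_def upfun_def one_pCons)
    have "map_poly (peval x) [:upfun mvar (r + 1) (c + 1):] = [:upfun x (r + 1) (c + 1):]"
      by (rule poly_eqI) (simp add: coeff_pCons peval_upfun_mvar split: nat.split)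
    moreover have "map_poly (peval x) [:0, 1:] = [:0, 1:]"
      by (rule poly_eqI) (simp add: coeff_pCons split: nat.split)
    ultimately show ?thesis unfolding T mp.hom_minus by simp
  qed
  have "map_mat (map_poly (peval x)) (submatrix ?T {..<n - i} {i..<n})
      = four_block_mat (?c (?bl 0 i i ?m)) (?c (?bl 0 (n - i) i i))
          (?c (?bl i i ?m ?m) - [:0, 1:] \<cdot>\<^sub>m 1\<^sub>m ?m) (?c (?bl i (n - i) ?m i))" (is "?L = ?R")
  proof (rule eq_matI)
    have dimL: "dim_row ?L = n - i" "dim_col ?L = n - i"
      by (simp_all only: index_map_mat dim_submatrix Tdim sets card_lessThan card_atLeastLessThan)
    have dimR: "dim_row ?R = i + ?m" "dim_col ?R = ?m + i" by simp_all
    have ni: "i + ?m = n - i" "?m + i = n - i" using i by auto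
    show "dim_row ?L = dim_row ?R" "dim_col ?L = dim_col ?R"
      by (simp_all only: dimL dimR ni)
    fix r c assume "r < dim_row ?R" "c < dim_col ?R"
    then have rc: "r < n - i" "c < n - i" by (simp_all only: dimR ni)
    have "?L $$ (r, c) = map_poly (peval x) (?T $$ (r, i + c))"
    proof -
      have "submatrix ?T {..<n - i} {i..<n} $$ (r, c) = ?T $$ (pick {..<n - i} r, pick {i..<n} c)"
        by (rule submatrix_index) (simp_all only: Tdim sets card_lessThan card_atLeastLessThan rc)
      moreover have "r < dim_row (submatrix ?T {..<n - i} {i..<n})" "c < dim_col (submatrix ?T {..<n - i} {i..<n})"
        by (simp_all only: dim_submatrix Tdim sets card_lessThan card_atLeastLessThan rc)
      ultimately show ?thesis by (simp only: index_map_mat pick1[OF rc(1)] pick2[OF rc(2)])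
    qed
    also have "\<dots> = [:upfun x (r + 1) (i + c + 1):] - (if r = i + c then [:0, 1:] else 0)"
      using rc by (subst Tent) auto
    also have "\<dots> = ?R $$ (r, c)" using rc i by (auto simp: one_pCons)
    finally show "?L $$ (r, c) = ?R $$ (r, c)" .
  qed
  then have "map_poly (peval x) (tau_minor n i) = det ?R"
    unfolding tau_minor_def mp.hom_det[symmetric] by simp
  then have "peval x (pcoeff (tau_minor n i) (?m - 1)) = pcoeff (det ?R) (?m - 1)"
    by (metis ev.coeff_map_poly_hom)
  also have "\<dots> = (-1) ^ (?m * i + ?m) * det_deriv (?bl 0 (n - i) i i) (?bl 0 i i ?m * ?bl i (n - i) ?m i)"
    by (rule coeff_det_corner_char_mat) (use i in \<open>auto simp: upfun_def\<close>)
  finally show ?thesis using i by (simp add: P_poly_def corner_trace_def)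
qed

context root_subset
begin

section \<open>Linearity in the leading variable, and constancy on the orbit\<close>

definition earlier :: "root \<Rightarrow> root set" where
  "earlier \<gamma> = {\<delta> \<in> roots n. fst \<delta> < fst \<gamma> \<or> fst \<delta> = fst \<gamma> \<and> \<delta> \<notin> G}"

lemma S_gamma_rows:
  assumes "r \<in> S_rows \<gamma>" "1 \<le> fst \<gamma>"
  shows "1 \<le> r" "r \<le> fst \<gamma>" "r = fst \<gamma> \<or> r \<in> NE_rows \<gamma>"
proof -
  show "r = fst \<gamma> \<or> r \<in> NE_rows \<gamma>"
    using assms(1) unfolding S_gamma_eq image_insert by blast
  then show "1 \<le> r" "r \<le> fst \<gamma>"
    using above_right_facts(5)[of r \<gamma>] assms(2) by linarith+
qed

lemma S_gamma_columns:
  assumes "c \<in> S_cols \<gamma>" "snd \<gamma> \<le> n"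
  shows "snd \<gamma> \<le> c" "c \<le> n" "c = snd \<gamma> \<or> c \<in> NE_cols \<gamma>"
proof -
  show "c = snd \<gamma> \<or> c \<in> NE_cols \<gamma>"
    using assms(1) unfolding S_gamma_eq image_insert by blast
  then show "snd \<gamma> \<le> c" "c \<le> n"
    using above_right_facts(6)[of c \<gamma>] assms(2) by linarith+
qed

lemma M_poly_eq_minor:
  assumes "\<gamma> \<in> upper"
  shows "M_poly n S \<gamma> = minor (upfun mvar) (S_rows \<gamma>) (S_cols \<gamma>)"
proof -
  obtain i j where ij: "\<gamma> = (i, j)" by (cases \<gamma>)
  note bd = upper_bounds[OF assms[unfolded ij]]
  note ar = above_right_facts[where \<gamma> = \<gamma>]
  have I: "1 \<le> r \<and> r \<le> i" if "r \<in> S_rows \<gamma>" for r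
    using S_gamma_rows[OF that] bd by (auto simp: ij)
  have J: "j \<le> c \<and> c \<le> n" if "c \<in> S_cols \<gamma>" for c
    using S_gamma_columns[OF that] bd by (auto simp: ij)
  have "M_poly n S \<gamma> = det (submatrix (generic_mat n) ((\<lambda>i. i - 1) ` S_rows \<gamma>) ((\<lambda>i. i - 1) ` S_cols \<gamma>))"
    by (simp add: M_poly_def image_image)
  also have "\<dots> = minor (upfun mvar) (S_rows \<gamma>) (S_cols \<gamma>)"
  proof (rule det_submatrix_eq_minor[where n = n])
    show "S_rows \<gamma> \<subseteq> {1..n}" "S_cols \<gamma> \<subseteq> {1..n}"
      using I J bd by fastforce+
    show "card (S_rows \<gamma>) = card (S_cols \<gamma>)"
      using S_gamma_facts[of \<gamma>] by (simp add: card_image)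
    show "generic_mat n \<in> carrier_mat n n" by (simp add: generic_mat_def)
    fix r c assume "r \<in> S_rows \<gamma>" "c \<in> S_cols \<gamma>"
    from I[OF this(1)] J[OF this(2)] bd
    show "generic_mat n $$ (r - 1, c - 1) = upfun mvar r c"
      by (auto simp: generic_mat_def upfun_def)
  qed (simp_all add: S_gamma_facts)
  finally show ?thesis .
qed

lemma upfun_admissible:
  assumes "admissible f" shows "upfun f = (\<lambda>a b. f (a, b))"
proof (intro ext)
  fix a b
  show "upfun f a b = f (a, b)"
    using assms support_subset_roots by (fastforce simp: upfun_def admissible_def roots_def)
qed

text \<open>The two cases use the closed quadrant at \<gamma> and the open one, obtained by moving
  its corner one step up and one to the right.\<close>

lemma minor_on_orbit:
  assumes f: "admissible f" and x: "x \<in> orbit_points f" and \<gamma>: "\<gamma> \<in> upper"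
  shows "minor (upfun x) (S_rows \<gamma>) (S_cols \<gamma>)
      = minor (upfun f) (S_rows \<gamma>) (S_cols \<gamma>)"
    "minor (upfun x) (NE_rows \<gamma>) (NE_cols \<gamma>)
      = minor (upfun f) (NE_rows \<gamma>) (NE_cols \<gamma>)"
proof -
  obtain i j where ij: "\<gamma> = (i, j)" by (cases \<gamma>)
  note bd = upper_bounds[OF \<gamma>[unfolded ij]]
  note ar = above_right_facts[where \<gamma> = \<gamma>]
  obtain h u where "lower_conjugation n h u (\<lambda>a b. f (a, b)) (\<lambda>r c. if r < c then x (r, c) else 0)"
    by (rule orbit_lower_conjugation[OF x])
  then interpret lower_conjugation n h u "upfun f" "upfun x"
    by (simp add: upfun_def[abs_def] upfun_admissible[OF f, unfolded upfun_def[abs_def]])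
  have supp: "(a, b) \<in> S_gamma n S \<gamma>" if "upfun f a b \<noteq> 0" "a \<le> i" "j \<le> b" for a b
    using that f unfolding ij by (intro support_above_right[OF \<gamma>[unfolded ij]]) (auto simp: upfun_admissible[OF f] admissible_def)
  show "minor (upfun x) (S_rows \<gamma>) (S_cols \<gamma>)
      = minor (upfun f) (S_rows \<gamma>) (S_cols \<gamma>)"
  proof (rule minor_invariant[of _ i j])
    show "1 \<le> r \<and> r \<le> i" if "r \<in> S_rows \<gamma>" for r
      using S_gamma_rows[OF that] bd by (auto simp: ij)
    show "j \<le> c \<and> c \<le> n" if "c \<in> S_cols \<gamma>" for c
      using S_gamma_columns[OF that] bd by (auto simp: ij)
  qed (use bd supp in \<open>auto simp: S_gamma_facts\<close>)
  show "minor (upfun x) (NE_rows \<gamma>) (NE_cols \<gamma>)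
      = minor (upfun f) (NE_rows \<gamma>) (NE_cols \<gamma>)"
  proof (rule minor_invariant[of _ "i - 1" "j + 1"])
    show "1 \<le> r \<and> r \<le> i - 1" if "r \<in> NE_rows \<gamma>" for r
      using ar(5)[OF that] by (auto simp: ij)
    show "j + 1 \<le> c \<and> c \<le> n" if "c \<in> NE_cols \<gamma>" for c
      using ar(6)[OF that] by (auto simp: ij)
    show "(a, b) \<in> above_right \<gamma>" if "upfun f a b \<noteq> 0" "a \<le> i - 1" "j + 1 \<le> b" for a b
      using supp[of a b] that bd by (auto simp: S_gamma_eq ij)
  qed (use bd ar in auto)
qed

lemma minor_above_right_ne_0:
  assumes f: "admissible f" and \<gamma>: "\<gamma> \<in> upper"
  shows "minor (upfun f) (NE_rows \<gamma>) (NE_cols \<gamma>) \<noteq> 0"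
    "\<gamma> \<in> pivots \<Longrightarrow> minor (upfun f) (S_rows \<gamma>) (S_cols \<gamma>) \<noteq> 0"
proof -
  obtain i j where ij: "\<gamma> = (i, j)" by (cases \<gamma>)
  note bd = upper_bounds[OF \<gamma>[unfolded ij]]
  note ar = above_right_facts[where \<gamma> = \<gamma>]
  have supp: "(a, b) \<in> S_gamma n S \<gamma>" if "f (a, b) \<noteq> 0" "a \<le> i" "j \<le> b" for a b
    using that f unfolding ij by (intro support_above_right[OF \<gamma>[unfolded ij]]) (auto simp: admissible_def)
  have piv: "f (a, b) \<noteq> 0" if "(a, b) \<in> pivots" for a b using that f by (auto simp: admissible_def)
  show "minor (upfun f) (NE_rows \<gamma>) (NE_cols \<gamma>) \<noteq> 0"
    unfolding upfun_admissible[OF f]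
  proof (rule minor_monomial_ne_0[OF ar(1-3)])
    fix r c assume "r \<in> NE_rows \<gamma>" "c \<in> NE_cols \<gamma>"
    from ar(5)[OF this(1)] ar(6)[OF this(2)] have "r < i" "j < c" by (auto simp: ij)
    then show "f (r, c) \<noteq> 0 \<longleftrightarrow> (r, c) \<in> above_right \<gamma>"
      using supp[of r c] piv[of r c] by (auto simp: S_gamma_eq ij above_right_def)
  qed
  show "minor (upfun f) (S_rows \<gamma>) (S_cols \<gamma>) \<noteq> 0" if "\<gamma> \<in> pivots"
    unfolding upfun_admissible[OF f]
  proof (rule minor_monomial_ne_0[OF S_gamma_facts(1-3)])
    fix r c assume r: "r \<in> S_rows \<gamma>" and c: "c \<in> S_cols \<gamma>"
    have "r \<le> i" using S_gamma_rows[OF r] bd by (simp add: ij)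
    moreover have "j \<le> c" using S_gamma_columns[OF c] bd by (simp add: ij)
    moreover have "S_gamma n S \<gamma> \<subseteq> pivots" using that by (auto simp: S_gamma_eq above_right_def)
    ultimately show "f (r, c) \<noteq> 0 \<longleftrightarrow> (r, c) \<in> S_gamma n S \<gamma>"
      using supp[of r c] piv[of r c] by auto
  qed
qed

lemma F_poly_upper: "\<gamma> \<in> upper \<Longrightarrow> F_poly n S \<gamma> = M_poly n S \<gamma>"
  using upper_L_minus_disjoint by (cases \<gamma>) (auto simp: F_poly_def)

lemma F_poly_minus: "i \<in> rows \<Longrightarrow> F_poly n S (n - i, n - pd i) = P_poly n (n - i, n - pd i) 1"
  by (auto simp: F_poly_def L_minus_iff)

definition linear_coeff :: "root \<Rightarrow> (root, 'c :: field) mpolynomial \<Rightarrow> (root, 'c) mpolynomial \<Rightarrow> bool" where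
  "linear_coeff \<gamma> F c \<longleftrightarrow> c \<in> mpolys_in (earlier \<gamma>) \<and> F - c * mvar \<gamma> \<in> mpolys_in (earlier \<gamma>) \<and>
     (\<forall>f. admissible f \<longrightarrow> peval f c \<noteq> 0 \<and> (\<forall>x\<in>orbit_points f. peval x c = peval f c))"

text \<open>Expanding along the row of \<gamma>, the corner term gives the coefficient, a minor of
  pivots. The other terms combine variables of that row outside \<open>G\<close> with cofactors from
  earlier rows.\<close>

lemma upper_linear_coeff:
  assumes \<gamma>: "\<gamma> \<in> upper"
  shows "\<exists>c :: (root, 'c :: field) mpolynomial. linear_coeff \<gamma> (F_poly n S \<gamma>) c"
proof -
  obtain i j where ij: "\<gamma> = (i, j)" by (cases \<gamma>)
  note bd = upper_bounds[OF \<gamma>[unfolded ij]]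
  note ar = above_right_facts[where \<gamma> = \<gamma>]
  let ?I = "S_rows \<gamma>" and ?J = "S_cols \<gamma>"
  let ?X = "upfun mvar :: nat \<Rightarrow> nat \<Rightarrow> (root, 'c) mpolynomial"
  let ?N = "card ?I"
  define c where "c = (-1) ^ (?N - 1) * minor ?X (NE_rows \<gamma>) (NE_cols \<gamma>)"
  define g where "g = (\<Sum>c\<in>{1..<?N}. ?X i (pick ?J c) *
      cofactor (mat ?N ?N (\<lambda>(r, c). ?X (pick ?I r) (pick ?J c))) (?N - 1) c)"
  have cards: "card ?I = card ?J" using S_gamma_facts[of \<gamma>] by (simp add: card_image)
  have I: "r = i \<or> r \<in> NE_rows \<gamma>" "r \<le> i" if "r \<in> ?I" for r
    using S_gamma_rows[OF that] bd by (auto simp: ij)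
  have J: "c = j \<or> c \<in> NE_cols \<gamma>" "j \<le> c" "c \<le> n" if "c \<in> ?J" for c
    using S_gamma_columns[OF that] bd by (auto simp: ij)
  have F: "F_poly n S \<gamma> = c * mvar \<gamma> + g"
  proof -
    have "F_poly n S \<gamma> = minor ?X ?I ?J" by (simp add: F_poly_upper[OF \<gamma>] M_poly_eq_minor[OF \<gamma>])
    also have "\<dots> = (-1) ^ (?N - 1) * minor ?X (?I - {i}) (?J - {j}) * ?X i j + g"
      unfolding g_def
      by (rule minor_expand_corner) (use cards I J in \<open>auto simp: S_gamma_eq ij above_right_facts(1)\<close>)
    finally show ?thesis
      using S_gamma_facts(4,5)[of \<gamma>] bd by (simp add: c_def ij upfun_def)
  qed
  have early: "?X r c \<in> mpolys_in (earlier \<gamma>)" if "1 \<le> r" "r < i" "c \<le> n" for r c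
    using that by (intro upfun_in_mpolys) (auto simp: earlier_def roots_def ij)
  have "minor ?X (NE_rows \<gamma>) (NE_cols \<gamma>) \<in> mpolys_in (earlier \<gamma>)"
    by (rule minor_in_mpolys) (use ar early in \<open>auto simp: card_image ij\<close>)
  then have c_in: "c \<in> mpolys_in (earlier \<gamma>)"
    unfolding c_def by (intro mpolys_in_mult mpolys_in_power mpolys_in_uminus mpolys_in_1)
  have bij_I: "bij_betw (pick ?I) {..<?N} ?I" and bij_J: "bij_betw (pick ?J) {..<?N} ?J"
    using bij_betw_pick[of ?I] bij_betw_pick[of ?J] S_gamma_facts(1)[of \<gamma>] cards by auto
  have "i \<in> ?I" "j \<in> ?J" by (auto simp: S_gamma_eq ij)
  have Npos: "0 < ?N" using \<open>i \<in> ?I\<close> S_gamma_facts(1)[of \<gamma>] by (auto simp: card_gt_0_iff simp del: image_eqI)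
  have pickI: "pick ?I r \<in> NE_rows \<gamma>" if "r < ?N" "r \<noteq> ?N - 1" for r
  proof -
    have "pick ?I r < pick ?I (?N - 1)" using that by (intro pick_mono_le) auto
    also have "\<dots> \<le> i" using Npos by (intro I pick_in_set_le) auto
    finally have "pick ?I r \<noteq> i" by simp
    then show ?thesis using I(1)[OF pick_in_set_le[OF that(1)]] by simp
  qed
  have pickJ: "pick ?J c \<in> NE_cols \<gamma>" if "c \<in> {1..<?N}" for c
  proof -
    have c: "c < card ?J" using that cards by simp
    have "j \<le> pick ?J 0" using c by (intro J pick_in_set_le) auto
    also have "pick ?J 0 < pick ?J c" using that c by (intro pick_mono_le) auto
    finally have "pick ?J c \<noteq> j" by simp
    then show ?thesis using J(1)[OF pick_in_set_le[OF c]] by simp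
  qed
  have "g \<in> mpolys_in (earlier \<gamma>)"
    unfolding g_def
  proof (intro mpolys_in_sum mpolys_in_mult)
    fix c assume c: "c \<in> {1..<?N}"
    have "(i, pick ?J c) \<notin> G" using row_upper_not_G[OF \<gamma>[unfolded ij], of "pick ?J c"] pickJ[OF c] by (simp add: ij)
    moreover have "pick ?J c \<le> n" using ar(6)[OF pickJ[OF c]] by simp
    ultimately show "?X i (pick ?J c) \<in> mpolys_in (earlier \<gamma>)"
      using bd by (intro upfun_in_mpolys) (auto simp: earlier_def roots_def ij)
    show "cofactor (mat ?N ?N (\<lambda>(r, c). ?X (pick ?I r) (pick ?J c))) (?N - 1) c \<in> mpolys_in (earlier \<gamma>)"
    proof (rule cofactor_in_mpolys)
      fix r' c' assume rc: "r' < ?N" "c' < ?N" "r' \<noteq> ?N - 1"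
      have "pick ?J c' \<in> ?J" using rc cards by (intro pick_in_set_le) simp
      then have "?X (pick ?I r') (pick ?J c') \<in> mpolys_in (earlier \<gamma>)"
        using ar(5)[OF pickI[OF rc(1,3)]] J(3) by (intro early) (auto simp: ij)
      then show "mat ?N ?N (\<lambda>(r, c). ?X (pick ?I r) (pick ?J c)) $$ (r', c') \<in> mpolys_in (earlier \<gamma>)"
        using rc by simp
    qed simp
  qed
  moreover have ev: "peval x c = (-1) ^ (?N - 1) * minor (upfun x) (NE_rows \<gamma>) (NE_cols \<gamma>)" for x
  proof -
    interpret ev: comm_ring_hom "peval x" by (rule hom_msubst[OF hom_id])
    show ?thesis unfolding c_def by (simp add: ev.hom_mult ev.hom_power ev.hom_uminus peval_minor)
  qed
  ultimately have "linear_coeff \<gamma> (F_poly n S \<gamma>) c"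
    unfolding linear_coeff_def
  proof (intro conjI allI impI ballI)
    show "c \<in> mpolys_in (earlier \<gamma>)" by (rule c_in)
    show "F_poly n S \<gamma> - c * mvar \<gamma> \<in> mpolys_in (earlier \<gamma>)"
      using \<open>g \<in> mpolys_in (earlier \<gamma>)\<close> by (simp add: F)
    fix f :: "root \<Rightarrow> 'c" assume f: "admissible f"
    show "peval f c \<noteq> 0" using minor_above_right_ne_0(1)[OF f \<gamma>] by (simp add: ev)
    show "peval x c = peval f c" if "x \<in> orbit_points f" for x
      unfolding ev minor_on_orbit(2)[OF f that \<gamma>] ..
  qed
  then show ?thesis ..
qed

text \<open>The last row of the block is zero: row i of \<open>f\<close> has no support to the right
  of its pivot in column n - i.\<close>

lemma corner_det_0:
  assumes f: "admissible f" and i: "i \<in> rows"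
  shows "det (block (upfun f) 0 (n - i) i i) = 0"
proof -
  let ?A = "block (upfun f) 0 (n - i) i i"
  have i1: "1 \<le> i" "i \<le> k" using rows_bounds[OF i] by auto
  have \<gamma>: "(i, n - i) \<in> upper" using i by (auto simp: upper_iff)
  have z: "f (i, b) = 0" if "n - i < b" for b
  proof (rule ccontr)
    assume "f (i, b) \<noteq> 0"
    then have "(i, b) \<in> support" using f by (auto simp: admissible_def)
    then have "(i, b) \<in> S_gamma n S (i, n - i)" using that by (intro support_above_right[OF \<gamma>]) auto
    then show False using that by (auto simp: S_gamma_eq above_right_def)
  qed
  have "det ?A = (\<Sum>c<i. ?A $$ (i - 1, c) * cofactor ?A (i - 1) c)"
    using i1 by (intro laplace_expansion_row) auto
  also have "\<dots> = 0"
    using i1 by (intro sum.neutral) (auto simp: upfun_admissible[OF f] z)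
  finally show ?thesis .
qed

text \<open>Values are compared because \<open>coeff_det_corner_char_mat\<close> is stated over
  integral domains; the infinite field then gives the identity of polynomials.\<close>

lemma P_poly_eq:
  assumes inf: "infinite (UNIV :: 'c :: field set)" and i: "i \<in> rows"
  shows "(P_poly n (n - i, b) 1 :: (root, 'c) mpolynomial)
    = (-1) ^ ((n - 2 * i) * i + (n - 2 * i)) * corner_trace n (upfun mvar) i"
proof (rule mpoly_eqI[OF inf])
  fix x :: "root \<Rightarrow> 'c"
  interpret ev: comm_ring_hom "peval x" by (rule hom_msubst[OF hom_id])
  have "1 \<le> i" "2 * i < n" using rows_bounds[OF i] k_bounds by auto
  then show "peval x (P_poly n (n - i, b) 1)
      = peval x ((-1) ^ ((n - 2 * i) * i + (n - 2 * i)) * corner_trace n (upfun mvar) i)"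
    by (simp only: peval_P_poly)
      (simp add: ev.hom_mult ev.hom_power ev.hom_uminus corner_trace_hom[OF ev.comm_ring_hom_axioms] peval_upfun_mvar)
qed

lemma F_poly_on_orbit:
  fixes f :: "root \<Rightarrow> 'c :: field"
  assumes f: "admissible f" and x: "x \<in> orbit_points f" and \<gamma>: "\<gamma> \<in> G"
  shows "peval x (F_poly n S \<gamma>) = peval f (F_poly n S \<gamma>)"
proof (cases "\<gamma> \<in> upper")
  case True
  then show ?thesis
    using minor_on_orbit(1)[OF f x] by (simp add: F_poly_upper M_poly_eq_minor peval_minor)
next
  case False
  then obtain i where i: "i \<in> rows" "\<gamma> = (n - i, n - pd i)"
    using \<gamma> by (cases \<gamma>) (auto simp: G_eq L_minus_iff)
  have ib: "1 \<le> i" "2 * i < n" using rows_bounds[OF i(1)] k_bounds by auto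
  obtain h u where "lower_conjugation n h u (\<lambda>a b. f (a, b)) (\<lambda>r c. if r < c then x (r, c) else 0)"
    by (rule orbit_lower_conjugation[OF x])
  then interpret lower_conjugation n h u "upfun f" "upfun x"
    by (simp add: upfun_def[abs_def] upfun_admissible[OF f, unfolded upfun_def[abs_def]])
  have "corner_trace n (upfun x) i = corner_trace n (upfun f) i"
    using ib corner_det_0[OF f i(1)] by (intro corner_trace_invariant) auto
  then show ?thesis unfolding i(2) F_poly_minus[OF i(1)] peval_P_poly[OF ib] by simp
qed

text \<open>The pivots of the rows a < i have offsets at most a and different from
  \<open>pd i\<close>. There are i columns to choose from and i distinct ones occur, so all
  occur.\<close>

lemma corner_columns:
  assumes i: "i \<in> rows"
  shows "S_rows (i, n - i) = {1..i}" "S_cols (i, n - i) = {n - i..n} - {n - pd i}"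
proof -
  have i1: "1 \<le> i" "i \<le> k" using rows_bounds[OF i] by auto
  have \<gamma>: "(i, n - i) \<in> upper" using i by (auto simp: upper_iff)
  have ar: "above_right (i, n - i) = {(a, n - pcol a) | a. 1 \<le> a \<and> a < i}" (is "_ = ?R")
  proof
    show "above_right (i, n - i) \<subseteq> ?R" by (auto simp: above_right_def pivots_iff)
    show "?R \<subseteq> above_right (i, n - i)"
    proof
      fix \<beta> assume "\<beta> \<in> ?R"
      then obtain a where a: "\<beta> = (a, n - pcol a)" "1 \<le> a" "a < i" by blast
      have "pcol a \<le> a" by (rule pcol_le) fact
      then have "n - i < n - pcol a" using a i1 k_bounds by linarith
      then show "\<beta> \<in> above_right (i, n - i)" using a i1 by (simp add: above_right_def pivots_iff)
    qed
  qed
  show 1: "S_rows (i, n - i) = {1..i}"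
  proof
    show "{1..i} \<subseteq> S_rows (i, n - i)"
    proof
      fix a assume "a \<in> {1..i}"
      then show "a \<in> S_rows (i, n - i)"
        by (cases "a = i") (force simp: S_gamma_eq ar)+
    qed
  qed (use i1 in \<open>auto simp: S_gamma_eq ar\<close>)
  show "S_cols (i, n - i) = {n - i..n} - {n - pd i}"
  proof (rule card_subset_eq)
    have pd: "pd i < i" using i1 by (intro pd_props) 
    show "S_cols (i, n - i) \<subseteq> {n - i..n} - {n - pd i}"
    proof
      fix c assume c: "c \<in> S_cols (i, n - i)"
      then consider "c = n - i" | a where "1 \<le> a" "a < i" "c = n - pcol a" by (auto simp: S_gamma_eq ar)
      then show "c \<in> {n - i..n} - {n - pd i}"
      proof cases
        case 1
        then show ?thesis using pd i1 k_bounds by auto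
      next
        case 2
        then have "c \<noteq> n - pd i" using upper_column_pivot(2)[OF \<gamma>, of a] i1 by simp
        moreover have "pcol a \<le> a" using 2 by (intro pcol_le)
        ultimately show ?thesis using 2 by auto
      qed
    qed
    have "card (S_cols (i, n - i)) = card (S_rows (i, n - i))"
      using S_gamma_facts[of "(i, n - i)"] by (simp add: card_image)
    also have "\<dots> = i" unfolding 1 by simp
    also have "i = card ({n - i..n} - {n - pd i})"
      using pd i1 k_bounds by simp
    finally show "card (S_cols (i, n - i)) = card ({n - i..n} - {n - pd i})" .
  qed simp
qed

text \<open>The corner trace is linear in the entries of V, and \<gamma> is the only position of V
  in its last row that belongs to \<open>G\<close>. Its coefficient is det A with column n -
  \<open>pd i\<close> replaced by column n - i, which by \<open>corner_columns\<close> is the minor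
  of the pivot (i, n - i) up to sign.\<close>

lemma minus_linear_coeff:
  assumes inf: "infinite (UNIV :: 'c :: field set)" and i: "i \<in> rows"
  shows "\<exists>c :: (root, 'c) mpolynomial.
    linear_coeff (n - i, n - pd i) (F_poly n S (n - i, n - pd i)) c"
proof -
  let ?\<gamma> = "(n - i, n - pd i)" and ?m = "n - 2 * i"
  let ?X = "upfun mvar :: nat \<Rightarrow> nat \<Rightarrow> (root, 'c) mpolynomial"
  have i1: "1 \<le> i" "i \<le> k" and ib: "2 * i < n" using rows_bounds[OF i] k_bounds by auto
  have pd: "pd i < i" using i1 by (intro pd_props)
  have \<gamma>: "(i, n - i) \<in> upper" and piv: "(i, n - i) \<in> pivots"
    using i by (auto simp: upper_iff pivots_def in_S_iff)
  define e where "e = ((-1) ^ (?m * i + ?m) :: (root, 'c) mpolynomial)"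
  \<comment> \<open>The 0-based position of column n - \<open>pd i\<close> among the columns n - i +
    1, ..., n of A and V.\<close>
  define ct where "ct = i - 1 - pd i"
  have ct: "ct < i" "n - i + ct + 1 = n - pd i" using pd i1 k_bounds by (auto simp: ct_def)
  let ?A = "block ?X 0 (n - i) i i" and ?U = "block ?X 0 i i ?m" and ?V = "block ?X i (n - i) ?m i"
  \<comment> \<open>The coefficient of the entry (j, c) of V: by Laplace, det A with column c
    replaced by column j of U.\<close>
  define K where "K = (\<lambda>(j, c). \<Sum>r<i. ?U $$ (r, j) * cofactor ?A r c)"
  let ?P = "{..<?m} \<times> {..<i}" and ?p = "(?m - 1, ct)"
  have "corner_trace n ?X i = (\<Sum>r<i. \<Sum>c<i. \<Sum>j<?m. ?V $$ (j, c) * (?U $$ (r, j) * cofactor ?A r c))"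
    unfolding corner_trace_def det_deriv_def
    by (auto simp: scalar_prod_def atLeast0LessThan sum_distrib_right sum_distrib_left mult_ac intro!: sum.cong)
  also have "\<dots> = (\<Sum>c<i. \<Sum>r<i. \<Sum>j<?m. ?V $$ (j, c) * (?U $$ (r, j) * cofactor ?A r c))"
    by (rule sum.swap)
  also have "\<dots> = (\<Sum>c<i. \<Sum>j<?m. \<Sum>r<i. ?V $$ (j, c) * (?U $$ (r, j) * cofactor ?A r c))"
    by (rule sum.cong[OF refl sum.swap])
  also have "\<dots> = (\<Sum>j<?m. \<Sum>c<i. \<Sum>r<i. ?V $$ (j, c) * (?U $$ (r, j) * cofactor ?A r c))"
    by (rule sum.swap)
  also have "\<dots> = (\<Sum>j<?m. \<Sum>c<i. ?V $$ (j, c) * K (j, c))"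
    by (simp only: K_def prod.case sum_distrib_left)
  also have "\<dots> = (\<Sum>q\<in>?P. ?V $$ q * K q)"
    by (subst sum.cartesian_product) (simp only: case_prod_unfold prod.collapse)
  also have "\<dots> = ?V $$ ?p * K ?p + (\<Sum>q\<in>?P - {?p}. ?V $$ q * K q)"
    by (rule sum.remove) (use ct ib in auto)
  also have "?V $$ ?p = mvar ?\<gamma>"
  proof -
    have "?V $$ ?p = ?X (i + (?m - 1) + 1) (n - i + ct + 1)"
      using ct ib by (intro block_index) auto
    also have "i + (?m - 1) + 1 = n - i" using ib by simp
    also have "n - i + ct + 1 = n - pd i" by (rule ct)
    also have "?X (n - i) (n - pd i) = mvar ?\<gamma>"
      using pd i1 k_bounds by (simp add: upfun_def)
    finally show ?thesis .
  qed
  finally have tr: "corner_trace n ?X i = mvar ?\<gamma> * K ?p + (\<Sum>q\<in>?P - {?p}. ?V $$ q * K q)" .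
  have F: "F_poly n S ?\<gamma> = e * K ?p * mvar ?\<gamma> + e * (\<Sum>q\<in>?P - {?p}. ?V $$ q * K q)"
    unfolding F_poly_minus[OF i] P_poly_eq[OF inf i] tr e_def by (simp add: algebra_simps)
  have e_in: "e \<in> mpolys_in V" for V
    unfolding e_def by (intro mpolys_in_power mpolys_in_uminus mpolys_in_1)
  have early: "?X r c \<in> mpolys_in (earlier ?\<gamma>)" if "1 \<le> r" "r \<le> i" "c \<le> n" for r c
    using that ib by (intro upfun_in_mpolys) (auto simp: earlier_def roots_def)
  have K_in: "K q \<in> mpolys_in (earlier ?\<gamma>)" if "q \<in> ?P" for q
    unfolding K_def using that ib
    by (auto intro!: mpolys_in_sum mpolys_in_mult early cofactor_in_mpolys)
  have V_in: "?V $$ q \<in> mpolys_in (earlier ?\<gamma>)" if "q \<in> ?P - {?p}" for q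
  proof -
    obtain j c where q': "q = (j, c)" by (cases q)
    with that have q: "q = (j, c)" "j < ?m" "c < i" by auto
    have "?V $$ q = ?X (i + j + 1) (n - i + c + 1)" using q by simp
    moreover have "(i + j + 1, n - i + c + 1) \<in> earlier ?\<gamma>"
    proof (cases "j = ?m - 1")
      case True
      then have "c \<noteq> ct" using that q by auto
      then have "(n - i, n - i + c + 1) \<notin> G"
        using L_minus_row_unique[OF i, of "n - i + c + 1"] ct by linarith
      moreover have "i + j + 1 = n - i" using True ib by simp
      ultimately show ?thesis using q i1 ib by (auto simp: earlier_def roots_def)
    next
      case False
      then show ?thesis using q i1 ib by (auto simp: earlier_def roots_def)
    qed
    ultimately show ?thesis by (simp add: upfun_in_mpolys)
  qed
  let ?I = "S_rows (i, n - i)" and ?J = "S_cols (i, n - i)"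
  \<comment> \<open>The columns of the modified A in their actual order; only position
    \<open>ct\<close> is out of increasing order.\<close>
  define fc where "fc c = (if c = ct then n - i else n - i + c + 1)" for c
  have cards: "card ?I = card ?J" using S_gamma_facts[of "(i, n - i)"] by (simp add: card_image)
  have cI: "card ?I = i" unfolding corner_columns(1)[OF i] by simp
  have bij: "bij_betw fc {..<card ?I} ?J"
    unfolding cI
  proof (rule bij_betw_imageI)
    show inj: "inj_on fc {..<i}" by (auto simp: inj_on_def fc_def)
    show "fc ` {..<i} = ?J"
    proof (rule card_subset_eq)
      show "finite ?J" by (simp add: S_gamma_facts)
      show "fc ` {..<i} \<subseteq> ?J"
        unfolding corner_columns(2)[OF i] using ct i1 k_bounds pd by (auto simp: fc_def)
      show "card (fc ` {..<i}) = card ?J" using inj cards cI by (simp add: card_image)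
    qed
  qed
  obtain s :: "(root, 'c) mpolynomial" where s: "s = 1 \<or> s = -1"
    "\<And>Z. det (mat (card ?I) (card ?I) (\<lambda>(r, c). Z (pick ?I r) (fc c))) = s * minor Z ?I ?J"
    using minor_permuted_columns[of ?I ?J fc] S_gamma_facts(1)[of "(i, n - i)"] cards bij by blast
  have pickI: "pick ?I r = r + 1" if "r < i" for r
    unfolding corner_columns(1)[OF i]
  proof (rule pick_eqI)
    have "{a \<in> {1..i}. a < r + 1} = {1..r}" using that by auto
    then show "card {a \<in> {1..i}. a < r + 1} = r" by simp
  qed (use that in auto)
  have Kp: "K ?p = s * minor ?X ?I ?J"
  proof -
    have "K ?p = det (mat i i (\<lambda>(r, c). if c = ct then ?U $$ (r, ?m - 1) else ?A $$ (r, c)))"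
      unfolding K_def prod.case by (rule det_column_replaced[symmetric]) (use ct in auto)
    also have "mat i i (\<lambda>(r, c). if c = ct then ?U $$ (r, ?m - 1) else ?A $$ (r, c))
        = mat i i (\<lambda>(r, c). ?X (pick ?I r) (fc c))"
      using ib Suc_diff_Suc[of i n] by (intro eq_matI) (auto simp: pickI fc_def simp del: pick.simps)
    finally show ?thesis using s(2)[of ?X] by (simp add: cI)
  qed
  have ev: "peval x (e * K ?p) = peval x (e * s) * minor (upfun x) ?I ?J" for x
    unfolding Kp by (simp only: msubst_mult[OF hom_id] peval_minor mult.assoc)
  have es: "e * s = 1 \<or> e * s = -1"
    unfolding e_def using s(1) by (cases "even (?m * i + ?m)") (auto simp del: even_add even_mult_iff)
  have "linear_coeff ?\<gamma> (F_poly n S ?\<gamma>) (e * K ?p)"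
    unfolding linear_coeff_def
  proof (intro conjI allI impI ballI)
    have pP: "?p \<in> ?P" using ct ib by auto
    show "e * K ?p \<in> mpolys_in (earlier ?\<gamma>)" by (intro mpolys_in_mult e_in K_in[OF pP])
    have "F_poly n S ?\<gamma> - e * K ?p * mvar ?\<gamma> = e * (\<Sum>q\<in>?P - {?p}. ?V $$ q * K q)"
      unfolding F by simp
    moreover have "e * (\<Sum>q\<in>?P - {?p}. ?V $$ q * K q) \<in> mpolys_in (earlier ?\<gamma>)"
      by (intro mpolys_in_mult e_in mpolys_in_sum V_in K_in) simp_all
    ultimately show "F_poly n S ?\<gamma> - e * K ?p * mvar ?\<gamma> \<in> mpolys_in (earlier ?\<gamma>)"
      by simp
    fix f :: "root \<Rightarrow> 'c" assume f: "admissible f"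
    have m1: "peval x (- 1) = - 1" for x :: "root \<Rightarrow> 'c"
      using msubst_diff[OF hom_id, of x 0 1] by (simp add: msubst_0[OF hom_id] msubst_1[OF hom_id])
    have const: "peval x (e * s) = peval f (e * s)" "peval f (e * s) \<noteq> 0" for x
      using es by (auto simp: msubst_1[OF hom_id] m1)
    show "peval f (e * K ?p) \<noteq> 0"
      unfolding ev using minor_above_right_ne_0(2)[OF f \<gamma> piv] const by simp
    show "peval x (e * K ?p) = peval f (e * K ?p)" if "x \<in> orbit_points f" for x
      unfolding ev using minor_on_orbit(1)[OF f that \<gamma>] const(1)[of x] by simp
  qed
  then show ?thesis ..
qed

lemma linear_coeff_exists:
  assumes "infinite (UNIV :: 'c :: field set)" "\<gamma> \<in> G"
  shows "\<exists>c :: (root, 'c) mpolynomial. linear_coeff \<gamma> (F_poly n S \<gamma>) c"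
proof (cases "\<gamma> \<in> upper")
  case False
  then obtain i where "i \<in> rows" "\<gamma> = (n - i, n - pd i)"
    using assms by (cases \<gamma>) (auto simp: G_eq L_minus_iff)
  with minus_linear_coeff[OF assms(1)] show ?thesis by simp
qed (rule upper_linear_coeff)

end

section \<open>The ideal of the orbit\<close>

text \<open>Euclid's argument: over a finite field, the product of all X - a plus 1 has no
  root.\<close>

lemma infinite_alg_closed_field: "infinite (UNIV :: 'c :: alg_closed_field set)"
proof
  assume fin: "finite (UNIV :: 'c set)"
  define p where "p = (\<Prod>a\<in>UNIV. [:- a, 1:]) + (1 :: 'c poly)"
  have deg: "Polynomial.degree (\<Prod>a\<in>(UNIV :: 'c set). [:- a, 1:]) = card (UNIV :: 'c set)"
    by (subst Polynomial.degree_prod_sum_eq) auto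
  have "0 < card (UNIV :: 'c set)" using fin by (simp add: card_gt_0_iff)
  then have "0 < Polynomial.degree p" unfolding p_def using deg by (subst Polynomial.degree_add_eq_left) auto
  then obtain x where "poly p x = 0" using alg_closed_imp_poly_has_root by blast
  moreover have "poly p x = 1"
    using fin by (auto simp: p_def poly_prod intro!: prod_zero)
  ultimately show False by simp
qed

lemma ring_sym_alg: "ring (sym_alg n :: (root, 'c :: comm_ring_1) mpolynomial ring)"
proof (rule ringI)
  show "abelian_group (sym_alg n :: (root, 'c) mpolynomial ring)"
  proof (rule abelian_groupI)
    fix x :: "(root, 'c) mpolynomial" assume "x \<in> carrier (sym_alg n)"
    then show "\<exists>y\<in>carrier (sym_alg n). y \<oplus>\<^bsub>sym_alg n\<^esub> x = \<zero>\<^bsub>sym_alg n\<^esub>"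
      by (intro bexI[of _ "- x"]) (auto simp: sym_alg_def mpolys_in_uminus)
  qed (auto simp: sym_alg_def mpolys_in_add add_ac)
  show "Group.monoid (sym_alg n :: (root, 'c) mpolynomial ring)"
    by (rule monoidI) (auto simp: sym_alg_def mpolys_in_mult mult_ac)
qed (auto simp: sym_alg_def algebra_simps)

context root_subset
begin

lemma triangular:
  assumes inf: "infinite (UNIV :: 'c :: field set)"
  shows "\<exists>c. triangular_system (roots n) G earlier fst (F_poly n S) c
      (\<lambda>\<gamma>. F_poly n S \<gamma> - c \<gamma> * mvar \<gamma> :: (root, 'c) mpolynomial) \<and>
    (\<forall>\<gamma>\<in>G. \<forall>f. admissible f \<longrightarrow> peval f (c \<gamma>) \<noteq> 0 \<and>
      (\<forall>x\<in>orbit_points f. peval x (c \<gamma>) = peval f (c \<gamma>)))"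
proof -
  have "\<forall>\<gamma>\<in>G. \<exists>c :: (root, 'c) mpolynomial. linear_coeff \<gamma> (F_poly n S \<gamma>) c"
    using linear_coeff_exists[OF inf] by blast
  then obtain c :: "root \<Rightarrow> (root, 'c) mpolynomial" where c: "\<And>\<gamma>. \<gamma> \<in> G \<Longrightarrow> linear_coeff \<gamma> (F_poly n S \<gamma>) (c \<gamma>)"
    by metis
  have "triangular_system (roots n) G earlier fst (F_poly n S) c (\<lambda>\<gamma>. F_poly n S \<gamma> - c \<gamma> * mvar \<gamma>)"
  proof
    show "infinite (UNIV :: 'c set)" by fact
    show "finite (roots n)" by (rule finite_roots)
    show "G \<subseteq> roots n" by (rule G_subset_roots)
  qed (use c in \<open>auto simp: linear_coeff_def earlier_def\<close>)
  moreover have "\<forall>\<gamma>\<in>G. \<forall>f. admissible f \<longrightarrow> peval f (c \<gamma>) \<noteq> 0 \<and>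
      (\<forall>x\<in>orbit_points f. peval x (c \<gamma>) = peval f (c \<gamma>))"
    using c unfolding linear_coeff_def by blast
  ultimately show ?thesis by blast
qed

lemma F_poly_in:
  assumes "infinite (UNIV :: 'c :: field set)" "\<gamma> \<in> G"
  shows "(F_poly n S \<gamma> :: (root, 'c) mpolynomial) \<in> mpolys_in (roots n)"
proof -
  obtain c :: "root \<Rightarrow> (root, 'c) mpolynomial" where
    "triangular_system (roots n) G earlier fst (F_poly n S) c (\<lambda>\<gamma>. F_poly n S \<gamma> - c \<gamma> * mvar \<gamma>)"
    using triangular[OF assms(1)] by blast
  from triangular_system.F_in[OF this assms(2)] show ?thesis
    by (rule mpolys_in_mono) (use assms(2) G_subset_roots in \<open>auto simp: earlier_def\<close>)
qed

lemma alg_independent_F_poly: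
  assumes inf: "infinite (UNIV :: 'c :: field set)"
  shows "alg_independent mconst G (\<lambda>\<gamma>. F_poly n S \<gamma> - mconst (e \<gamma>) :: (root, 'c) mpolynomial)"
proof -
  obtain c :: "root \<Rightarrow> (root, 'c) mpolynomial" where
    tri: "triangular_system (roots n) G earlier fst (F_poly n S) c (\<lambda>\<gamma>. F_poly n S \<gamma> - c \<gamma> * mvar \<gamma>)"
    and c: "\<And>\<gamma> f. \<gamma> \<in> G \<Longrightarrow> admissible f \<Longrightarrow> peval f (c \<gamma>) \<noteq> 0"
    using triangular[OF inf] by blast
  \<comment> \<open>The Jacobian point has value 1 at the pivots and 0 elsewhere, whatever the given
    form.\<close>
  have "admissible (\<lambda>\<gamma>. if \<gamma> \<in> pivots then 1 else 0 :: 'c)"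
    by (auto simp: admissible_def support_def)
  from c[OF _ this] show ?thesis by (rule triangular_system.alg_independent_F[OF tri])
qed

lemma ideal_eq:
  fixes f :: "root \<Rightarrow> 'c :: field"
  assumes inf: "infinite (UNIV :: 'c set)" and f: "admissible f"
  shows "{p \<in> carrier (sym_alg n). \<forall>x\<in>orbit_points f. peval x p = 0}
    = Idl\<^bsub>sym_alg n\<^esub> ((\<lambda>\<gamma>. F_poly n S \<gamma> - mconst (peval f (F_poly n S \<gamma>))) ` G)" (is "?I = Idl\<^bsub>?R\<^esub> ?F")
proof -
  obtain c :: "root \<Rightarrow> (root, 'c) mpolynomial" where
    tri: "triangular_system (roots n) G earlier fst (F_poly n S) c (\<lambda>\<gamma>. F_poly n S \<gamma> - c \<gamma> * mvar \<gamma>)"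
    and c: "\<And>\<gamma> f. \<gamma> \<in> G \<Longrightarrow> admissible f \<Longrightarrow> peval f (c \<gamma>) \<noteq> 0"
      "\<And>\<gamma> f x. \<gamma> \<in> G \<Longrightarrow> admissible f \<Longrightarrow> x \<in> orbit_points f \<Longrightarrow> peval x (c \<gamma>) = peval f (c \<gamma>)"
    using triangular[OF inf] by blast
  interpret triangular_system "roots n" G earlier fst "F_poly n S" c "\<lambda>\<gamma>. F_poly n S \<gamma> - c \<gamma> * mvar \<gamma>"
    by (rule tri)
  interpret R: ring ?R by (rule ring_sym_alg)
  note ev = msubst_add[OF hom_id] msubst_mult[OF hom_id] msubst_0[OF hom_id]
    msubst_diff[OF hom_id] msubst_mconst[OF hom_id]
  have carrier: "carrier ?R = mpolys_in (roots n)" by (simp add: sym_alg_def)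
  have F_sub: "?F \<subseteq> carrier ?R"
    unfolding carrier using F_poly_in[OF inf] by (auto intro!: mpolys_in_diff)
  have I: "ideal ?I ?R"
  proof (rule idealI[OF ring_sym_alg])
    show "subgroup ?I (add_monoid ?R)"
    proof (rule R.add.subgroupI)
      show "?I \<subseteq> carrier ?R" by auto
      show "?I \<noteq> {}" using ev(3) by (force simp: sym_alg_def)
      fix p assume p: "p \<in> ?I"
      then have "\<ominus>\<^bsub>?R\<^esub> p = - p"
        by (intro R.minus_equality) (auto simp: sym_alg_def mpolys_in_uminus)
      moreover have "peval x (- p) = - peval x p" for x
        using ev(4)[of x 0 p] by (simp add: ev)
      ultimately show "\<ominus>\<^bsub>?R\<^esub> p \<in> ?I" using p by (auto simp: carrier mpolys_in_uminus)
    qed (auto simp: sym_alg_def mpolys_in_add ev)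
  qed (auto simp: sym_alg_def mpolys_in_mult ev)
  have FI: "?F \<subseteq> ?I"
    using F_sub F_poly_on_orbit[OF f] by (auto simp: ev)
  show ?thesis
  proof
    show "Idl\<^bsub>?R\<^esub> ?F \<subseteq> ?I" by (rule R.genideal_minimal[OF I FI])
    interpret J: ideal "Idl\<^bsub>?R\<^esub> ?F" ?R by (rule R.genideal_ideal[OF F_sub])
    show "?I \<subseteq> Idl\<^bsub>?R\<^esub> ?F"
    proof
      fix p assume p: "p \<in> ?I"
      show "p \<in> Idl\<^bsub>?R\<^esub> ?F"
      proof (rule vanishing_imp_in_ideal[where Orb = "orbit_points f" and cval = "\<lambda>\<gamma>. peval f (c \<gamma>)"
            and e = "\<lambda>\<gamma>. peval f (F_poly n S \<gamma>)"])
        show "0 \<in> Idl\<^bsub>?R\<^esub> ?F" using J.zero_closed by (simp add: sym_alg_def)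
        show "p + q \<in> Idl\<^bsub>?R\<^esub> ?F" if "p \<in> Idl\<^bsub>?R\<^esub> ?F" "q \<in> Idl\<^bsub>?R\<^esub> ?F" for p q
          using J.a_closed[OF that] by (simp add: sym_alg_def)
        show "q * p \<in> Idl\<^bsub>?R\<^esub> ?F" if "p \<in> Idl\<^bsub>?R\<^esub> ?F" "q \<in> mpolys_in (roots n)" for p q
          using J.I_l_closed[of p q] that by (simp add: sym_alg_def)
        show "peval x q = 0" if "q \<in> Idl\<^bsub>?R\<^esub> ?F" "x \<in> orbit_points f" for q x
          using that R.genideal_minimal[OF I FI] by blast
        show "F_poly n S \<gamma> - mconst (peval f (F_poly n S \<gamma>)) \<in> Idl\<^bsub>?R\<^esub> ?F" if "\<gamma> \<in> G" for \<gamma>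
          using R.genideal_self[OF F_sub] that by blast
        show "q = 0" if "q \<in> mpolys_in (roots n - G)" "\<And>x. x \<in> orbit_points f \<Longrightarrow> peval x q = 0" for q
          by (rule orbit_dense[OF inf f that])
      qed (use p c f in \<open>auto simp: carrier\<close>)
    qed
  qed
qed

end

lemma form_with_mat_unit:
  fixes f :: "root \<Rightarrow> 'c :: field"
  assumes "\<gamma> \<in> roots n"
  shows "form_with n f (mat_unit n \<gamma>) = f \<gamma>"
proof -
  obtain i j where ij: "\<gamma> = (i, j)" by (cases \<gamma>)
  have fin: "finite (roots n)" by (rule finite_subset[of _ "{..n} \<times> {..n}"]) (auto simp: roots_def)
  have "(mat_unit n \<gamma> :: 'c mat) \<in> strict_upper n" using assms by (auto simp: strict_upper_def mat_unit_def ij roots_def)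
  then have "form_with n f (mat_unit n \<gamma>) = (\<Sum>\<beta>\<in>roots n. f \<beta> * mat_unit n \<gamma> $$ (fst \<beta> - 1, snd \<beta> - 1))"
    by (simp add: form_with_def)
  also have "\<dots> = (\<Sum>\<beta>\<in>roots n. if \<beta> = \<gamma> then f \<gamma> else 0)"
    by (rule sum.cong) (auto simp: mat_unit_def roots_def)
  also have "\<dots> = f \<gamma>" using fin assms by simp
  finally show ?thesis .
qed

lemma form_with_cong: "(\<And>\<gamma>. \<gamma> \<in> roots n \<Longrightarrow> f \<gamma> = g \<gamma>) \<Longrightarrow> form_with n f = form_with n g"
  unfolding form_with_def by (intro restrict_ext sum.cong) auto

theorem theorem3p4:
  fixes n :: nat
    and lam :: "'a :: {field, finite} mat \<Rightarrow> 'a"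
    and S :: "root set"
    and a :: "root \<Rightarrow> 'a"
  assumes "n > 2"
    and "is_character n (g_plus n) lam"
    and "nondegenerate n lam"
    and "S \<subseteq> Pi_roots n"
    and "a \<in> Lambda_set n S"
  shows "alg_independent mconst (S \<union> L_roots n S) (F_gen n lam S a) \<and>
    ((\<forall>\<gamma>\<in>S \<inter> Pi0_roots n. lam (mat_unit n \<gamma>) \<noteq> 0) \<longrightarrow>
      ideal_Sa n lam S a = Idl\<^bsub>sym_alg n\<^esub> (F_gen n lam S a ` (S \<union> L_roots n S)))"
proof -
  interpret root_subset n S using assms by unfold_locales
  define \<mu> where "\<mu> = extend_form n (lambda_Sa n lam S a)"
  \<comment> \<open>Extended by 0 outside the roots, since \<open>coadjoint_entry\<close> sums over
    all pairs of indices.\<close>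
  define f where "f \<gamma> = (if \<gamma> \<in> roots n then to_ac (lambda_Sa n lam S a (mat_unit n \<gamma>)) else 0)" for \<gamma>
  have inf: "infinite (UNIV :: 'a alg_closure set)" by (rule infinite_alg_closed_field)
  have \<mu>: "\<mu> = form_with n f"
    unfolding \<mu>_def extend_form_def by (rule form_with_cong) (simp add: f_def)
  have F_gen: "F_gen n lam S a = (\<lambda>\<gamma>. F_poly n S \<gamma> - mconst (value_at n \<mu> (F_poly n S \<gamma>)))"
    by (simp add: F_gen_def[abs_def] \<mu>_def)
  have "ideal_Sa n lam S a = Idl\<^bsub>sym_alg n\<^esub> (F_gen n lam S a ` G)"
    if nz: "\<forall>\<gamma>\<in>S \<inter> Pi0_roots n. lam (mat_unit n \<gamma>) \<noteq> 0"
  proof -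
    define v where "v \<gamma> = (if \<gamma> \<in> (Pi0_roots n - Pi_roots n) \<union> S then lam (mat_unit n \<gamma>)
      else if \<gamma> \<in> L_zero n S \<union> L_zerozero n S \<union> L_minus n S then a \<gamma> else 0)" for \<gamma>
    have fv: "f \<gamma> = (if \<gamma> \<in> roots n then to_ac (v \<gamma>) else 0)" for \<gamma>
      by (simp add: f_def lambda_Sa_def form_with_mat_unit v_def)
    have adm: "admissible f"
      unfolding admissible_def
    proof (intro conjI allI impI ballI)
      fix \<gamma>
      show "\<gamma> \<in> support" if "f \<gamma> \<noteq> 0"
        using that by (auto simp: fv v_def support_def pivots_def split: if_splits)
      assume piv: "\<gamma> \<in> pivots"
      then have "\<gamma> \<in> roots n" using support_subset_roots by (auto simp: support_def)
      moreover have "v \<gamma> \<noteq> 0"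
      proof (cases "\<gamma> \<in> S")
        case True
        \<comment> \<open>Roots of S outside \<open>Pi0_roots n\<close> are covered by
          nondegeneracy, those inside by the premise \<open>nz\<close>.\<close>
        then have "lam (mat_unit n \<gamma>) \<noteq> 0"
          using nz assms(3,4) by (auto simp: nondegenerate_def)
        then show ?thesis using True by (simp add: v_def)
      next
        case False
        then have L: "\<gamma> \<in> L_zero n S" using piv by (simp add: pivots_def)
        obtain i j where ij: "\<gamma> = (i, j)" by (cases \<gamma>)
        \<comment> \<open>A root (i, i + 1) with i \<le> k has coordinate sum at most n, while those
          of \<open>L_zero\<close> have at least n + 1; so the value of \<open>v\<close> here is the
          nonzero a(\<gamma>).\<close>
        have "\<gamma> \<notin> Pi0_roots n"
          using L k_bounds by (auto simp: ij L_zero_def Pi0_roots_def)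
        then show ?thesis using False L assms(5) by (simp add: v_def Lambda_set_def)
      qed
      ultimately show "f \<gamma> \<noteq> 0" by (simp add: fv)
    qed
    have fr: "\<gamma> \<in> roots n" if "f \<gamma> \<noteq> 0" for \<gamma> using that by (auto simp: f_def split: if_splits)
    have val: "value_at n \<mu> p = peval f p" if "p \<in> mpolys_in (roots n)" for p
      unfolding value_at_def
      by (rule msubst_cong[OF hom_id that]) (simp add: \<mu> form_with_mat_unit)
    have gens: "F_gen n lam S a ` G = (\<lambda>\<gamma>. F_poly n S \<gamma> - mconst (peval f (F_poly n S \<gamma>))) ` G"
      unfolding F_gen by (intro image_cong refl) (simp add: val F_poly_in[OF inf])
    have "(\<forall>\<mu>'\<in>orbit_Sa n lam S a. value_at n \<mu>' p = 0) \<longleftrightarrow> (\<forall>x\<in>orbit_points f. peval x p = 0)"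
      if p: "p \<in> carrier (sym_alg n)" for p
    proof -
      have pr: "p \<in> mpolys_in (roots n)" using p by (simp add: sym_alg_def)
      have val_orbit: "value_at n (coadjoint n g \<mu>) p = peval x p"
        if "g \<in> unitriangular n" "h \<in> carrier_mat n n" "g * h = 1\<^sub>m n"
          "\<And>\<delta>. \<delta> \<in> roots n \<Longrightarrow> x \<delta> = coadjoint_entry n f g h \<delta>" for g h x
        unfolding value_at_def \<mu>
        by (rule msubst_cong[OF hom_id pr]) (simp add: coadjoint_mat_unit[OF that(1-3) fr] that(4))
      show ?thesis
      proof
        assume L: "\<forall>\<mu>'\<in>orbit_Sa n lam S a. value_at n \<mu>' p = 0"
        show "\<forall>x\<in>orbit_points f. peval x p = 0"
        proof
          fix x assume "x \<in> orbit_points f"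
          then obtain g h where g: "g \<in> unitriangular n" "h \<in> carrier_mat n n" "g * h = 1\<^sub>m n"
            "\<And>\<delta>. \<delta> \<in> roots n \<Longrightarrow> x \<delta> = coadjoint_entry n f g h \<delta>" by (auto simp: orbit_points_def)
          have "value_at n (coadjoint n g \<mu>) p = 0"
            using L g(1) by (auto simp: orbit_Sa_def \<mu>_def)
          then show "peval x p = 0" using val_orbit[OF g] by simp
        qed
      next
        assume R: "\<forall>x\<in>orbit_points f. peval x p = 0"
        show "\<forall>\<mu>'\<in>orbit_Sa n lam S a. value_at n \<mu>' p = 0"
        proof
          fix \<mu>' assume "\<mu>' \<in> orbit_Sa n lam S a"
          then obtain g where g: "g \<in> unitriangular n" and \<mu>': "\<mu>' = coadjoint n g \<mu>"
            by (auto simp: orbit_Sa_def \<mu>_def)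
          obtain h where h: "h \<in> carrier_mat n n" "g * h = 1\<^sub>m n" "h * g = 1\<^sub>m n"
            by (rule unitriangular_inverse[OF g])
          have "coadjoint_entry n f g h \<in> orbit_points f"
            using g h by (auto simp: orbit_points_def)
          then show "value_at n \<mu>' p = 0" using val_orbit[OF g h(1,2)] R by (simp add: \<mu>')
        qed
      qed
    qed
    then have "ideal_Sa n lam S a = {p \<in> carrier (sym_alg n). \<forall>x\<in>orbit_points f. peval x p = 0}"
      by (auto simp: ideal_Sa_def)
    then show ?thesis unfolding gens ideal_eq[OF inf adm] .
  qed
  moreover have "alg_independent mconst G (F_gen n lam S a)"
    unfolding F_gen by (rule alg_independent_F_poly[OF inf])
  ultimately show ?thesis by blast
qed

end
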